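(* Let $P(X)=X^3-\theta_2X^2+\theta_1X-1\in\mathbb{Z}[X]$ be a polynomial with a real root $\alpha\in\,]1,+\infty[$ and two non-real roots. Then to $P$ correspond exactly $2h_{\mathbb{Z}[\alpha]}$ biholomorphism classes of type I Inoue surfaces, where $h_{\mathbb{Z}[\alpha]}$ is the number of equivalence classes of ideals in the order $\mathbb{Z}[\alpha]$; i.e. there are exactly $2h_{\mathbb{Z}[\alpha]}$ biholomorphism classes of type I Inoue surfaces $S^{\beta}_{a,b}$ for which the matrix $M(\beta,a,b)$ has characteristic polynomial $P$.
   Context: $H=\{w\in\mathbb{C}\mid\mathrm{Im}(w)>0\}$, $U=H\times\mathbb{C}$ with coordinates $(w,z)$. A number $\beta\in\mathbb{C}\setminus\mathbb{R}$ with $|\beta|<1$ is admissible if $|\beta|^{-2},\beta,\bar\beta$ are the roots of a polynomial $X^3-\theta_2X^2+\theta_1X-1$ with $\theta_1,\theta_2\in\mathbb{Z}$. For an admissible $\beta$, a pair $(a,b)\in\mathbb{R}^3\times\mathbb{C}^3$ is $\beta$-compatible if $a,b,\bar b$ are linearly independent over $\mathbb{C}$ and, $Q$ being the matrix with columns $a,b,\bar b$, $$M(\beta,a,b):=Q\,\mathrm{diag}(|\beta|^{-2},\beta,\bar\beta)\,Q^{-1}\in M_3(\mathbb{Z}).$$ The type I Inoue surfaces are the compact complex surfaces $S^{\beta}_{a,b}=U/G(\beta,a,b)$, with $\beta$ admissible and $(a,b)$ $\beta$-compatible, where $G(\beta,a,b)$ is the group (acting properly discontinuously on $U$) generated by $(w,z)\mapsto(|\beta|^{-2}w,\beta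 z)$ and $(w,z)\mapsto(w+a_i,z+b_i)$, $1\le i\le 3$. The polynomial $P$ is irreducible in $\mathbb{Q}[X]$, so $\mathbb{Z}[\alpha]$ is an order in the cubic field $\mathbb{Q}(\alpha)$ (not necessarily maximal). Two nonzero ideals $I,J$ of $\mathbb{Z}[\alpha]$ (not necessarily invertible) are equivalent if $xI=yJ$ for some nonzero $x,y\in\mathbb{Z}[\alpha]$; the set of equivalence classes is finite. *)

theory Defs
  imports
    "HOL-Analysis.Analysis"
    "HOL-Computational_Algebra.Polynomial"
    "HOL-Algebra.Generated_Groups"
    "HOL-Algebra.Group_Action"
    "HOL-Algebra.Ideal"
begin

section \<open>Holomorphic maps between complex surfaces\<close>

text \<open>Real differentiability with a complex-linear derivative. It is only meant for open \<open>S\<close>,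
  since the derivative is taken at \<open>p\<close> and not within \<open>S\<close>.\<close>

definition holomorphic2_on ::
    "(complex \<times> complex \<Rightarrow> complex \<times> complex) \<Rightarrow> (complex \<times> complex) set \<Rightarrow> bool" where
  "holomorphic2_on f S \<longleftrightarrow>
     (\<forall>p\<in>S. \<exists>f'. (f has_derivative f') (at p) \<and>
        (\<forall>c v. f' (c * fst v, c * snd v) = (c * fst (f' v), c * snd (f' v))))"

text \<open>A topological space together with an atlas; a chart \<open>(D, \<phi>)\<close> consists of an open subset \<open>D\<close>
  of the space and of a homeomorphism \<open>\<phi>\<close> from \<open>D\<close> onto an open subset of \<open>\<complex>\<^sup>2\<close>, whose values
  outside \<open>D\<close> are irrelevant.\<close>

record 'm complex_surface =
  topo :: "'m topology"
  charts :: "('m set \<times> ('m \<Rightarrow> complex \<times> complex)) set"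

definition holomorphic_map ::
    "'m complex_surface \<Rightarrow> 'n complex_surface \<Rightarrow> ('m \<Rightarrow> 'n) \<Rightarrow> bool" where
  "holomorphic_map X Y F \<longleftrightarrow>
     continuous_map (topo X) (topo Y) F \<and>
     (\<forall>(D, \<phi>)\<in>charts X. \<forall>(E, \<psi>)\<in>charts Y.
        holomorphic2_on (\<psi> \<circ> F \<circ> inv_into D \<phi>) (\<phi> ` (D \<inter> F -` E)))"

definition biholomorphic :: "'m complex_surface \<Rightarrow> 'n complex_surface \<Rightarrow> bool" where
  "biholomorphic X Y \<longleftrightarrow>
     (\<exists>F G. holomorphic_map X Y F \<and> holomorphic_map Y X G \<and>
        (\<forall>x\<in>topspace (topo X). G (F x) = x) \<and>
        (\<forall>y\<in>topspace (topo Y). F (G y) = y))"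


section \<open>Quotients of open subsets of \<open>\<complex>\<^sup>2\<close>\<close>

definition quotient_topology :: "'a topology \<Rightarrow> ('a \<Rightarrow> 'b) \<Rightarrow> 'b topology" where
  "quotient_topology X q =
     topology (\<lambda>V. V \<subseteq> q ` topspace X \<and> openin X {x \<in> topspace X. q x \<in> V})"

lemma openin_quotient_topology:
  "openin (quotient_topology X q) V \<longleftrightarrow>
     V \<subseteq> q ` topspace X \<and> openin X {x \<in> topspace X. q x \<in> V}"
proof -
  let ?P = "\<lambda>V. V \<subseteq> q ` topspace X \<and> openin X {x \<in> topspace X. q x \<in> V}"
  have "istopology ?P"
    unfolding istopology_def
  proof (intro conjI allI impI)
    fix S T assume S: "?P S" and T: "?P T"
    then show "S \<inter> T \<subseteq> q ` topspace X" by blast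
    have "{x \<in> topspace X. q x \<in> S \<inter> T} = {x \<in> topspace X. q x \<in> S} \<inter> {x \<in> topspace X. q x \<in> T}"
      by blast
    also have "openin X \<dots>" using S T by (intro openin_Int) blast+
    finally show "openin X {x \<in> topspace X. q x \<in> S \<inter> T}" .
  next
    fix \<K> assume K: "\<forall>V\<in>\<K>. ?P V"
    then show "\<Union>\<K> \<subseteq> q ` topspace X" by blast
    have "{x \<in> topspace X. q x \<in> \<Union>\<K>} = (\<Union>V\<in>\<K>. {x \<in> topspace X. q x \<in> V})"
      by blast
    also have "openin X \<dots>" using K by (intro openin_Union) blast
    finally show "openin X {x \<in> topspace X. q x \<in> \<Union>\<K>}" .
  qed
  then show ?thesis
    unfolding quotient_topology_def by (simp only: topology_inverse')
qed

lemma topspace_quotient_topology: "topspace (quotient_topology X q) = q ` topspace X"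
proof
  show "topspace (quotient_topology X q) \<subseteq> q ` topspace X"
    using openin_topspace[of "quotient_topology X q"] unfolding openin_quotient_topology by (rule conjunct1)
  have "{x \<in> topspace X. q x \<in> q ` topspace X} = topspace X" by blast
  then have "openin (quotient_topology X q) (q ` topspace X)"
    unfolding openin_quotient_topology by (simp only: openin_topspace subset_refl)
  then show "q ` topspace X \<subseteq> topspace (quotient_topology X q)"
    by (rule openin_subset)
qed

lemma quotient_map_quotient_topology: "quotient_map X (quotient_topology X q) q"
  unfolding quotient_map_def topspace_quotient_topology openin_quotient_topology by blast

text \<open>The points of the quotient of \<open>U\<close> by a group \<open>G\<close> of transformations of \<open>U\<close> are the orbits.
  The charts are the local inverses of the projection \<open>\<pi>\<close>: there is one for each open subset \<open>V\<close>
  of \<open>U\<close> on which \<open>\<pi>\<close> is injective. For a free and properly discontinuous action by biholomorphic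
  transformations they form an atlas of the unique complex structure for which \<open>\<pi>\<close> is locally
  biholomorphic.\<close>

definition quotient_surface ::
    "(complex \<times> complex) set \<Rightarrow> (complex \<times> complex \<Rightarrow> complex \<times> complex) monoid
      \<Rightarrow> (complex \<times> complex) set complex_surface" where
  "quotient_surface U G =
     (let \<pi> = orbit G (\<lambda>g. g) in
       \<lparr>topo = quotient_topology (top_of_set U) \<pi>,
        charts = {(\<pi> ` V, inv_into V \<pi>) | V. open V \<and> V \<subseteq> U \<and> inj_on \<pi> V}\<rparr>)"

lemma topspace_quotient_surface:
  "topspace (topo (quotient_surface U G)) = orbits G U (\<lambda>g. g)"
  by (auto simp: quotient_surface_def Let_def topspace_quotient_topology orbits_def)


section \<open>Inoue surfaces of type I\<close>

definition inoue_cubic :: "int \<Rightarrow> int \<Rightarrow> int poly" where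
  "inoue_cubic \<theta>1 \<theta>2 = [:-1, \<theta>1, -\<theta>2, 1:]"

lemma poly_inoue_cubic:
  fixes x :: "'a::comm_ring_1"
  shows "poly (map_poly of_int (inoue_cubic \<theta>1 \<theta>2)) x
     = x ^ 3 - of_int \<theta>2 * x ^ 2 + of_int \<theta>1 * x - 1"
  by (simp add: inoue_cubic_def map_poly_pCons algebra_simps power2_eq_square power3_eq_cube)

text \<open>For \<open>\<beta> \<notin> \<real>\<close> and \<open>|\<beta>| < 1\<close> the three numbers below are pairwise distinct, so that multiplicities
  play no role.\<close>

definition admissible :: "complex \<Rightarrow> bool" where
  "admissible \<beta> \<longleftrightarrow> \<beta> \<notin> \<real> \<and> norm \<beta> < 1 \<and>
     (\<exists>\<theta>1 \<theta>2. {x. poly (map_poly of_int (inoue_cubic \<theta>1 \<theta>2)) x = 0} =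
        {of_real (1 / (norm \<beta>)\<^sup>2), \<beta>, cnj \<beta>})"

definition inoue_Q :: "real^3 \<Rightarrow> complex^3 \<Rightarrow> complex^3^3" where
  "inoue_Q a b = transpose (vector [\<chi> i. of_real (a $ i), b, \<chi> i. cnj (b $ i)])"

definition inoue_diag :: "complex \<Rightarrow> complex^3^3" where
  "inoue_diag \<beta> =
     (\<chi> i j. if i = j then (vector [of_real (1 / (norm \<beta>)\<^sup>2), \<beta>, cnj \<beta>] :: complex^3) $ i else 0)"

definition inoue_M :: "complex \<Rightarrow> real^3 \<Rightarrow> complex^3 \<Rightarrow> complex^3^3" where
  "inoue_M \<beta> a b = inoue_Q a b ** inoue_diag \<beta> ** matrix_inv (inoue_Q a b)"

text \<open>Linear independence is that of the family \<open>a, b, cnj b\<close> and not of the set of its members.\<close>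

definition compatible :: "complex \<Rightarrow> real^3 \<Rightarrow> complex^3 \<Rightarrow> bool" where
  "compatible \<beta> a b \<longleftrightarrow>
     (\<forall>r s t :: complex. r *s (\<chi> i. of_real (a $ i)) + s *s b + t *s (\<chi> i. cnj (b $ i)) = 0
        \<longrightarrow> r = 0 \<and> s = 0 \<and> t = 0) \<and>
     (\<forall>i j. inoue_M \<beta> a b $ i $ j \<in> \<int>)"

definition inoue_domain :: "(complex \<times> complex) set" where
  "inoue_domain = {w. Im w > 0} \<times> UNIV"

definition inoue_homothety :: "complex \<Rightarrow> complex \<times> complex \<Rightarrow> complex \<times> complex" where
  "inoue_homothety \<beta> = (\<lambda>(w, z)\<in>inoue_domain. (of_real (1 / (norm \<beta>)\<^sup>2) * w, \<beta> * z))"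

definition inoue_translation ::
    "real^3 \<Rightarrow> complex^3 \<Rightarrow> 3 \<Rightarrow> complex \<times> complex \<Rightarrow> complex \<times> complex" where
  "inoue_translation a b i = (\<lambda>(w, z)\<in>inoue_domain. (w + of_real (a $ i), z + b $ i))"

text \<open>The subgroup of the group of all permutations of \<open>inoue_domain\<close> generated by these maps.\<close>

definition inoue_group ::
    "complex \<Rightarrow> real^3 \<Rightarrow> complex^3 \<Rightarrow> (complex \<times> complex \<Rightarrow> complex \<times> complex) monoid" where
  "inoue_group \<beta> a b = BijGroup inoue_domain
     \<lparr>carrier := generate (BijGroup inoue_domain)
        (insert (inoue_homothety \<beta>) (range (inoue_translation a b)))\<rparr>"

lemma inoue_homothety_in_Bij:
  assumes "\<beta> \<noteq> 0"
  shows "inoue_homothety \<beta> \<in> carrier (BijGroup inoue_domain)"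
proof -
  define k where "k = 1 / (norm \<beta>)\<^sup>2"
  have k: "k > 0" using assms by (simp add: k_def)
  have fold: "inoue_homothety \<beta> = (\<lambda>(w, z)\<in>inoue_domain. (of_real k * w, \<beta> * z))"
    unfolding inoue_homothety_def k_def ..
  have "bij_betw (inoue_homothety \<beta>) inoue_domain inoue_domain"
    unfolding fold
  proof (rule bij_betwI[where g = "\<lambda>(w, z). (w / of_real k, z / \<beta>)"], goal_cases)
    case 1
    show ?case using k by (auto simp: inoue_domain_def)
  next
    case 2
    show ?case using k by (auto simp: inoue_domain_def)
  next
    case (3 p)
    then show ?case using k assms by (cases p) simp
  next
    case (4 p)
    obtain w z where p: "p = (w, z)" by (cases p)
    with 4 have "(w / of_real k, z / \<beta>) \<in> inoue_domain" using k by (simp add: inoue_domain_def)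
    then show ?case using k assms by (simp add: p)
  qed
  then show ?thesis by (simp add: BijGroup_def Bij_def inoue_homothety_def)
qed

lemma inoue_translation_in_Bij:
  "inoue_translation a b i \<in> carrier (BijGroup inoue_domain)"
proof -
  have "bij_betw (inoue_translation a b i) inoue_domain inoue_domain"
    by (rule bij_betwI[where g = "\<lambda>(w, z). (w - of_real (a $ i), z - b $ i)"])
       (auto simp: inoue_translation_def inoue_domain_def)
  then show ?thesis by (simp add: BijGroup_def Bij_def inoue_translation_def)
qed

definition inoue_surface ::
    "complex \<Rightarrow> real^3 \<Rightarrow> complex^3 \<Rightarrow> (complex \<times> complex) set complex_surface" where
  "inoue_surface \<beta> a b = quotient_surface inoue_domain (inoue_group \<beta> a b)"

definition charpoly :: "'a::comm_ring_1^'n^'n \<Rightarrow> 'a poly" where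
  "charpoly A = det (mat [:0, 1:] - (\<chi> i j. [:A $ i $ j:]))"

definition inoue_surfaces :: "int poly \<Rightarrow> (complex \<times> complex) set complex_surface set" where
  "inoue_surfaces P = {inoue_surface \<beta> a b | \<beta> a b.
     admissible \<beta> \<and> compatible \<beta> a b \<and> charpoly (inoue_M \<beta> a b) = map_poly of_int P}"

definition inoue_classes :: "int poly \<Rightarrow> (complex \<times> complex) set complex_surface set set" where
  "inoue_classes P =
     inoue_surfaces P // {(X, Y) \<in> inoue_surfaces P \<times> inoue_surfaces P. biholomorphic X Y}"


section \<open>Ideal classes of the order \<open>\<int>[\<alpha>]\<close>\<close>

definition Z_adjoin :: "real \<Rightarrow> real ring" where
  "Z_adjoin \<alpha> = \<lparr>carrier = {poly (map_poly of_int p) \<alpha> | p :: int poly. True},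
     mult = (*), one = 1, zero = 0, add = (+)\<rparr>"

definition nonzero_ideals :: "real \<Rightarrow> real set set" where
  "nonzero_ideals \<alpha> = {I. ideal I (Z_adjoin \<alpha>) \<and> I \<noteq> {0}}"

text \<open>Equivalence of not necessarily invertible ideals: the quotient is in general only a monoid,
  larger than the Picard group.\<close>

definition ideal_equiv :: "real \<Rightarrow> (real set \<times> real set) set" where
  "ideal_equiv \<alpha> = {(I, J) \<in> nonzero_ideals \<alpha> \<times> nonzero_ideals \<alpha>.
     \<exists>x\<in>carrier (Z_adjoin \<alpha>). \<exists>y\<in>carrier (Z_adjoin \<alpha>).
       x \<noteq> 0 \<and> y \<noteq> 0 \<and> (\<lambda>t. x * t) ` I = (\<lambda>t. y * t) ` J}"

definition ideal_class_number :: "real \<Rightarrow> nat" where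
  "ideal_class_number \<alpha> = card (nonzero_ideals \<alpha> // ideal_equiv \<alpha>)"

end

theory Submission
  imports Defs "HOL-Complex_Analysis.Complex_Analysis"
begin

text \<open>Write \<open>\<Lambda> \<subseteq> \<real> \<times> \<complex>\<close> for the lattice generated by the pairs \<open>(a\<^sub>i, b\<^sub>i)\<close>; it is stable under multiplication
  by \<open>(\<alpha>, \<beta>)\<close>, and the surface depends only on \<open>\<beta>\<close> and \<open>\<Lambda>\<close>. A biholomorphism between two such surfaces
  lifts to a map \<open>f\<close> of \<open>U\<close> which is equivariant for an isomorphism of the groups, and the cubic equation
  forces it to carry translations to translations. Hence each component of \<open>f\<close> changes by a constant under
  every element of \<open>\<Lambda>\<close>, and Liouville's theorem in \<open>z\<close> together with the identity theorem in \<open>w\<close> shows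
  that \<open>f\<close> is affine. Comparing linear parts, the two values of \<open>\<beta>\<close> agree and the projections
  of the two lattices to \<open>\<real>\<close> are proportional. Up to a real factor such a projection is a nonzero ideal
  of \<open>\<int>[\<alpha>]\<close>, every ideal class occurs, and the second component is recovered from the first through the
  embedding \<open>\<alpha> \<mapsto> \<beta>\<close>. So the classes correspond to pairs of one of the two non-real roots and an ideal class.
  The class number is finite by the usual argument: if \<open>d\<close> has minimal norm in the ideal \<open>J\<close>, then a
  fixed multiple of \<open>J\<close> lies in \<open>d \<int>[\<alpha>]\<close>.\<close>

section \<open>Lifting maps between quotient surfaces\<close>

text \<open>The embedding \<open>\<alpha> \<mapsto> \<beta>\<close> is handled through integer
  polynomials: a lattice built from an ideal consists of pairs
  \<open>(ipoly p \<alpha>, ipoly p \<beta>)\<close>. For this to define a map, the two values must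
  vanish together, and that comes from dynamics: multiplication by
  \<open>(\<alpha>, \<beta>)\<close> expands the first coordinate and contracts the second, so a
  vector of a discrete invariant lattice with one zero coordinate can be pushed arbitrarily close to
  the origin. Run backwards, the same action yields arbitrarily small real periods, the accumulation
  that the identity theorem feeds on. The cubic equation separates translations from homotheties
  through its value at \<open>1\<close>, which is \<open>\<theta>1 - \<theta>2\<close> and does not
  vanish. A basis of an ideal is built only when the ideal contains a given positive integer. The
  approximation argument that bounds the class number also moves every ideal, within its class, to
  one with this property; it thus serves both for finiteness and for showing that every class
  occurs.\<close>

lemma holomorphic2_on_pointwise: "holomorphic2_on f S \<longleftrightarrow> (\<forall>p\<in>S. holomorphic2_on f {p})"
  by (simp add: holomorphic2_on_def)

lemma holomorphic2_on_subset: "holomorphic2_on f S \<Longrightarrow> T \<subseteq> S \<Longrightarrow> holomorphic2_on f T"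
  by (auto simp: holomorphic2_on_def)

lemma holomorphic2_on_compose:
  assumes "holomorphic2_on f S" "holomorphic2_on g T" "f ` S \<subseteq> T"
  shows "holomorphic2_on (\<lambda>x. g (f x)) S"
  unfolding holomorphic2_on_def
proof
  fix p assume p: "p \<in> S"
  obtain f' where f: "(f has_derivative f') (at p)"
      "\<And>c v. f' (c * fst v, c * snd v) = (c * fst (f' v), c * snd (f' v))"
    using assms(1) p unfolding holomorphic2_on_def by metis
  obtain g' where g: "(g has_derivative g') (at (f p))"
      "\<And>c v. g' (c * fst v, c * snd v) = (c * fst (g' v), c * snd (g' v))"
    using assms(2,3) p unfolding holomorphic2_on_def by (metis image_subset_iff)
  have "((\<lambda>x. g (f x)) has_derivative (\<lambda>x. g' (f' x))) (at p)"
    using diff_chain_at[OF f(1) g(1)] by (simp add: o_def)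
  then show "\<exists>h'. ((\<lambda>x. g (f x)) has_derivative h') (at p) \<and>
      (\<forall>c v. h' (c * fst v, c * snd v) = (c * fst (h' v), c * snd (h' v)))"
    using f(2) g(2) by (intro exI[of _ "\<lambda>x. g' (f' x)"]) simp
qed

lemma holomorphic2_on_cong_near:
  assumes "holomorphic2_on f {p}" "open W" "\<And>x. x \<in> W \<Longrightarrow> f x = g x" "p \<in> W"
  shows "holomorphic2_on g {p}"
  using assms has_derivative_transform_within_open[of f _ p UNIV W g]
  by (fastforce simp: holomorphic2_on_def)

lemma holomorphic2_on_imp_continuous_on:
  assumes "holomorphic2_on f S" shows "continuous_on S f"
proof (rule continuous_at_imp_continuous_on, rule ballI)
  fix x assume "x \<in> S"
  then show "isCont f x"
    using assms has_derivative_continuous unfolding holomorphic2_on_def by blast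
qed

text \<open>Composites and inverses are only required to exist as elements with the right action on
  \<open>U\<close>, so the axioms can be checked on the explicit maps \<open>inoue_act\<close>. The
  axiom \<open>wandering\<close> merges freeness with proper discontinuity: an element returning a
  point of \<open>V\<close> to \<open>V\<close> acts trivially on all of \<open>U\<close>.\<close>

locale free_pd_action =
  fixes U :: "(complex \<times> complex) set"
    and G :: "(complex \<times> complex \<Rightarrow> complex \<times> complex) monoid"
  assumes open_U: "open U"
    and act_in: "g \<in> carrier G \<Longrightarrow> x \<in> U \<Longrightarrow> g x \<in> U"
    and act_one: "\<exists>e\<in>carrier G. \<forall>x\<in>U. e x = x"
    and act_mult: "g \<in> carrier G \<Longrightarrow> h \<in> carrier G \<Longrightarrow> \<exists>k\<in>carrier G. \<forall>x\<in>U. k x = g (h x)"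
    and act_inv: "g \<in> carrier G \<Longrightarrow> \<exists>h\<in>carrier G. \<forall>x\<in>U. h (g x) = x \<and> g (h x) = x"
    and act_hol: "g \<in> carrier G \<Longrightarrow> holomorphic2_on g U"
    and wandering: "p \<in> U \<Longrightarrow>
      \<exists>V. open V \<and> p \<in> V \<and> V \<subseteq> U \<and> (\<forall>g\<in>carrier G. \<forall>x\<in>V. g x \<in> V \<longrightarrow> (\<forall>y\<in>U. g y = y))"
begin

abbreviation "proj \<equiv> orbit G (\<lambda>g. g)"
abbreviation "quot \<equiv> quotient_surface U G"

lemma act_cont: "g \<in> carrier G \<Longrightarrow> continuous_on U g"
  by (rule holomorphic2_on_imp_continuous_on[OF act_hol])

lemma proj_eq_iff:
  assumes "x \<in> U" "y \<in> U"
  shows "proj x = proj y \<longleftrightarrow> (\<exists>g\<in>carrier G. x = g y)"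
proof
  assume "proj x = proj y"
  moreover obtain e where "e \<in> carrier G" "\<forall>x\<in>U. e x = x" using act_one by blast
  then have "x \<in> proj x" using assms(1) by (auto simp: orbit_def intro!: exI[of _ e])
  ultimately show "\<exists>g\<in>carrier G. x = g y" by (auto simp: orbit_def)
next
  have *: "proj (g y) \<subseteq> proj y" if g: "g \<in> carrier G" and y: "y \<in> U" for g y
  proof
    fix t assume "t \<in> proj (g y)"
    then obtain h where h: "h \<in> carrier G" "t = h (g y)" by (auto simp: orbit_def)
    obtain k where "k \<in> carrier G" "\<forall>x\<in>U. k x = h (g x)" using act_mult[OF h(1) g] by blast
    then show "t \<in> proj y" using h y by (auto simp: orbit_def intro!: exI[of _ k])
  qed
  assume "\<exists>g\<in>carrier G. x = g y"
  then obtain g where g: "g \<in> carrier G" "x = g y" by blast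
  obtain h where h: "h \<in> carrier G" "\<forall>x\<in>U. h (g x) = x" using act_inv[OF g(1)] by blast
  then have "y = h x" using g assms by simp
  then show "proj x = proj y" using *[OF g(1) assms(2)] *[OF h(1) assms(1)] g(2) by auto
qed

lemma proj_act: "g \<in> carrier G \<Longrightarrow> x \<in> U \<Longrightarrow> proj (g x) = proj x"
  using proj_eq_iff act_in by blast

text \<open>Following \<open>g\<close> by an inverse of \<open>h\<close> gives an element fixing
  \<open>x\<close>, and \<open>wandering\<close> turns one fixed point into a trivial
  action.\<close>

lemma free:
  assumes "g \<in> carrier G" "h \<in> carrier G" "x \<in> U" "g x = h x" "y \<in> U"
  shows "g y = h y"
proof -
  obtain h' where h': "h' \<in> carrier G" "\<forall>x\<in>U. h' (h x) = x \<and> h (h' x) = x"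
    using act_inv[OF assms(2)] by blast
  obtain k where k: "k \<in> carrier G" "\<forall>x\<in>U. k x = h' (g x)" using act_mult[OF h'(1) assms(1)] by blast
  have "k x = x" using k h' assms by simp
  then have "k y = y" using wandering[OF assms(3)] k(1) assms(5) by metis
  then have "h' (g y) = y" using k assms(5) by simp
  then have "h (h' (g y)) = h y" by simp
  then show ?thesis using h' act_in[OF assms(1,5)] by simp
qed

lemma image_act_eq:
  assumes g: "g \<in> carrier G" and h: "\<forall>x\<in>U. h (g x) = x \<and> g (h x) = x" "h \<in> carrier G" and "V \<subseteq> U"
  shows "g ` V = U \<inter> h -` V"
  using assms act_in by (force simp: image_iff)

lemma open_image_act:
  assumes g: "g \<in> carrier G" and V: "open V" "V \<subseteq> U"
  shows "open (g ` V)"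
proof -
  obtain h where h: "h \<in> carrier G" "\<forall>x\<in>U. h (g x) = x \<and> g (h x) = x" using act_inv[OF g] by blast
  show ?thesis
    unfolding image_act_eq[OF g h(2,1) V(2)]
    using continuous_open_preimage[OF act_cont[OF h(1)] open_U V(1)] .
qed

lemma topspace_quot: "topspace (topo quot) = proj ` U"
  by (auto simp: topspace_quotient_surface orbits_def)

lemma quotient_map_proj: "quotient_map (top_of_set U) (topo quot) proj"
  using quotient_map_quotient_topology[of "top_of_set U" proj]
  by (simp add: quotient_surface_def Let_def)

lemma continuous_map_proj: "continuous_map (top_of_set U) (topo quot) proj"
  by (rule quotient_imp_continuous_map[OF quotient_map_proj])

text \<open>The saturation of \<open>V\<close> is the union of its translates under
  \<open>G\<close>, and these are open.\<close>

lemma openin_proj_image: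
  assumes V: "open V" "V \<subseteq> U"
  shows "openin (topo quot) (proj ` V)"
proof -
  have "{x \<in> U. proj x \<in> proj ` V} = (\<Union>g\<in>carrier G. g ` V)"
  proof (intro equalityI subsetI)
    fix x assume "x \<in> {x \<in> U. proj x \<in> proj ` V}"
    then obtain v where "x \<in> U" "v \<in> V" "proj x = proj v" by auto
    then obtain g where "g \<in> carrier G" "x = g v" using V proj_eq_iff[of x v] by blast
    then show "x \<in> (\<Union>g\<in>carrier G. g ` V)" using \<open>v \<in> V\<close> by blast
  next
    fix x assume "x \<in> (\<Union>g\<in>carrier G. g ` V)"
    then obtain g v where "g \<in> carrier G" "v \<in> V" "x = g v" by auto
    moreover from this have "x \<in> U" using act_in V by blast
    ultimately show "x \<in> {x \<in> U. proj x \<in> proj ` V}" using V proj_eq_iff[of x v] by blast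
  qed
  moreover have "open (\<Union>g\<in>carrier G. g ` V)" using open_image_act[OF _ V] by blast
  ultimately have "openin (top_of_set U) {x \<in> U. proj x \<in> proj ` V}"
    using open_U by (auto simp: openin_open_eq)
  then show ?thesis
    using V by (auto simp: quotient_surface_def Let_def openin_quotient_topology)
qed

lemma obtain_chart:
  assumes "p \<in> U"
  obtains V where "open V" "p \<in> V" "V \<subseteq> U" "inj_on proj V"
    "\<forall>g\<in>carrier G. \<forall>x\<in>V. g x \<in> V \<longrightarrow> (\<forall>y\<in>U. g y = y)"
proof -
  obtain V where V: "open V" "p \<in> V" "V \<subseteq> U"
      "\<forall>g\<in>carrier G. \<forall>x\<in>V. g x \<in> V \<longrightarrow> (\<forall>y\<in>U. g y = y)"
    using wandering[OF assms] by blast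
  have "inj_on proj V"
  proof (rule inj_onI)
    fix x y assume xy: "x \<in> V" "y \<in> V" "proj x = proj y"
    then obtain g where "g \<in> carrier G" "x = g y" using proj_eq_iff[of x y] V by blast
    then have "\<forall>z\<in>U. g z = z" using V(4) xy(1,2) by blast
    then show "x = y" using xy(2) V(3) \<open>x = g y\<close> by auto
  qed
  then show ?thesis using that V by blast
qed

lemma charts_quot: "charts quot = {(proj ` V, inv_into V proj) | V. open V \<and> V \<subseteq> U \<and> inj_on proj V}"
  by (simp add: quotient_surface_def Let_def)

text \<open>Since \<open>proj\<close> is open, it embeds \<open>V\<close> into the quotient, and a
  section with values in \<open>V\<close> inherits the continuity of \<open>\<Phi>\<close>. This is
  what makes each sheet of the pulled back covering homeomorphic to its base.\<close>

lemma continuous_on_local_section: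
  assumes V: "open V" "V \<subseteq> U" "inj_on proj V"
    and \<Phi>: "continuous_map (top_of_set T) (topo quot) \<Phi>"
    and s: "\<And>x. x \<in> T \<Longrightarrow> s x \<in> V \<and> proj (s x) = \<Phi> x"
  shows "continuous_on T s"
  unfolding continuous_openin_preimage_eq
proof (intro allI impI)
  fix W :: "(complex \<times> complex) set" assume W: "open W"
  have "T \<inter> s -` W = {x \<in> topspace (top_of_set T). \<Phi> x \<in> proj ` (V \<inter> W)}"
  proof (intro equalityI subsetI)
    fix x assume x: "x \<in> T \<inter> s -` W"
    then have "\<Phi> x = proj (s x)" "s x \<in> V \<inter> W" using s[of x] by auto
    then show "x \<in> {x \<in> topspace (top_of_set T). \<Phi> x \<in> proj ` (V \<inter> W)}" using x by auto
  next
    fix x assume "x \<in> {x \<in> topspace (top_of_set T). \<Phi> x \<in> proj ` (V \<inter> W)}"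
    then obtain v where "x \<in> T" "v \<in> V" "v \<in> W" "\<Phi> x = proj v" by auto
    then have "s x = v" using s[of x] V(3) by (metis inj_onD)
    then show "x \<in> T \<inter> s -` W" using \<open>x \<in> T\<close> \<open>v \<in> W\<close> by auto
  qed
  then show "openin (top_of_set T) (T \<inter> s -` W)"
    using openin_continuous_map_preimage[OF \<Phi> openin_proj_image[of "V \<inter> W"]] V W by auto
qed

text \<open>The sets \<open>A g\<close> on which \<open>f\<close> agrees with
  \<open>g \<circ> f'\<close> are open by \<open>wandering\<close>, cover \<open>S\<close>, and by
  freeness meet only where they coincide. Connectedness leaves a single one.\<close>

lemma lift_unique:
  assumes S: "connected S" "S \<noteq> {}" and f: "continuous_on S f" "f ` S \<subseteq> U"
    and f': "continuous_on S f'" "f' ` S \<subseteq> U"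
    and eq: "\<And>x. x \<in> S \<Longrightarrow> proj (f x) = proj (f' x)"
  obtains g where "g \<in> carrier G" "\<And>x. x \<in> S \<Longrightarrow> f x = g (f' x)"
proof -
  define A where "A g = {x \<in> S. f x = g (f' x)}" for g
  have opn: "openin (top_of_set S) (A g)" if g: "g \<in> carrier G" for g
  proof (subst openin_subopen, intro ballI)
    fix x assume x: "x \<in> A g"
    then have xS: "x \<in> S" "f x = g (f' x)" by (auto simp: A_def)
    have "f x \<in> U" using xS f by blast
    then obtain V where V: "open V" "f x \<in> V" "V \<subseteq> U" "inj_on proj V"
      and wand: "\<forall>g\<in>carrier G. \<forall>x\<in>V. g x \<in> V \<longrightarrow> (\<forall>y\<in>U. g y = y)"
      by (rule obtain_chart)
    define N where "N = (S \<inter> f -` V) \<inter> (S \<inter> (\<lambda>y. g (f' y)) -` V)"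
    have cg: "continuous_on S (\<lambda>y. g (f' y))"
      using continuous_on_compose2[OF act_cont[OF g] f'(1)] f'(2) by simp
    have "openin (top_of_set S) N" unfolding N_def
      using continuous_openin_preimage_gen[OF f(1) V(1)] continuous_openin_preimage_gen[OF cg V(1)]
      by (rule openin_Int)
    moreover have "x \<in> N" using xS V by (auto simp: N_def)
    moreover have "N \<subseteq> A g"
    proof
      fix y assume "y \<in> N"
      then have y: "y \<in> S" "f y \<in> V" "g (f' y) \<in> V" by (auto simp: N_def)
      have "f y \<in> U" "f' y \<in> U" using f f' y by auto
      then have "proj (f y) = proj (g (f' y))" using eq y g proj_act by simp
      then obtain k where k: "k \<in> carrier G" "f y = k (g (f' y))"
        using proj_eq_iff[of "f y" "g (f' y)"] V y by blast
      have "k (g (f' y)) = g (f' y)" using wand[rule_format, OF k(1) y(3), of "g (f' y)"] k(2) y V(3)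
        by (simp add: subsetD)
      then show "y \<in> A g" using k(2) y by (simp add: A_def)
    qed
    ultimately show "\<exists>N. openin (top_of_set S) N \<and> x \<in> N \<and> N \<subseteq> A g" by blast
  qed
  have cover: "\<exists>g\<in>carrier G. x \<in> A g" if "x \<in> S" for x
  proof -
    have "f x \<in> U" "f' x \<in> U" using f f' that by auto
    then show ?thesis using proj_eq_iff eq[OF that] that unfolding A_def by blast
  qed
  obtain x0 where "x0 \<in> S" using S by blast
  then obtain g where g: "g \<in> carrier G" "x0 \<in> A g" using cover by blast
  have "S - A g = \<Union> {A k | k. k \<in> carrier G \<and> A k \<inter> A g = {}}"
  proof (intro equalityI subsetI)
    fix x assume x: "x \<in> S - A g"
    then obtain k where k: "k \<in> carrier G" "x \<in> A k" using cover by blast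
    have "A k \<inter> A g = {}"
    proof (rule ccontr)
      assume "A k \<inter> A g \<noteq> {}"
      then obtain z where "z \<in> A k" "z \<in> A g" by blast
      then have z: "f' z \<in> U" "k (f' z) = g (f' z)" using f'(2) by (auto simp: A_def)
      have "f' x \<in> U" using x f'(2) by blast
      then have "k (f' x) = g (f' x)" by (rule free[OF k(1) g(1) z])
      then show False using x k(2) by (simp add: A_def)
    qed
    then show "x \<in> \<Union> {A k | k. k \<in> carrier G \<and> A k \<inter> A g = {}}" using k by blast
  qed (auto simp: A_def)
  then have "openin (top_of_set S) (S - A g)" using opn by auto
  then have "A g = S"
    using S(1) opn[OF g(1)] g(2) unfolding connected_clopen
    by (auto simp: closedin_def A_def)
  then show ?thesis using that[OF g(1)] by (auto simp: A_def)
qed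

text \<open>The pairs \<open>(p, q)\<close> with \<open>\<Phi> p = proj q\<close> form a covering space of the domain of \<open>\<Phi>\<close> inside
  a normed space, so that the lifting theorem of the library applies to it.\<close>

lemma covering_space_pullback:
  fixes S :: "(complex \<times> complex) set"
  assumes \<Phi>: "continuous_map (top_of_set S) (topo quot) \<Phi>"
  shows "covering_space {(p, q). p \<in> S \<and> q \<in> U \<and> \<Phi> p = proj q} fst S"
proof -
  define E where "E = {(p, q). p \<in> S \<and> q \<in> U \<and> \<Phi> p = proj q}"
  have "\<exists>T. x \<in> T \<and> openin (top_of_set S) T \<and>
      (\<exists>v. \<Union> v = E \<inter> fst -` T \<and> (\<forall>u\<in>v. openin (top_of_set E) u) \<and> pairwise disjnt v \<and>
           (\<forall>u\<in>v. \<exists>q. homeomorphism u T fst q))" if x: "x \<in> S" for x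
  proof -
    have "\<Phi> x \<in> proj ` U" using continuous_map_funspace[OF \<Phi>] x topspace_quot by auto
    then obtain q0 where q0: "q0 \<in> U" "\<Phi> x = proj q0" by blast
    obtain V where V: "open V" "q0 \<in> V" "V \<subseteq> U" "inj_on proj V"
      and wand: "\<forall>g\<in>carrier G. \<forall>x\<in>V. g x \<in> V \<longrightarrow> (\<forall>y\<in>U. g y = y)"
      by (rule obtain_chart[OF q0(1)])
    define T where "T = {p \<in> topspace (top_of_set S). \<Phi> p \<in> proj ` V}"
    have T_open: "openin (top_of_set S) T"
      unfolding T_def using openin_continuous_map_preimage[OF \<Phi> openin_proj_image[OF V(1,3)]] .
    have TS: "T \<subseteq> S" by (auto simp: T_def)
    \<comment> \<open>The sheets over \<open>T\<close> are indexed by group elements through the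
      translates of \<open>V\<close>. Elements acting alike give the same sheet, which is why
      \<open>disj\<close> offers equality as an alternative.\<close>
    define sheet where "sheet g = {(p, q) \<in> E. p \<in> T \<and> q \<in> g ` V}" for g
    have union: "\<Union> (sheet ` carrier G) = E \<inter> fst -` T"
    proof (intro equalityI subsetI)
      fix z assume z: "z \<in> E \<inter> fst -` T"
      obtain p q where pq: "z = (p, q)" by (cases z)
      then have pq': "p \<in> T" "q \<in> U" "\<Phi> p = proj q" using z by (auto simp: E_def)
      then obtain v where "v \<in> V" "proj q = proj v" by (auto simp: T_def)
      then obtain g where "g \<in> carrier G" "q = g v" using proj_eq_iff[of q v] pq' V by blast
      then show "z \<in> \<Union> (sheet ` carrier G)" using pq pq' z \<open>v \<in> V\<close> by (auto simp: sheet_def)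
    qed (auto simp: sheet_def)
    have opn: "openin (top_of_set E) (sheet g)" if g: "g \<in> carrier G" for g
    proof -
      have "sheet g = (E \<inter> fst -` T) \<inter> (E \<inter> snd -` (g ` V))" by (auto simp: sheet_def)
      moreover have "openin (top_of_set E) (E \<inter> fst -` T)"
        by (rule continuous_openin_preimage[OF _ _ T_open]) (auto simp: E_def intro!: continuous_intros)
      moreover have "openin (top_of_set E) (E \<inter> snd -` (g ` V))"
        by (rule continuous_openin_preimage_gen[OF _ open_image_act[OF g V(1,3)]])
           (auto intro!: continuous_intros)
      ultimately show ?thesis by (simp add: openin_Int)
    qed
    have disj: "sheet g = sheet h \<or> disjnt (sheet g) (sheet h)" if g: "g \<in> carrier G" "h \<in> carrier G" for g h
    proof (rule disjCI)
      assume "\<not> disjnt (sheet g) (sheet h)"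
      then obtain z where "z \<in> sheet g" "z \<in> sheet h" by (auto simp: disjnt_def)
      then obtain v w where vw: "v \<in> V" "w \<in> V" "g v = h w" by (auto simp: sheet_def simp del: split_paired_Ex)
      then have "proj v = proj w" using g proj_act V by (metis subsetD)
      then have "v = w" using vw V(4) by (auto dest: inj_onD)
      then have "\<And>y. y \<in> V \<Longrightarrow> g y = h y" using free[OF g, of v] vw V by blast
      then have "g ` V = h ` V" by auto
      then show "sheet g = sheet h" by (simp add: sheet_def)
    qed
    have homeo: "\<exists>q. homeomorphism (sheet g) T fst q" if g: "g \<in> carrier G" for g
    proof -
      define s where "s p = inv_into V proj (\<Phi> p)" for p
      have s: "s p \<in> V \<and> proj (s p) = \<Phi> p" if "p \<in> T" for p
        using that by (auto simp: T_def s_def inv_into_into f_inv_into_f)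
      have "continuous_map (top_of_set T) (topo quot) \<Phi>"
        using continuous_map_from_subtopology[OF \<Phi>, of T] TS by (simp add: subtopology_subtopology Int_absorb1)
      then have cs: "continuous_on T s"
        using continuous_on_local_section[OF V(1,3,4)] s by blast
      have "homeomorphism (sheet g) T fst (\<lambda>p. (p, g (s p)))"
      proof (rule homeomorphismI)
        show "continuous_on (sheet g) fst" by (auto intro!: continuous_intros)
        have "continuous_on T (\<lambda>p. g (s p))"
          by (rule continuous_on_compose2[OF act_cont[OF g] cs]) (use s V in auto)
        then show "continuous_on T (\<lambda>p. (p, g (s p)))" by (auto intro!: continuous_intros)
        show "fst ` sheet g \<subseteq> T" by (auto simp: sheet_def)
        have mem: "(p, g (s p)) \<in> sheet g" if "p \<in> T" for p
        proof -
          have "g (s p) \<in> U" "proj (g (s p)) = \<Phi> p"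
            using act_in[OF g, of "s p"] proj_act[OF g, of "s p"] s[OF that] V by auto
          then show ?thesis using that TS s[OF that] by (auto simp: sheet_def E_def)
        qed
        then show "(\<lambda>p. (p, g (s p))) ` T \<subseteq> sheet g" by blast
        show "(fst z, g (s (fst z))) = z" if "z \<in> sheet g" for z
        proof -
          obtain p v where z: "z = (p, g v)" "v \<in> V" "p \<in> T" "\<Phi> p = proj (g v)"
            using \<open>z \<in> sheet g\<close> by (auto simp: sheet_def E_def)
          then have "proj (s p) = proj v" using s[of p] proj_act[OF g, of v] V by auto
          then have "s p = v" using s[of p] z V by (auto dest: inj_onD)
          then show ?thesis using z by simp
        qed
      qed auto
      then show ?thesis by blast
    qed
    have "x \<in> T" using x q0 V by (auto simp: T_def)
    moreover have "pairwise disjnt (sheet ` carrier G)"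
      unfolding pairwise_def using disj by blast
    ultimately show ?thesis
      using T_open union opn homeo by (intro exI[of _ T] conjI exI[of _ "sheet ` carrier G"]) auto
  qed
  moreover have "fst ` E = S"
  proof (intro equalityI subsetI)
    fix x assume x: "x \<in> S"
    have "\<Phi> x \<in> proj ` U" using continuous_map_funspace[OF \<Phi>] x topspace_quot by auto
    then show "x \<in> fst ` E" using x by (force simp: E_def)
  qed (auto simp: E_def)
  moreover have "continuous_on E fst" by (auto intro!: continuous_intros)
  ultimately have "covering_space E fst S" unfolding covering_space_def by blast
  then show ?thesis by (simp add: E_def)
qed

text \<open>The identity of \<open>S\<close> lifts through the pulled back covering, and the second
  component of this section is the desired lift of \<open>\<Phi>\<close>.\<close>

lemma lift_exists:
  fixes S :: "(complex \<times> complex) set"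
  assumes "continuous_map (top_of_set S) (topo quot) \<Phi>" "simply_connected S" "locally path_connected S"
  obtains f where "continuous_on S f" "f ` S \<subseteq> U" "\<And>x. x \<in> S \<Longrightarrow> proj (f x) = \<Phi> x"
proof -
  obtain s where s: "continuous_on S s" "s \<in> S \<rightarrow> {(p, q). p \<in> S \<and> q \<in> U \<and> \<Phi> p = proj q}"
      "\<And>x. x \<in> S \<Longrightarrow> fst (s x) = x"
    using covering_space_lift[OF covering_space_pullback[OF assms(1)] assms(2,3), of "\<lambda>x. x"] by auto
  show ?thesis
  proof (rule that[of "\<lambda>x. snd (s x)"])
    show "continuous_on S (\<lambda>x. snd (s x))" using s(1) by (auto intro!: continuous_intros)
    have "s x \<in> {(p, q). p \<in> S \<and> q \<in> U \<and> \<Phi> p = proj q}" if "x \<in> S" for x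
      using s(2) that by (rule funcset_mem)
    then show "(\<lambda>x. snd (s x)) ` S \<subseteq> U" "\<And>x. x \<in> S \<Longrightarrow> proj (snd (s x)) = \<Phi> x"
      using s(3) by (fastforce simp: case_prod_beta)+
  qed
qed

end

text \<open>Topology provides a continuous lift of \<open>F \<circ> proj\<close>; near each point it
  equals \<open>F\<close> read in a pair of charts, hence is holomorphic.\<close>

lemma holomorphic_map_lift:
  assumes "free_pd_action U G" "free_pd_action U' G'" and U: "simply_connected U"
    and F: "holomorphic_map (quotient_surface U G) (quotient_surface U' G') F"
  obtains f where "holomorphic2_on f U" "f ` U \<subseteq> U'"
    "\<And>x. x \<in> U \<Longrightarrow> orbit G' (\<lambda>g. g) (f x) = F (orbit G (\<lambda>g. g) x)"
proof -
  interpret X: free_pd_action U G by fact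
  interpret Y: free_pd_action U' G' by fact
  have cF: "continuous_map (topo X.quot) (topo Y.quot) F"
    and hF: "\<And>D \<phi> E \<psi>. (D, \<phi>) \<in> charts X.quot \<Longrightarrow> (E, \<psi>) \<in> charts Y.quot \<Longrightarrow>
      holomorphic2_on (\<psi> \<circ> F \<circ> inv_into D \<phi>) (\<phi> ` (D \<inter> F -` E))"
    using F by (auto simp: holomorphic_map_def)
  obtain f where f: "continuous_on U f" "f ` U \<subseteq> U'" "\<And>x. x \<in> U \<Longrightarrow> Y.proj (f x) = F (X.proj x)"
    using Y.lift_exists[of U "F \<circ> X.proj"] continuous_map_compose[OF X.continuous_map_proj cF] U
      open_imp_locally_path_connected[OF X.open_U] by (auto simp: o_def)
  have "holomorphic2_on f {p}" if p: "p \<in> U" for p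
  proof -
    obtain V where V: "open V" "p \<in> V" "V \<subseteq> U" "inj_on X.proj V"
      by (rule X.obtain_chart[OF p]) blast
    have "f p \<in> U'" using p f(2) by blast
    then obtain V' where V': "open V'" "f p \<in> V'" "V' \<subseteq> U'" "inj_on Y.proj V'"
      by (rule Y.obtain_chart) blast
    define D where "D = X.proj ` V"
    define \<phi> where "\<phi> = inv_into V X.proj"
    define E where "E = Y.proj ` V'"
    define \<psi> where "\<psi> = inv_into V' Y.proj"
    have inj: "inj_on \<phi> D" by (simp add: \<phi>_def D_def inj_on_inv_into)
    have \<phi>: "\<phi> (X.proj x) = x" if "x \<in> V" for x using that V by (simp add: \<phi>_def)
    have inv: "inv_into D \<phi> x = X.proj x" if "x \<in> V" for x
      using inv_into_f_f[OF inj, of "X.proj x"] \<phi>[OF that] that by (simp add: D_def)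
    have "holomorphic2_on (\<psi> \<circ> F \<circ> inv_into D \<phi>) (\<phi> ` (D \<inter> F -` E))"
      using V V' by (intro hF) (auto simp: X.charts_quot Y.charts_quot D_def E_def \<phi>_def \<psi>_def)
    moreover have "{p} \<subseteq> \<phi> ` (D \<inter> F -` E)"
    proof -
      have "X.proj p \<in> D \<inter> F -` E" using V V' f(3)[OF p] by (auto simp: D_def E_def)
      from imageI[OF this, of \<phi>] show ?thesis using \<phi>[OF V(2)] by simp
    qed
    ultimately have "holomorphic2_on (\<psi> \<circ> F \<circ> inv_into D \<phi>) {p}" by (rule holomorphic2_on_subset)
    moreover have "open (V \<inter> (U \<inter> f -` V'))"
      using V(1) continuous_open_preimage[OF f(1) X.open_U V'(1)] by (rule open_Int)
    moreover have "(\<psi> \<circ> F \<circ> inv_into D \<phi>) x = f x" if "x \<in> V \<inter> (U \<inter> f -` V')" for x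
      using that f(3)[of x] V'(4) by (auto simp: inv \<psi>_def inv_into_f_f simp flip: f(3))
    ultimately show ?thesis
      by (rule holomorphic2_on_cong_near) (use p V V' in auto)
  qed
  then have "holomorphic2_on f U" using holomorphic2_on_pointwise by blast
  then show ?thesis using that f by blast
qed

text \<open>Both \<open>f \<circ> g\<close> and \<open>f\<close> lift the same map to the quotient,
  so they differ by one element of \<open>G'\<close>. The lemma asks for no homomorphism property of
  the choice \<open>g \<mapsto> g'\<close>.\<close>

lemma lift_equivariant:
  assumes "free_pd_action U G" "free_pd_action U' G'" and U: "connected U" "U \<noteq> {}"
    and f: "continuous_on U f" "f ` U \<subseteq> U'"
      "\<And>x. x \<in> U \<Longrightarrow> orbit G' (\<lambda>g. g) (f x) = F (orbit G (\<lambda>g. g) x)"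
    and g: "g \<in> carrier G"
  shows "\<exists>g'\<in>carrier G'. \<forall>x\<in>U. f (g x) = g' (f x)"
proof -
  interpret X: free_pd_action U G by fact
  interpret Y: free_pd_action U' G' by fact
  have "continuous_on U (\<lambda>x. f (g x))"
    by (rule continuous_on_compose2[OF f(1) X.act_cont[OF g]]) (use X.act_in[OF g] in blast)
  moreover have "(\<lambda>x. f (g x)) ` U \<subseteq> U'" using f(2) X.act_in[OF g] by blast
  moreover have "Y.proj (f (g x)) = Y.proj (f x)" if "x \<in> U" for x
    using f(3)[OF that] f(3)[OF X.act_in[OF g that]] X.proj_act[OF g that] by simp
  ultimately show ?thesis using Y.lift_unique[OF U _ _ f(1,2)] by metis
qed

lemma holomorphic_map_descend:
  assumes "free_pd_action U G" "free_pd_action U' G'"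
    and f: "holomorphic2_on f U" "f ` U \<subseteq> U'"
    and F: "\<And>x. x \<in> U \<Longrightarrow> F (orbit G (\<lambda>g. g) x) = orbit G' (\<lambda>g. g) (f x)"
  shows "holomorphic_map (quotient_surface U G) (quotient_surface U' G') F"
proof -
  interpret X: free_pd_action U G by fact
  interpret Y: free_pd_action U' G' by fact
  have "continuous_map (top_of_set U) (top_of_set U') f"
    using holomorphic2_on_imp_continuous_on[OF f(1)] f(2) by auto
  then have "continuous_map (top_of_set U) (topo Y.quot) (Y.proj \<circ> f)"
    by (rule continuous_map_compose[OF _ Y.continuous_map_proj])
  then have "continuous_map (top_of_set U) (topo Y.quot) (F \<circ> X.proj)"
    by (rule continuous_map_eq) (simp add: F)
  then have "continuous_map (topo X.quot) (topo Y.quot) F"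
    using continuous_compose_quotient_map[OF X.quotient_map_proj] by blast
  moreover have "holomorphic2_on (\<psi> \<circ> F \<circ> inv_into D \<phi>) (\<phi> ` (D \<inter> F -` E))"
    if "(D, \<phi>) \<in> charts X.quot" "(E, \<psi>) \<in> charts Y.quot" for D \<phi> E \<psi>
  proof -
    from that(1) obtain V where "open V" "V \<subseteq> U" "inj_on X.proj V"
      "(D, \<phi>) = (X.proj ` V, inv_into V X.proj)"
      unfolding X.charts_quot mem_Collect_eq by (elim exE conjE)
    then have V: "open V" "V \<subseteq> U" "inj_on X.proj V" "D = X.proj ` V" "\<phi> = inv_into V X.proj"
      by simp_all
    from that(2) obtain V' where "open V'" "V' \<subseteq> U'" "inj_on Y.proj V'"
      "(E, \<psi>) = (Y.proj ` V', inv_into V' Y.proj)"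
      unfolding Y.charts_quot mem_Collect_eq by (elim exE conjE)
    then have V': "open V'" "V' \<subseteq> U'" "inj_on Y.proj V'" "E = Y.proj ` V'" "\<psi> = inv_into V' Y.proj"
      by simp_all
    have inj: "inj_on \<phi> D" by (simp add: V inj_on_inv_into)
    have \<phi>: "\<phi> (X.proj x) = x" if "x \<in> V" for x using that V by simp
    have inv: "inv_into D \<phi> x = X.proj x" if "x \<in> V" for x
      using inv_into_f_f[OF inj, of "X.proj x"] \<phi>[OF that] that by (simp add: V)
    have "holomorphic2_on (\<psi> \<circ> F \<circ> inv_into D \<phi>) {p}" if "p \<in> \<phi> ` (D \<inter> F -` E)" for p
    proof -
      from that have p: "p \<in> V" "F (X.proj p) \<in> E" using \<phi> by (auto simp: V(4))
      then have pU: "p \<in> U" "f p \<in> U'" using V f by auto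
      \<comment> \<open>The orbit of \<open>f p\<close> meets the chart domain \<open>V'\<close>,
        but \<open>f p\<close> itself may lie outside it. In these charts \<open>F\<close> is
        therefore \<open>g \<circ> f\<close> for an element \<open>g\<close> that moves
        \<open>f p\<close> into \<open>V'\<close>.\<close>
      obtain v where v: "v \<in> V'" "Y.proj v = Y.proj (f p)" using p F[OF pU(1)] V'(4) by auto
      obtain g where g: "g \<in> carrier G'" "v = g (f p)"
        using Y.proj_eq_iff[of v "f p"] v V' pU by blast
      have hol: "holomorphic2_on (\<lambda>x. g (f x)) U"
        by (rule holomorphic2_on_compose[OF f(1) Y.act_hol[OF g(1)] f(2)])
      then have "holomorphic2_on (\<lambda>x. g (f x)) {p}" by (rule holomorphic2_on_subset) (use pU in auto)
      moreover have "open (V \<inter> (U \<inter> (\<lambda>x. g (f x)) -` V'))"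
        using V(1) continuous_open_preimage[OF holomorphic2_on_imp_continuous_on[OF hol] X.open_U V'(1)]
        by (rule open_Int)
      moreover have "g (f x) = (\<psi> \<circ> F \<circ> inv_into D \<phi>) x" if "x \<in> V \<inter> (U \<inter> (\<lambda>x. g (f x)) -` V')" for x
      proof -
        have x: "x \<in> V" "x \<in> U" "g (f x) \<in> V'" "f x \<in> U'" using that f(2) by auto
        then have "F (X.proj x) = Y.proj (g (f x))" using F Y.proj_act[OF g(1)] by simp
        then show ?thesis using x inv V' by simp
      qed
      ultimately show ?thesis
        by (rule holomorphic2_on_cong_near) (use p pU g v in auto)
    qed
    then show ?thesis using holomorphic2_on_pointwise by blast
  qed
  ultimately show ?thesis by (auto simp: holomorphic_map_def)
qed

section \<open>Equivariant holomorphic functions are affine\<close>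

abbreviation upper_half :: "complex set" where "upper_half \<equiv> {w. Im w > 0}"

lemma inoue_domain_iff: "(w, z) \<in> inoue_domain \<longleftrightarrow> Im w > 0"
  by (simp add: inoue_domain_def)

lemma open_upper_half: "open upper_half"
  using open_halfspace_Im_gt[of 0] by simp

lemma convex_upper_half: "convex upper_half"
  using convex_halfspace_Im_gt[of 0] by simp

lemma connected_upper_half: "connected upper_half"
  by (rule convex_connected[OF convex_upper_half])

lemma open_inoue_domain: "open inoue_domain"
  unfolding inoue_domain_def by (intro open_Times open_upper_half open_UNIV)

lemma convex_inoue_domain: "convex inoue_domain"
  unfolding inoue_domain_def using convex_halfspace_Im_gt[of 0] by (intro convex_Times) auto

text \<open>The vectors \<open>a\<close> and \<open>b\<close> are forgotten here: the analysis sees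
  only a discrete cocompact subgroup of \<open>\<real> \<times> \<complex>\<close> on which
  \<open>(\<alpha>, \<beta>)\<close> acts invertibly. By \<open>theta_neq\<close>, \<open>1\<close>
  is not a root of the cubic.\<close>

locale inoue_lattice =
  fixes \<theta>1 \<theta>2 :: int and \<alpha> :: real and \<beta> :: complex and L :: "(real \<times> complex) set"
  assumes alpha_gt_1: "\<alpha> > 1"
    and norm_beta: "(norm \<beta>)\<^sup>2 = 1 / \<alpha>"
    and cubic_alpha: "\<alpha> ^ 3 + of_int \<theta>1 * \<alpha> = of_int \<theta>2 * \<alpha>\<^sup>2 + 1"
    and cubic_beta: "\<beta> ^ 3 + of_int \<theta>1 * \<beta> = of_int \<theta>2 * \<beta>\<^sup>2 + 1"
    and theta_neq: "\<theta>1 \<noteq> \<theta>2"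
    and zero_mem: "(0, 0) \<in> L"
    and add_mem: "(r, s) \<in> L \<Longrightarrow> (r', s') \<in> L \<Longrightarrow> (r + r', s + s') \<in> L"
    and minus_mem: "(r, s) \<in> L \<Longrightarrow> (- r, - s) \<in> L"
    and scale_mem: "(r, s) \<in> L \<Longrightarrow> (\<alpha> * r, \<beta> * s) \<in> L"
    and scale_inv_mem: "(r, s) \<in> L \<Longrightarrow> (r / \<alpha>, s / \<beta>) \<in> L"
    and discrete: "\<exists>\<epsilon>>0. \<forall>r s. (r, s) \<in> L \<longrightarrow> \<bar>r\<bar> < \<epsilon> \<longrightarrow> norm s < \<epsilon> \<longrightarrow> r = 0 \<and> s = 0"
    and cocompact: "\<exists>R. \<forall>r s. \<exists>r' s'. (r', s') \<in> L \<and> \<bar>r - r'\<bar> \<le> R \<and> norm (s - s') \<le> R"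
begin

lemma beta_neq_0: "\<beta> \<noteq> 0"
  using norm_beta alpha_gt_1 by auto

lemma powi_mem: "(r, s) \<in> L \<Longrightarrow> (\<alpha> powi n * r, \<beta> powi n * s) \<in> L"
proof (induction n arbitrary: r s rule: int_induct[where k = 0])
  case base
  then show ?case by simp
next
  case (step1 i)
  have "(\<alpha> powi i * (\<alpha> * r), \<beta> powi i * (\<beta> * s)) \<in> L" by (intro step1.IH scale_mem step1.prems)
  then show ?case using alpha_gt_1 beta_neq_0 by (simp add: power_int_add mult.assoc)
next
  case (step2 i)
  have "(\<alpha> powi i * (r / \<alpha>), \<beta> powi i * (s / \<beta>)) \<in> L" by (intro step2.IH scale_inv_mem step2.prems)
  then show ?case using alpha_gt_1 beta_neq_0 by (simp add: power_int_diff)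
qed

lemma obtain_nonzero: obtains r s where "(r, s) \<in> L" "r \<noteq> 0"
proof -
  obtain R where R: "\<And>r s. \<exists>r' s'. (r', s') \<in> L \<and> \<bar>r - r'\<bar> \<le> R \<and> norm (s - s') \<le> R"
    using cocompact by blast
  obtain r s where rs: "(r, s) \<in> L" "\<bar>R + 1 - r\<bar> \<le> R" using R[of "R + 1" 0] by blast
  then have "r \<noteq> 0" by auto
  with rs that show ?thesis by blast
qed

text \<open>Dividing one nonzero period by powers of \<open>\<alpha>\<close> gives periods tending
  to zero, so \<open>g\<close> takes the value \<open>g w'\<close> on a sequence accumulating at
  \<open>w'\<close>.\<close>

lemma holomorphic_periodic_constant:
  assumes g: "g holomorphic_on upper_half"
    and per: "\<And>w r s. Im w > 0 \<Longrightarrow> (r, s) \<in> L \<Longrightarrow> g (w + of_real r) = g w"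
    and w: "Im w > 0" "Im w' > 0"
  shows "g w = g w'"
proof -
  obtain r s where rs: "(r, s) \<in> L" "r \<noteq> 0" by (rule obtain_nonzero)
  define S where "S = range (\<lambda>n. w' + of_real ((1 / \<alpha>) ^ n * r))"
  have "norm (1 / \<alpha>) < 1" using alpha_gt_1 by simp
  then have "(\<lambda>n. (1 / \<alpha>) ^ n) \<longlonglongrightarrow> 0" by (rule LIMSEQ_power_zero)
  then have "(\<lambda>n. w' + of_real ((1 / \<alpha>) ^ n * r)) \<longlonglongrightarrow> w' + of_real (0 * r)"
    by (intro tendsto_add tendsto_of_real tendsto_mult tendsto_const)
  then have lim: "(\<lambda>n. w' + of_real ((1 / \<alpha>) ^ n * r)) \<longlonglongrightarrow> w'" by simp
  have "w' islimpt S"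
    unfolding islimpt_sequential
    using lim rs alpha_gt_1 by (intro exI[of _ "\<lambda>n. w' + of_real ((1 / \<alpha>) ^ n * r)"]) (auto simp: S_def)
  moreover have "g z - g w' = 0" if z: "z \<in> S" for z
  proof -
    obtain n where n: "z = w' + of_real ((1 / \<alpha>) ^ n * r)" using z by (auto simp: S_def)
    have "((1 / \<alpha>) ^ n * r, \<beta> powi (- int n) * s) \<in> L"
      using powi_mem[OF rs(1), of "- int n"] alpha_gt_1 by (simp add: power_int_minus power_inverse field_simps)
    from per[OF w(2) this] show ?thesis unfolding n by (simp only: diff_self)
  qed
  moreover have "S \<subseteq> upper_half" using w by (auto simp: S_def)
  moreover have "(\<lambda>z. g z - g w') holomorphic_on upper_half" by (intro holomorphic_intros g)
  ultimately have "g w - g w' = 0"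
    using analytic_continuation[OF _ open_upper_half connected_upper_half, of "\<lambda>z. g z - g w'" S w' w] w
    by blast
  then show ?thesis by simp
qed

lemma linear_of_constant_deriv:
  assumes g: "g holomorphic_on S" "open S" "convex S"
    and c: "\<And>z. z \<in> S \<Longrightarrow> deriv g z = c" and z: "z \<in> S" "z' \<in> S"
  shows "g z - c * z = g z' - c * z'"
proof -
  have "((\<lambda>z. g z - c * z) has_field_derivative 0) (at x within S)" if "x \<in> S" for x
  proof -
    have "(g has_field_derivative c) (at x)"
      using holomorphic_derivI[OF g(1,2) that] c[OF that] by simp
    from DERIV_diff[OF this DERIV_cmult_Id[of c]] show ?thesis
      by (simp add: has_field_derivative_at_within)
  qed
  then obtain d where "\<And>x. x \<in> S \<Longrightarrow> g x - c * x = d"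
    using has_field_derivative_zero_constant[OF g(3), of "\<lambda>z. g z - c * z"] by blast
  then show ?thesis using z by simp
qed

text \<open>The difference \<open>v\<close> of \<open>u\<close> in the \<open>z\<close> direction no
  longer sees the constants \<open>\<tau> r s\<close>, so it is invariant under \<open>L\<close>.
  Once it is constant in both variables, \<open>u\<close> splits into a function of \<open>w\<close>
  and a function of \<open>z\<close>. The latter is additive up to a constant, and the former has an
  invariant derivative.\<close>

theorem equivariant_affine:
  assumes cont: "continuous_on inoue_domain u"
    and hz: "\<And>w. Im w > 0 \<Longrightarrow> (\<lambda>z. u (w, z)) holomorphic_on UNIV"
    and hw: "\<And>z. (\<lambda>w. u (w, z)) holomorphic_on upper_half"
    and equi: "\<And>w z r s. Im w > 0 \<Longrightarrow> (r, s) \<in> L \<Longrightarrow> u (w + of_real r, z + s) = u (w, z) + \<tau> r s"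
  obtains a b c :: complex where "\<And>w z. Im w > 0 \<Longrightarrow> u (w, z) = a * w + b * z + c"
proof -
  obtain R where R: "\<And>r s. \<exists>r' s'. (r', s') \<in> L \<and> \<bar>r - r'\<bar> \<le> R \<and> norm (s - s') \<le> R"
    using cocompact by blast
  define v where "v \<zeta> w z = u (w, z + \<zeta>) - u (w, z)" for \<zeta> w z
  have per: "v \<zeta> (w + of_real r) (z + s) = v \<zeta> w z" if "Im w > 0" "(r, s) \<in> L" for \<zeta> w z r s
    using equi[OF that, of z] equi[OF that, of "z + \<zeta>"] by (simp add: v_def add_ac)
  have vz: "v \<zeta> w z = v \<zeta> w z'" if w: "Im w > 0" for \<zeta> w z z'
  proof -
    \<comment> \<open>Lattice shifts move \<open>w\<close> by real numbers only, hence keep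
      \<open>Im w\<close>. Cocompactness therefore brings every point of the line over
      \<open>w\<close> into \<open>K\<close>, a compact set inside the domain.\<close>
    define K where "K = (\<lambda>x. w + of_real x) ` {-R..R} \<times> cball (0 :: complex) R"
    have K: "compact K" "K \<subseteq> inoue_domain" unfolding K_def
      using w by (auto intro!: compact_Times compact_continuous_image continuous_intros simp: inoue_domain_def)
    have "continuous_on K (\<lambda>p. u (fst p, snd p + \<zeta>) - u (fst p, snd p))"
      using K(2)
      by (intro continuous_intros continuous_on_compose2[OF cont]) (auto simp: inoue_domain_def)
    then have "bounded ((\<lambda>p. u (fst p, snd p + \<zeta>) - u (fst p, snd p)) ` K)"
      by (intro compact_imp_bounded compact_continuous_image K)
    moreover have "range (v \<zeta> w) \<subseteq> (\<lambda>p. u (fst p, snd p + \<zeta>) - u (fst p, snd p)) ` K"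
    proof (rule image_subsetI)
      fix z
      obtain r s where rs: "(r, s) \<in> L" "\<bar>0 - r\<bar> \<le> R" "norm (z - s) \<le> R" using R[of 0 z] by blast
      have "v \<zeta> w z = v \<zeta> (w - of_real r) (z - s)"
        using per[of "w - of_real r" r s \<zeta> "z - s"] w rs by simp
      moreover have "(w - of_real r, z - s) \<in> K"
        using rs by (auto simp: K_def intro!: image_eqI[of _ _ "- r"])
      ultimately show "v \<zeta> w z \<in> (\<lambda>p. u (fst p, snd p + \<zeta>) - u (fst p, snd p)) ` K"
        by (intro image_eqI[of _ _ "(w - of_real r, z - s)"]) (simp_all add: v_def)
    qed
    ultimately have "bounded (range (v \<zeta> w))" by (rule bounded_subset)
    moreover have "(\<lambda>z. u (w, z + \<zeta>)) holomorphic_on UNIV"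
      using holomorphic_on_compose[of "\<lambda>z. z + \<zeta>" UNIV "\<lambda>z. u (w, z)"] hz[OF w]
      by (simp add: o_def holomorphic_on_add holomorphic_on_subset)
    then have "v \<zeta> w holomorphic_on UNIV"
      unfolding v_def by (intro holomorphic_intros hz w)
    ultimately have "v \<zeta> w constant_on UNIV" by (intro Liouville_theorem)
    then show ?thesis unfolding constant_on_def by (metis UNIV_I)
  qed
  have vw: "v \<zeta> w 0 = v \<zeta> w' 0" if "Im w > 0" "Im w' > 0" for \<zeta> w w'
  proof (rule holomorphic_periodic_constant[of "\<lambda>w. v \<zeta> w 0"])
    show "(\<lambda>w. v \<zeta> w 0) holomorphic_on upper_half"
      unfolding v_def by (intro holomorphic_intros hw)
    fix w r s assume w: "Im w > 0" "(r, s) \<in> L"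
    \<comment> \<open>The shift is applied at \<open>z = - s\<close> so that it ends at
      \<open>0\<close>; independence of \<open>z\<close> then replaces \<open>- s\<close> by
      \<open>0\<close>.\<close>
    then show "v \<zeta> (w + of_real r) 0 = v \<zeta> w 0"
      using per[OF w, of \<zeta> "- s"] vz[OF w(1), of \<zeta> "- s" 0] by simp
  qed (use that in auto)
  define g where "g z = u (\<i>, z)" for z
  have v: "u (w, z) = u (w, 0) + g z - g 0" if "Im w > 0" for w z
    using vw[of w \<i> z] that by (simp add: v_def g_def algebra_simps)
  have gh: "g holomorphic_on UNIV" unfolding g_def by (rule hz) simp
  have gadd: "g (z + \<zeta>) = g z + g \<zeta> - g 0" for z \<zeta>
    using vz[of \<i> \<zeta> z 0] by (simp add: v_def g_def algebra_simps)
  \<comment> \<open>By \<open>gadd\<close>, \<open>g - g 0\<close> is additive: shifting the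
    argument changes \<open>g\<close> by a constant, so its derivative is the same
    everywhere.\<close>
  have dg: "deriv g \<zeta> = deriv g 0" for \<zeta>
  proof -
    have "(g has_field_derivative deriv g \<zeta>) (at \<zeta>)"
      using holomorphic_derivI[OF gh open_UNIV] by simp
    then have "((\<lambda>z. g (z + \<zeta>)) has_field_derivative deriv g \<zeta>) (at 0)"
      using DERIV_shift[of g "deriv g \<zeta>" 0 \<zeta>] by simp
    then have "((\<lambda>z. g z + g \<zeta> - g 0) has_field_derivative deriv g \<zeta>) (at 0)"
      using gadd by simp
    moreover have "((\<lambda>z. g z + g \<zeta> - g 0) has_field_derivative deriv g 0 + 0 - 0) (at 0)"
      using holomorphic_derivI[OF gh open_UNIV] by (intro derivative_intros) simp
    ultimately show ?thesis using DERIV_unique by fastforce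
  qed
  have g: "g z = deriv g 0 * z + g 0" for z
    using linear_of_constant_deriv[OF gh open_UNIV convex_UNIV dg, of z 0]
    by (simp add: algebra_simps)
  define h where "h w = u (w, 0)" for w
  have hh: "h holomorphic_on upper_half" unfolding h_def by (rule hw)
  have hper: "h (w + of_real r) = h w + (\<tau> r s - deriv g 0 * s)" if w: "Im w > 0" "(r, s) \<in> L" for w r s
  proof -
    have "u (w + of_real r, - s + s) = u (w, - s) + \<tau> r s" by (rule equi[OF w])
    then show ?thesis using v[OF w(1), of "- s"] g[of "- s"] by (simp add: h_def)
  qed
  \<comment> \<open>The function \<open>h\<close> is invariant only up to additive constants, but
    its derivative is invariant and hence constant.\<close>
  have dh: "deriv h w = deriv h \<i>" if "w \<in> upper_half" for w
  proof (rule holomorphic_periodic_constant[of "deriv h"])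
    show "deriv h holomorphic_on upper_half" by (rule holomorphic_deriv[OF hh open_upper_half])
    fix w r s assume w: "Im w > 0" "(r, s) \<in> L"
    have "(h has_field_derivative deriv h (w + of_real r)) (at (w + of_real r))"
      using holomorphic_derivI[OF hh open_upper_half] w by simp
    then have "((\<lambda>z. h (z + of_real r)) has_field_derivative deriv h (w + of_real r)) (at w)"
      using DERIV_shift[of h "deriv h (w + of_real r)" w "of_real r"] by simp
    then have "((\<lambda>z. h z + (\<tau> r s - deriv g 0 * s)) has_field_derivative deriv h (w + of_real r)) (at w)"
      by (rule has_field_derivative_transform_within_open[OF _ open_upper_half]) (use w hper in auto)
    moreover have "((\<lambda>z. h z + (\<tau> r s - deriv g 0 * s)) has_field_derivative deriv h w + 0) (at w)"
      using holomorphic_derivI[OF hh open_upper_half] w by (intro derivative_intros) simp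
    ultimately show "deriv h (w + of_real r) = deriv h w" using DERIV_unique by fastforce
  qed (use that in auto)
  have h: "h w = deriv h \<i> * w + (h \<i> - deriv h \<i> * \<i>)" if "Im w > 0" for w
  proof -
    have "h w - deriv h \<i> * w = h \<i> - deriv h \<i> * \<i>"
      by (rule linear_of_constant_deriv[OF hh open_upper_half convex_upper_half]) (use that in \<open>auto intro!: dh\<close>)
    then show ?thesis by (simp add: algebra_simps)
  qed
  show ?thesis
  proof (rule that[of "deriv h \<i>" "deriv g 0" "h \<i> - deriv h \<i> * \<i>"])
    fix w z :: complex assume w: "Im w > 0"
    have "u (w, z) = h w + g z - g 0" using v[OF w, of z] by (simp only: h_def)
    also have "\<dots> = (deriv h \<i> * w + (h \<i> - deriv h \<i> * \<i>)) + (deriv g 0 * z + g 0) - g 0"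
      by (subst h[OF w], subst g[of z]) (rule refl)
    finally show "u (w, z) = deriv h \<i> * w + deriv g 0 * z + (h \<i> - deriv h \<i> * \<i>)"
      by (simp add: algebra_simps)
  qed
qed

end

section \<open>Holomorphy in each variable separately\<close>

lemma holomorphic2_on_partials:
  assumes f: "holomorphic2_on f S" and p: "(w, z) \<in> S"
  shows "(\<lambda>z. fst (f (w, z))) field_differentiable at z" "(\<lambda>w. fst (f (w, z))) field_differentiable at w"
    "(\<lambda>z. snd (f (w, z))) field_differentiable at z" "(\<lambda>w. snd (f (w, z))) field_differentiable at w"
proof -
  obtain f' where f': "(f has_derivative f') (at (w, z))"
      and lin: "\<forall>c v. f' (c * fst v, c * snd v) = (c * fst (f' v), c * snd (f' v))"
    using f p unfolding holomorphic2_on_def by blast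
  have "((\<lambda>z. (w, z)) has_derivative (\<lambda>h. (0, h))) (at z)" "((\<lambda>w. (w, z)) has_derivative (\<lambda>h. (h, 0))) (at w)"
    by (auto intro!: derivative_eq_intros)
  from this(1)[THEN diff_chain_at, unfolded o_def, OF f'] this(2)[THEN diff_chain_at, unfolded o_def, OF f']
  have z: "((\<lambda>z. f (w, z)) has_derivative (\<lambda>h. f' (0, h))) (at z)"
    and w: "((\<lambda>w. f (w, z)) has_derivative (\<lambda>h. f' (h, 0))) (at w)" .
  \<comment> \<open>Complex linearity turns the derivative along each coordinate axis into
    multiplication by a component of its value at \<open>1\<close>.\<close>
  define p q where "p = f' (0, 1)" and "q = f' (1, 0)"
  have p: "f' (0, h) = (h * fst p, h * snd p)" and q: "f' (h, 0) = (h * fst q, h * snd q)" for h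
    using lin[rule_format, of h "(0, 1)"] lin[rule_format, of h "(1, 0)"] by (simp_all add: p_def q_def)
  have eq: "(\<lambda>h. fst (f' (0, h))) = (*) (fst p)" "(\<lambda>h. snd (f' (0, h))) = (*) (snd p)"
      "(\<lambda>h. fst (f' (h, 0))) = (*) (fst q)" "(\<lambda>h. snd (f' (h, 0))) = (*) (snd q)"
    by (simp_all add: p q fun_eq_iff mult.commute)
  note z' = has_derivative_fst[OF z] has_derivative_snd[OF z]
  note w' = has_derivative_fst[OF w] has_derivative_snd[OF w]
  show "(\<lambda>z. fst (f (w, z))) field_differentiable at z" "(\<lambda>w. fst (f (w, z))) field_differentiable at w"
      "(\<lambda>z. snd (f (w, z))) field_differentiable at z" "(\<lambda>w. snd (f (w, z))) field_differentiable at w"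
    using z' w' unfolding eq field_differentiable_def has_field_derivative_def by blast+
qed

lemma holomorphic2_on_inoue_domain:
  assumes f: "holomorphic2_on f inoue_domain"
  shows "Im w > 0 \<Longrightarrow> (\<lambda>z. fst (f (w, z))) holomorphic_on UNIV" "(\<lambda>w. fst (f (w, z))) holomorphic_on upper_half"
    "Im w > 0 \<Longrightarrow> (\<lambda>z. snd (f (w, z))) holomorphic_on UNIV" "(\<lambda>w. snd (f (w, z))) holomorphic_on upper_half"
  by (auto intro!: field_differentiable_at_within holomorphic2_on_partials[OF f]
      simp: holomorphic_on_def inoue_domain_iff)

section \<open>Biholomorphisms of type I Inoue surfaces\<close>

text \<open>Keeps the multiplier \<open>of_real (\<alpha> powi n)\<close> visibly real, which
  matters when imaginary parts are taken or real equations are extracted.\<close>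

declare of_real_power_int [simp del]

text \<open>Normal form of the group elements: a power of the homothety followed by a translation.
  The restriction to the domain makes these maps extensional, as \<open>BijGroup\<close>
  demands.\<close>

definition inoue_act :: "real \<Rightarrow> complex \<Rightarrow> int \<Rightarrow> real \<Rightarrow> complex \<Rightarrow> complex \<times> complex \<Rightarrow> complex \<times> complex" where
  "inoue_act \<alpha> \<beta> n r s =
     (\<lambda>(w, z)\<in>inoue_domain. (of_real (\<alpha> powi n) * w + of_real r, \<beta> powi n * z + s))"

definition inoue_maps :: "real \<Rightarrow> complex \<Rightarrow> (real \<times> complex) set \<Rightarrow> (complex \<times> complex \<Rightarrow> complex \<times> complex) set" where
  "inoue_maps \<alpha> \<beta> L = {inoue_act \<alpha> \<beta> n r s | n r s. (r, s) \<in> L}"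

lemma inoue_act_apply [simp]:
  "Im w > 0 \<Longrightarrow> inoue_act \<alpha> \<beta> n r s (w, z) = (of_real (\<alpha> powi n) * w + of_real r, \<beta> powi n * z + s)"
  by (simp add: inoue_act_def inoue_domain_iff)

lemma inoue_mapsE:
  assumes "g \<in> inoue_maps \<alpha> \<beta> L"
  obtains n r s where "(r, s) \<in> L" "g = inoue_act \<alpha> \<beta> n r s"
  using assms unfolding inoue_maps_def mem_Collect_eq by (elim exE conjE)

lemma inoue_mapsI: "(r, s) \<in> L \<Longrightarrow> inoue_act \<alpha> \<beta> n r s \<in> inoue_maps \<alpha> \<beta> L"
  unfolding inoue_maps_def by blast

text \<open>Stated for a predicate because it serves twice: for membership in \<open>L\<close>, and
  for translations lying in the generated group.\<close>

lemma int_multiple_closed: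
  fixes P :: "real \<Rightarrow> complex \<Rightarrow> bool"
  assumes zero: "P 0 0" and add: "\<And>r s r' s'. P r s \<Longrightarrow> P r' s' \<Longrightarrow> P (r + r') (s + s')"
    and minus: "\<And>r s. P r s \<Longrightarrow> P (- r) (- s)" and rs: "P r s"
  shows "P (of_int k * r) (of_int k * s)"
proof -
  have *: "P (of_nat n * r) (of_nat n * s)" for n
    by (induction n) (simp_all add: zero distrib_right add[OF rs])
  show ?thesis
  proof (cases "k \<ge> 0")
    case True
    then show ?thesis using *[of "nat k"] by simp
  next
    case False
    then show ?thesis using minus[OF *[of "nat (- k)"]] by simp
  qed
qed

lemma holomorphic2_on_affine:
  "holomorphic2_on (\<lambda>(w, z). (a * w + b, c * z + d)) S"
proof -
  have "((\<lambda>(w, z). (a * w + b, c * z + d)) has_derivative (\<lambda>v. (a * fst v, c * snd v))) (at p)" for p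
    unfolding case_prod_beta by (auto intro!: derivative_eq_intros)
  then show ?thesis
    unfolding holomorphic2_on_def
    by (intro ballI exI[of _ "\<lambda>v. (a * fst v, c * snd v)"]) (simp add: mult.left_commute)
qed

section \<open>The action on the domain is free and properly discontinuous\<close>

context inoue_lattice
begin

abbreviation "act \<equiv> inoue_act \<alpha> \<beta>"
abbreviation "inv_act n r s \<equiv> act (- n) (- (\<alpha> powi (- n) * r)) (- (\<beta> powi (- n) * s))"

lemma alpha_powi_pos: "\<alpha> powi n > 0"
  using alpha_gt_1 by (simp add: zero_less_power_int)

lemma act_compose:
  assumes "Im w > 0"
  shows "act n r s (act m r' s' (w, z)) =
    act (n + m) (\<alpha> powi n * r' + r) (\<beta> powi n * s' + s) (w, z)"
proof -
  have "Im (of_real (\<alpha> powi m) * w + of_real r') > 0" using assms alpha_powi_pos[of m] by simp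
  then show ?thesis using assms alpha_gt_1 beta_neq_0
    by (simp add: power_int_add algebra_simps)
qed

lemma act_inverse:
  assumes "Im w > 0"
  shows "inv_act n r s (act n r s (w, z)) = (w, z)"
    "act n r s (inv_act n r s (w, z)) = (w, z)"
proof -
  have "\<alpha> powi n * \<alpha> powi (- n) = 1" "\<beta> powi n * \<beta> powi (- n) = 1"
    using alpha_gt_1 beta_neq_0 by (simp_all add: power_int_minus)
  then have 1: "\<alpha> powi n * (\<alpha> powi (- n) * r) = r" "\<beta> powi n * (\<beta> powi (- n) * s) = s"
    by (simp_all flip: mult.assoc)
  show "inv_act n r s (act n r s (w, z)) = (w, z)"
    by (subst act_compose[OF assms]) (simp add: assms)
  have "act n r s (inv_act n r s (w, z)) =
     act (n + - n) (- (\<alpha> powi n * (\<alpha> powi (- n) * r)) + r) (- (\<beta> powi n * (\<beta> powi (- n) * s)) + s) (w, z)"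
    by (subst act_compose[OF assms]) (simp only: mult_minus_right)
  also have "\<dots> = (w, z)" unfolding 1 using assms by simp
  finally show "act n r s (inv_act n r s (w, z)) = (w, z)" .
qed

text \<open>With \<open>c = sqrt \<alpha>\<close>, the imaginary parts in \<open>V\<close> range
  over an open interval whose end points have ratio \<open>c * c = \<alpha>\<close>, so
  multiplication by \<open>\<alpha> powi n\<close> returns a point to \<open>V\<close> only for
  \<open>n = 0\<close>. The remaining translation moves a point by less than
  \<open>\<epsilon>\<close>, twice the radius of the balls, and discreteness makes it
  trivial.\<close>

lemma wandering_nbhd:
  assumes "Im w0 > 0"
  obtains V where "open V" "(w0, z0) \<in> V" "V \<subseteq> inoue_domain"
    "\<And>n r s w z. (r, s) \<in> L \<Longrightarrow> (w, z) \<in> V \<Longrightarrow> act n r s (w, z) \<in> V \<Longrightarrow> n = 0 \<and> r = 0 \<and> s = 0"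
proof -
  obtain \<epsilon> where \<epsilon>: "\<epsilon> > 0" "\<And>r s. (r, s) \<in> L \<Longrightarrow> \<bar>r\<bar> < \<epsilon> \<Longrightarrow> norm s < \<epsilon> \<Longrightarrow> r = 0 \<and> s = 0"
    using discrete by blast
  define c where "c = sqrt \<alpha>"
  have c: "c > 1" "c * c = \<alpha>" using alpha_gt_1 by (simp_all add: c_def)
  define V where "V = (ball w0 (\<epsilon> / 2) \<inter> {w. Im w > Im w0 / c} \<inter> {w. Im w < Im w0 * c}) \<times> ball z0 (\<epsilon> / 2)"
  have pos: "Im w0 / c > 0" using assms c by simp
  show ?thesis
  proof
    show "open V" unfolding V_def
      by (intro open_Times open_Int open_ball open_halfspace_Im_gt open_halfspace_Im_lt)
    show "(w0, z0) \<in> V" using assms c \<epsilon> by (simp add: V_def field_simps)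
    show "V \<subseteq> inoue_domain" using pos by (auto simp: V_def inoue_domain_def)
    fix n r s w z
    assume rs: "(r, s) \<in> L" and V: "(w, z) \<in> V" and gV: "act n r s (w, z) \<in> V"
    have w: "Im w > Im w0 / c" "Im w < Im w0 * c" "dist w0 w < \<epsilon> / 2" "dist z0 z < \<epsilon> / 2"
      using V by (auto simp: V_def)
    have w0: "Im w > 0" using w pos by linarith
    have gw: "\<alpha> powi n * Im w > Im w0 / c" "\<alpha> powi n * Im w < Im w0 * c"
      using gV unfolding inoue_act_apply[OF w0] by (simp_all add: V_def)
    have eq: "\<alpha> * (Im w0 / c) = Im w0 * c" using c by (simp add: field_simps)
    have "\<not> n \<ge> 1"
    proof
      assume "n \<ge> 1"
      then have "\<alpha> powi 1 \<le> \<alpha> powi n" using alpha_gt_1 by (intro power_int_increasing) auto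
      then have "\<alpha> * Im w \<le> \<alpha> powi n * Im w" using w0 by (intro mult_right_mono) auto
      moreover have "\<alpha> * (Im w0 / c) < \<alpha> * Im w"
        using alpha_gt_1 by (intro mult_strict_left_mono[OF w(1)]) simp
      ultimately show False using gw eq by linarith
    qed
    moreover have "\<not> n \<le> - 1"
    proof
      assume "n \<le> - 1"
      then have "\<alpha> powi (1 + n) \<le> \<alpha> powi 0" using alpha_gt_1 by (intro power_int_increasing) auto
      then have "\<alpha> * \<alpha> powi n * Im w \<le> 1 * Im w"
        using w0 alpha_gt_1 by (intro mult_right_mono) (auto simp: power_int_add)
      moreover have "\<alpha> * (Im w0 / c) < \<alpha> * (\<alpha> powi n * Im w)"
        using alpha_gt_1 by (intro mult_strict_left_mono[OF gw(1)]) simp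
      ultimately show False using w eq by (simp add: mult.assoc)
    qed
    ultimately have n: "n = 0" by linarith
    have "dist w0 (w + of_real r) < \<epsilon> / 2" "dist z0 (z + s) < \<epsilon> / 2"
      using gV unfolding inoue_act_apply[OF w0] n by (auto simp: V_def)
    then have "dist w (w + of_real r) < \<epsilon>" "dist z (z + s) < \<epsilon>"
      using w dist_triangle3[of w "w + of_real r" w0] dist_triangle3[of z "z + s" z0] by linarith+
    then have "\<bar>r\<bar> < \<epsilon>" "norm s < \<epsilon>" by (simp_all add: dist_norm)
    then show "n = 0 \<and> r = 0 \<and> s = 0" using \<epsilon>(2)[OF rs] n by blast
  qed
qed

lemma free_pd_action_inoue:
  assumes G: "carrier G = inoue_maps \<alpha> \<beta> L"
  shows "free_pd_action inoue_domain G"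
proof
  show "open inoue_domain" by (rule open_inoue_domain)
next
  fix g x assume "g \<in> carrier G" "x \<in> inoue_domain"
  then show "g x \<in> inoue_domain"
    unfolding G using alpha_powi_pos
    by (cases x) (auto elim!: inoue_mapsE simp: inoue_domain_iff)
next
  show "\<exists>e\<in>carrier G. \<forall>x\<in>inoue_domain. e x = x"
    unfolding G using zero_mem by (intro bexI[of _ "act 0 0 0"]) (auto simp: inoue_domain_iff intro: inoue_mapsI)
next
  fix g h assume "g \<in> carrier G" "h \<in> carrier G"
  then obtain n r s m r' s' where gh: "(r, s) \<in> L" "g = act n r s"
      "(r', s') \<in> L" "h = act m r' s'"
    unfolding G by (elim inoue_mapsE)
  have "(\<alpha> powi n * r' + r, \<beta> powi n * s' + s) \<in> L" by (intro add_mem powi_mem gh)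
  then show "\<exists>k\<in>carrier G. \<forall>x\<in>inoue_domain. k x = g (h x)"
    unfolding G gh
    by (intro bexI[of _ "act (n + m) (\<alpha> powi n * r' + r) (\<beta> powi n * s' + s)"])
       (auto simp: act_compose inoue_domain_iff simp del: inoue_act_apply intro: inoue_mapsI)
next
  fix g assume "g \<in> carrier G"
  then obtain n r s where g: "(r, s) \<in> L" "g = act n r s" unfolding G by (elim inoue_mapsE)
  have "(- (\<alpha> powi (- n) * r), - (\<beta> powi (- n) * s)) \<in> L" by (intro minus_mem powi_mem g)
  then show "\<exists>h\<in>carrier G. \<forall>x\<in>inoue_domain. h (g x) = x \<and> g (h x) = x"
    unfolding G g
    by (intro bexI[of _ "inv_act n r s"])
       (auto simp: act_inverse inoue_domain_iff simp del: inoue_act_apply intro: inoue_mapsI)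
next
  fix g assume "g \<in> carrier G"
  then obtain n r s where g: "(r, s) \<in> L" "g = act n r s" unfolding G by (elim inoue_mapsE)
  have "holomorphic2_on g {p}" if "p \<in> inoue_domain" for p
    by (rule holomorphic2_on_cong_near[OF
          holomorphic2_on_affine[of "of_real (\<alpha> powi n)" "of_real r" "\<beta> powi n" s] open_inoue_domain _ that])
       (auto simp: g inoue_domain_iff)
  then show "holomorphic2_on g inoue_domain" using holomorphic2_on_pointwise by blast
next
  fix p assume "p \<in> inoue_domain"
  then obtain w0 z0 where p: "p = (w0, z0)" "Im w0 > 0" by (cases p) (auto simp: inoue_domain_iff)
  obtain V where V: "open V" "(w0, z0) \<in> V" "V \<subseteq> inoue_domain"
    and wand: "\<And>n r s w z. (r, s) \<in> L \<Longrightarrow> (w, z) \<in> V \<Longrightarrow> act n r s (w, z) \<in> V \<Longrightarrow> n = 0 \<and> r = 0 \<and> s = 0"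
    using wandering_nbhd[OF p(2)] by metis
  have "g y = y" if gxy: "g \<in> carrier G" "x \<in> V" "g x \<in> V" "y \<in> inoue_domain" for g x y
  proof -
    obtain n r s where g: "(r, s) \<in> L" "g = act n r s" using gxy(1) unfolding G by (elim inoue_mapsE)
    have "n = 0 \<and> r = 0 \<and> s = 0" using wand[OF g(1), of "fst x" "snd x" n] gxy g by simp
    then show ?thesis using g gxy(4) by (cases y) (simp add: inoue_domain_iff)
  qed
  then show "\<exists>V. open V \<and> p \<in> V \<and> V \<subseteq> inoue_domain \<and>
      (\<forall>g\<in>carrier G. \<forall>x\<in>V. g x \<in> V \<longrightarrow> (\<forall>y\<in>inoue_domain. g y = y))"
    using V p by blast
qed

lemma of_int_mult_mem: "(r, s) \<in> L \<Longrightarrow> (of_int k * r, of_int k * s) \<in> L"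
  by (rule int_multiple_closed[of "\<lambda>r s. (r, s) \<in> L"]) (simp_all add: zero_mem add_mem minus_mem)

text \<open>A positive multiplier on the lattice that is invariant under multiplication by \<open>(\<alpha>, \<beta>)\<close> is
  trivial: the cubic equation turns into \<open>c\<^sup>1\<^sup>+\<^sup>\<theta>\<^sup>1 = c\<^sup>\<theta>\<^sup>2\<^sup>+\<^sup>1\<close>.\<close>

lemma multiplier_trivial:
  fixes c :: "real \<Rightarrow> complex \<Rightarrow> real"
  assumes pos: "\<And>r s. (r, s) \<in> L \<Longrightarrow> c r s > 0"
    and mult: "\<And>r s r' s'. (r, s) \<in> L \<Longrightarrow> (r', s') \<in> L \<Longrightarrow> c (r + r') (s + s') = c r s * c r' s'"
    and inv: "\<And>r s. (r, s) \<in> L \<Longrightarrow> c (\<alpha> * r) (\<beta> * s) = c r s"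
    and rs: "(r, s) \<in> L"
  shows "c r s = 1"
proof -
  \<comment> \<open>The logarithm makes the multiplier additive, so that the integer coefficients of
    the cubic can be pulled out as factors.\<close>
  define l where "l r s = ln (c r s)" for r s
  have ladd: "l (r + r') (s + s') = l r s + l r' s'" if "(r, s) \<in> L" "(r', s') \<in> L" for r s r' s'
    using mult[OF that] pos[OF that(1)] pos[OF that(2)] by (simp add: l_def ln_mult)
  have l0: "l 0 0 = 0" using ladd[OF zero_mem zero_mem] by simp
  have lnat: "l (of_nat k * r) (of_nat k * s) = of_nat k * l r s" if "(r, s) \<in> L" for k r s
  proof (induction k)
    case (Suc k)
    then show ?case using ladd[OF that of_int_mult_mem[OF that, of "int k"]] by (simp add: algebra_simps)
  qed (simp add: l0)
  have lneg: "l (- r) (- s) = - l r s" if "(r, s) \<in> L" for r s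
    using ladd[OF that minus_mem[OF that]] l0 by simp
  have lint: "l (of_int k * r) (of_int k * s) = of_int k * l r s" if "(r, s) \<in> L" for k r s
  proof (cases "k \<ge> 0")
    case True
    then show ?thesis using lnat[OF that, of "nat k"] by simp
  next
    case False
    then show ?thesis using lneg[OF of_int_mult_mem[OF that, of "- k"]] lnat[OF that, of "nat (- k)"] by simp
  qed
  have linv: "l (\<alpha> * r) (\<beta> * s) = l r s" if "(r, s) \<in> L" for r s
    using inv[OF that] by (simp add: l_def)
  note m1 = scale_mem[OF rs] and m2 = scale_mem[OF scale_mem[OF rs]]
    and m3 = scale_mem[OF scale_mem[OF scale_mem[OF rs]]]
  have "l (\<alpha> * (\<alpha> * (\<alpha> * r)) + of_int \<theta>1 * (\<alpha> * r)) (\<beta> * (\<beta> * (\<beta> * s)) + of_int \<theta>1 * (\<beta> * s))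
      = l r s + of_int \<theta>1 * l r s"
    using ladd[OF m3 of_int_mult_mem[OF m1]] lint[OF m1] linv[OF m2] linv[OF m1] linv[OF rs] by simp
  moreover have "l (of_int \<theta>2 * (\<alpha> * (\<alpha> * r)) + r) (of_int \<theta>2 * (\<beta> * (\<beta> * s)) + s)
      = of_int \<theta>2 * l r s + l r s"
    using ladd[OF of_int_mult_mem[OF m2] rs] lint[OF m2] linv[OF m1] linv[OF rs] by simp
  moreover have "\<alpha> * (\<alpha> * (\<alpha> * r)) + of_int \<theta>1 * (\<alpha> * r) = of_int \<theta>2 * (\<alpha> * (\<alpha> * r)) + r"
    using arg_cong[OF cubic_alpha, of "\<lambda>x. x * r"] by (simp add: algebra_simps power2_eq_square power3_eq_cube)
  moreover have "\<beta> * (\<beta> * (\<beta> * s)) + of_int \<theta>1 * (\<beta> * s) = of_int \<theta>2 * (\<beta> * (\<beta> * s)) + s"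
    using arg_cong[OF cubic_beta, of "\<lambda>x. x * s"] by (simp add: algebra_simps power2_eq_square power3_eq_cube)
  ultimately have "of_int \<theta>1 * l r s = of_int \<theta>2 * l r s" by auto
  then have "l r s = 0" using theta_neq by simp
  then show ?thesis using pos[OF rs] by (simp add: l_def)
qed

end

lemma power_int_eq_1D:
  fixes x :: real
  assumes "x > 1" "x powi n = 1"
  shows "n = 0"
proof -
  have "\<not> n \<ge> 1" using power_int_increasing[of 1 n x] assms by auto
  moreover have "\<not> - n \<ge> 1"
    using power_int_increasing[of 1 "- n" x] assms by (auto simp: power_int_minus)
  ultimately show ?thesis by linarith
qed

lemma affine_coeff_eq:
  fixes a b c d :: complex
  assumes "\<And>w. Im w > 0 \<Longrightarrow> a * w + b = c * w + d"
  shows "a = c"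
proof -
  have "(a - c) * \<i> = (a * (2 * \<i>) + b) - (a * \<i> + b) - ((c * (2 * \<i>) + d) - (c * \<i> + d))"
    by (simp add: algebra_simps)
  also have "\<dots> = 0" using assms[of \<i>] assms[of "2 * \<i>"] by simp
  finally show ?thesis by simp
qed

text \<open>The two lattices share the cubic and \<open>\<alpha>\<close> but may belong to different
  roots \<open>\<beta>\<close> and \<open>\<beta>'\<close>, whose equality is one of the
  conclusions.\<close>

locale inoue_lattice_pair =
  X: inoue_lattice \<theta>1 \<theta>2 \<alpha> \<beta> L + Y: inoue_lattice \<theta>1 \<theta>2 \<alpha> \<beta>' L'
  for \<theta>1 \<theta>2 :: int and \<alpha> :: real and \<beta> \<beta>' :: complex and L L' :: "(real \<times> complex) set"
begin

text \<open>The imaginary part of the first component of \<open>f\<close> is positive, so the exponents of the images of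
  translations give a positive multiplier on \<open>L\<close>; since it is trivial, \<open>f\<close> carries translations to
  translations.\<close>

lemma equivariant_map_affine:
  assumes hol: "holomorphic2_on f inoue_domain" and im: "f ` inoue_domain \<subseteq> inoue_domain"
    and equi: "\<And>g. g \<in> inoue_maps \<alpha> \<beta> L \<Longrightarrow> \<exists>g'\<in>inoue_maps \<alpha> \<beta>' L'. \<forall>x\<in>inoue_domain. f (g x) = g' (f x)"
  obtains A :: real and B e p c :: complex
  where "\<And>w z. Im w > 0 \<Longrightarrow> f (w, z) = (of_real A * w + B, e * w + p * z + c)"
    and "\<And>r s. (r, s) \<in> L \<Longrightarrow> \<exists>s'. (A * r, s') \<in> L'"
proof -
  have dom: "Im (fst (f (w, z))) > 0" if "Im w > 0" for w z
  proof -
    have "f (w, z) \<in> inoue_domain" using im that inoue_domain_iff by blast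
    then show ?thesis using inoue_domain_iff by (metis prod.collapse)
  qed
  have ex: "\<exists>n' r' s'. (r', s') \<in> L' \<and> (\<forall>w z. Im w > 0 \<longrightarrow> f (inoue_act \<alpha> \<beta> n r s (w, z)) =
      (of_real (\<alpha> powi n') * fst (f (w, z)) + of_real r', \<beta>' powi n' * snd (f (w, z)) + s'))"
    if rs: "(r, s) \<in> L" for n r s
  proof -
    obtain g' where g': "g' \<in> inoue_maps \<alpha> \<beta>' L'"
        "\<forall>x\<in>inoue_domain. f (inoue_act \<alpha> \<beta> n r s x) = g' (f x)"
      using equi[OF inoue_mapsI[OF rs]] by blast
    obtain n' r' s' where n': "(r', s') \<in> L'" "g' = inoue_act \<alpha> \<beta>' n' r' s'" using g'(1) by (elim inoue_mapsE)
    have "f (inoue_act \<alpha> \<beta> n r s (w, z)) =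
      (of_real (\<alpha> powi n') * fst (f (w, z)) + of_real r', \<beta>' powi n' * snd (f (w, z)) + s')"
      if "Im w > 0" for w z
    proof -
      have "f (inoue_act \<alpha> \<beta> n r s (w, z)) = inoue_act \<alpha> \<beta>' n' r' s' (fst (f (w, z)), snd (f (w, z)))"
        using g'(2)[rule_format, of "(w, z)"] that n'(2) by (simp add: inoue_domain_iff del: inoue_act_apply)
      then show ?thesis by (subst (asm) inoue_act_apply[OF dom[OF that]])
    qed
    then show ?thesis using n'(1) by blast
  qed
  define v where "v w z = Im (fst (f (w, z)))" for w z
  \<comment> \<open>The factor by which a translation multiplies \<open>v\<close>, measured at the
    base point \<open>(\<i>, 0)\<close>. It is a power of \<open>\<alpha>\<close>, hence the same at
    every point.\<close>
  define cc where "cc r s = v (\<i> + of_real r) s / v \<i> 0" for r s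
  have vpos: "v w z > 0" if "Im w > 0" for w z using dom[OF that] by (simp add: v_def)
  have cc: "v (w + of_real r) (z + s) = cc r s * v w z" if rs: "(r, s) \<in> L" and w: "Im w > 0" for r s w z
  proof -
    obtain n' r' s' where n': "\<And>w z. Im w > 0 \<Longrightarrow> f (inoue_act \<alpha> \<beta> 0 r s (w, z)) =
        (of_real (\<alpha> powi n') * fst (f (w, z)) + of_real r', \<beta>' powi n' * snd (f (w, z)) + s')"
      using ex[OF rs, of 0] by blast
    have *: "v (w + of_real r) (z + s) = \<alpha> powi n' * v w z" if "Im w > 0" for w z
      using n'[OF that, of z] that by (simp add: v_def)
    have "cc r s = \<alpha> powi n'" using *[of \<i> 0] vpos[of \<i> 0] by (simp add: cc_def)
    then show ?thesis using *[OF w] by simp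
  qed
  have cc1: "cc r s = 1" if rs: "(r, s) \<in> L" for r s
  proof (rule X.multiplier_trivial[OF _ _ _ rs])
    show "cc r s > 0" for r s using vpos[of \<i> 0] vpos[of "\<i> + of_real r" s] by (simp add: cc_def)
  next
    fix r s r' s' assume rs: "(r, s) \<in> L" "(r', s') \<in> L"
    have "cc (r + r') (s + s') * v \<i> 0 = v ((\<i> + of_real r) + of_real r') (s + s')"
      using cc[OF X.add_mem[OF rs], of \<i> 0] by (simp add: add_ac)
    also have "\<dots> = cc r' s' * (cc r s * v \<i> 0)"
      using cc[OF rs(2), of "\<i> + of_real r" s] cc[OF rs(1), of \<i> 0] by simp
    finally show "cc (r + r') (s + s') = cc r s * cc r' s'" using vpos[of \<i> 0] by simp
  next
    \<comment> \<open>The homothety also multiplies \<open>v\<close> by a constant. Conjugating a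
      translation by it therefore leaves the factor \<open>cc\<close> unchanged.\<close>
    fix r s assume rs: "(r, s) \<in> L"
    obtain m r1 s1 where m: "\<And>w z. Im w > 0 \<Longrightarrow> f (inoue_act \<alpha> \<beta> 1 0 0 (w, z)) =
        (of_real (\<alpha> powi m) * fst (f (w, z)) + of_real r1, \<beta>' powi m * snd (f (w, z)) + s1)"
      using ex[OF X.zero_mem, of 1] by blast
    have *: "v (of_real \<alpha> * w) (\<beta> * z) = \<alpha> powi m * v w z" if "Im w > 0" for w z
      using m[OF that, of z] that by (simp add: v_def)
    have i: "Im (of_real \<alpha> * \<i>) > 0" using X.alpha_gt_1 by simp
    have "cc (\<alpha> * r) (\<beta> * s) * (\<alpha> powi m * v \<i> 0) = v (of_real \<alpha> * \<i> + of_real (\<alpha> * r)) (\<beta> * 0 + \<beta> * s)"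
      using cc[OF X.scale_mem[OF rs] i, of 0] *[of \<i> 0] by simp
    also have "\<dots> = v (of_real \<alpha> * (\<i> + of_real r)) (\<beta> * s)" by (simp add: distrib_left)
    also have "\<dots> = \<alpha> powi m * (cc r s * v \<i> 0)"
      using *[of "\<i> + of_real r" s] cc[OF rs, of \<i> 0] by simp
    finally show "cc (\<alpha> * r) (\<beta> * s) = cc r s" using vpos[of \<i> 0] X.alpha_gt_1 by auto
  qed
  have "\<exists>r' s'. (r', s') \<in> L' \<and> (\<forall>w z. Im w > 0 \<longrightarrow> f (w + of_real r, z + s) =
      (fst (f (w, z)) + of_real r', snd (f (w, z)) + s'))" if rs: "(r, s) \<in> L" for r s
  proof -
    obtain n' r' s' where n': "(r', s') \<in> L'" "\<And>w z. Im w > 0 \<Longrightarrow> f (inoue_act \<alpha> \<beta> 0 r s (w, z)) =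
        (of_real (\<alpha> powi n') * fst (f (w, z)) + of_real r', \<beta>' powi n' * snd (f (w, z)) + s')"
      using ex[OF rs, of 0] by blast
    have "v (\<i> + of_real r) (0 + s) = \<alpha> powi n' * v \<i> 0" using n'(2)[of \<i> 0] by (simp add: v_def)
    then have "\<alpha> powi n' = 1" using cc[OF rs, of \<i> 0] cc1[OF rs] vpos[of \<i> 0] by simp
    then have "n' = 0" using power_int_eq_1D[OF X.alpha_gt_1] by blast
    then show ?thesis using n' by auto
  qed
  then obtain \<rho> \<tau> where \<rho>: "\<And>r s. (r, s) \<in> L \<Longrightarrow> (\<rho> r s, \<tau> r s) \<in> L'"
    "\<And>r s w z. (r, s) \<in> L \<Longrightarrow> Im w > 0 \<Longrightarrow> f (w + of_real r, z + s) =
      (fst (f (w, z)) + of_real (\<rho> r s), snd (f (w, z)) + \<tau> r s)"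
    by metis
  have cont: "continuous_on inoue_domain (\<lambda>x. fst (f x))" "continuous_on inoue_domain (\<lambda>x. snd (f x))"
    by (intro continuous_intros holomorphic2_on_imp_continuous_on[OF hol])+
  obtain A' q B where 1: "\<And>w z. Im w > 0 \<Longrightarrow> fst (f (w, z)) = A' * w + q * z + B"
    by (rule X.equivariant_affine[OF cont(1), of "\<lambda>r s. of_real (\<rho> r s)"])
       (use holomorphic2_on_inoue_domain[OF hol] \<rho>(2) in auto)
  obtain e p c where 2: "\<And>w z. Im w > 0 \<Longrightarrow> snd (f (w, z)) = e * w + p * z + c"
    by (rule X.equivariant_affine[OF cont(2), of "\<lambda>r s. \<tau> r s"])
       (use holomorphic2_on_inoue_domain[OF hol] \<rho>(2) in auto)
  \<comment> \<open>If \<open>q\<close> were nonzero, a suitable \<open>z\<close> would give the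
    first component of \<open>f\<close> the value \<open>- \<i>\<close>, outside the upper half
    plane.\<close>
  have q: "q = 0"
  proof (rule ccontr)
    assume "q \<noteq> 0"
    then have "fst (f (\<i>, (- \<i> - A' * \<i> - B) / q)) = - \<i>" using 1[of \<i>] by simp
    then show False using dom[of \<i> "(- \<i> - A' * \<i> - B) / q"] by simp
  qed
  have A': "A' * of_real r = of_real (\<rho> r s)" if rs: "(r, s) \<in> L" for r s
    using \<rho>(2)[OF rs, of \<i> 0] 1[of \<i> 0] 1[of "\<i> + of_real r" s] q by (simp add: prod_eq_iff distrib_left)
  obtain r0 s0 where rs0: "(r0, s0) \<in> L" "r0 \<noteq> 0" by (rule X.obtain_nonzero)
  \<comment> \<open>The coefficient \<open>A'\<close> is real because it maps the nonzero real
    period \<open>r0\<close> to the real number \<open>\<rho> r0 s0\<close>.\<close>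
  define A where "A = \<rho> r0 s0 / r0"
  have A: "A' = of_real A" using A'[OF rs0(1)] rs0(2) by (simp add: A_def field_simps)
  show ?thesis
  proof (rule that[of A B e p c])
    show "f (w, z) = (of_real A * w + B, e * w + p * z + c)" if "Im w > 0" for w z
      using 1[OF that, of z] 2[OF that, of z] q A by (simp add: prod_eq_iff)
    show "\<exists>s'. (A * r, s') \<in> L'" if rs: "(r, s) \<in> L" for r s
    proof -
      have "of_real (A * r) = (of_real (\<rho> r s) :: complex)" using A'[OF rs] A by simp
      then have "A * r = \<rho> r s" by (simp only: of_real_eq_iff)
      then show ?thesis using \<rho>(1)[OF rs] by auto
    qed
  qed
qed

text \<open>The factors \<open>A\<close> and \<open>A'\<close> are inverse only up to a power of
  \<open>\<alpha>\<close>. Since \<open>L\<close> is stable under negative powers of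
  \<open>(\<alpha>, \<beta>)\<close> as well, that power can be removed from the preimage.\<close>

lemma scaling_imp_image_eq:
  assumes A: "\<And>r s. (r, s) \<in> L \<Longrightarrow> \<exists>s'. (A * r, s') \<in> L'" and A': "\<And>r s. (r, s) \<in> L' \<Longrightarrow> \<exists>s'. (A' * r, s') \<in> L"
    and AA': "A' * A = \<alpha> powi n"
  shows "(*) A ` fst ` L = fst ` L'"
proof (intro equalityI subsetI)
  fix x assume "x \<in> (*) A ` fst ` L"
  then obtain r s where "(r, s) \<in> L" "x = A * r" by force
  then show "x \<in> fst ` L'" using A by force
next
  fix x assume "x \<in> fst ` L'"
  then obtain s where s: "(x, s) \<in> L'" by force
  then obtain s' where "(A' * x, s') \<in> L" using A' by blast
  then have mem: "(\<alpha> powi (- n) * (A' * x), \<beta> powi (- n) * s') \<in> L" by (rule X.powi_mem)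
  have "A * (\<alpha> powi (- n) * (A' * x)) = (A' * A) * \<alpha> powi (- n) * x" by (simp add: mult_ac)
  also have "\<dots> = x" unfolding AA' using X.alpha_gt_1 by (simp add: power_int_minus)
  finally show "x \<in> (*) A ` fst ` L" using mem by (force intro: rev_image_eqI)
qed

text \<open>The affine normal form still allows a term \<open>e * w\<close> in the second component,
  so the lattices are compared only through their projections to \<open>\<real>\<close>. That is
  enough, as the projection determines the ideal class.\<close>

theorem biholomorphic_imp_scaling:
  assumes G: "carrier G = inoue_maps \<alpha> \<beta> L" and G': "carrier G' = inoue_maps \<alpha> \<beta>' L'"
    and bihol: "biholomorphic (quotient_surface inoue_domain G) (quotient_surface inoue_domain G')"
  shows "\<beta> = \<beta>'" and "\<exists>A. A \<noteq> 0 \<and> (*) A ` fst ` L = fst ` L'"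
proof -
  interpret GX: free_pd_action inoue_domain G by (rule X.free_pd_action_inoue[OF G])
  interpret GY: free_pd_action inoue_domain G' by (rule Y.free_pd_action_inoue[OF G'])
  interpret YX: inoue_lattice_pair \<theta>1 \<theta>2 \<alpha> \<beta>' \<beta> L' L ..
  obtain F H where F: "holomorphic_map GX.quot GY.quot F" and H: "holomorphic_map GY.quot GX.quot H"
    and HF: "\<forall>x\<in>topspace (topo GX.quot). H (F x) = x" and FH: "\<forall>y\<in>topspace (topo GY.quot). F (H y) = y"
    using bihol unfolding biholomorphic_def by blast
  have conn: "connected inoue_domain" by (rule convex_connected[OF convex_inoue_domain])
  have ne: "inoue_domain \<noteq> {}" using inoue_domain_iff[of \<i> 0] by auto
  have sc: "simply_connected inoue_domain" by (rule convex_imp_simply_connected[OF convex_inoue_domain])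
  obtain f where f: "holomorphic2_on f inoue_domain" "f ` inoue_domain \<subseteq> inoue_domain"
      "\<And>x. x \<in> inoue_domain \<Longrightarrow> GY.proj (f x) = F (GX.proj x)"
    using holomorphic_map_lift[OF GX.free_pd_action_axioms GY.free_pd_action_axioms sc F] by metis
  obtain h where h: "holomorphic2_on h inoue_domain" "h ` inoue_domain \<subseteq> inoue_domain"
      "\<And>x. x \<in> inoue_domain \<Longrightarrow> GX.proj (h x) = H (GY.proj x)"
    using holomorphic_map_lift[OF GY.free_pd_action_axioms GX.free_pd_action_axioms sc H] by metis
  have fx: "f x \<in> inoue_domain" if "x \<in> inoue_domain" for x using f(2) that by blast
  have hx: "h x \<in> inoue_domain" if "x \<in> inoue_domain" for x using h(2) that by blast
  note cf = holomorphic2_on_imp_continuous_on[OF f(1)] and ch = holomorphic2_on_imp_continuous_on[OF h(1)]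
  have ef: "\<exists>g'\<in>inoue_maps \<alpha> \<beta>' L'. \<forall>x\<in>inoue_domain. f (g x) = g' (f x)" if "g \<in> inoue_maps \<alpha> \<beta> L" for g
    using lift_equivariant[OF GX.free_pd_action_axioms GY.free_pd_action_axioms conn ne cf f(2,3)] that
    unfolding G G' by blast
  have eh: "\<exists>g'\<in>inoue_maps \<alpha> \<beta> L. \<forall>x\<in>inoue_domain. h (g x) = g' (h x)" if "g \<in> inoue_maps \<alpha> \<beta>' L'" for g
    using lift_equivariant[OF GY.free_pd_action_axioms GX.free_pd_action_axioms conn ne ch h(2,3)] that
    unfolding G G' by blast
  obtain A B e p c where f_aff: "\<And>w z. Im w > 0 \<Longrightarrow> f (w, z) = (of_real A * w + B, e * w + p * z + c)"
      and AL: "\<And>r s. (r, s) \<in> L \<Longrightarrow> \<exists>s'. (A * r, s') \<in> L'"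
    using equivariant_map_affine[OF f(1,2) ef] by metis
  obtain A' B' e' p' c' where h_aff: "\<And>w z. Im w > 0 \<Longrightarrow> h (w, z) = (of_real A' * w + B', e' * w + p' * z + c')"
      and AL': "\<And>r s. (r, s) \<in> L' \<Longrightarrow> \<exists>s'. (A' * r, s') \<in> L"
    using YX.equivariant_map_affine[OF h(1,2) eh] by metis
  \<comment> \<open>The composite \<open>h \<circ> f\<close> lifts the identity, so it is an element
    of \<open>G\<close>. Its multipliers are nonzero, which prevents \<open>A\<close> and
    \<open>p\<close> from vanishing.\<close>
  have hf: "GX.proj (h (f x)) = GX.proj x" if "x \<in> inoue_domain" for x
    using h(3)[OF fx[OF that]] f(3)[OF that] HF GX.topspace_quot that by simp
  have hf_im: "(\<lambda>x. h (f x)) ` inoue_domain \<subseteq> inoue_domain" by (intro image_subsetI hx fx)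
  obtain k where k: "k \<in> carrier G" "\<And>x. x \<in> inoue_domain \<Longrightarrow> h (f x) = k x"
    using GX.lift_unique[OF conn ne continuous_on_compose2[OF ch cf f(2)] hf_im continuous_on_id _ hf] by blast
  obtain n r s where nrs: "(r, s) \<in> L" "k = inoue_act \<alpha> \<beta> n r s" using k(1) unfolding G by (elim inoue_mapsE)
  have dom: "Im (of_real A * w + B) > 0" if "Im w > 0" for w
    using fx[of "(w, 0)"] f_aff[OF that, of 0] that by (simp add: inoue_domain_iff)
  have comp: "of_real A' * (of_real A * w + B) + B' = of_real (\<alpha> powi n) * w + of_real r"
      "e' * (of_real A * w + B) + p' * (e * w + p * z + c) + c' = \<beta> powi n * z + s" if "Im w > 0" for w z
    using k(2)[of "(w, z)"] h_aff[OF dom[OF that], of "e * w + p * z + c"] f_aff[OF that, of z] that nrs(2)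
    by (simp_all add: inoue_domain_iff)
  have "of_real (A' * A) = (of_real (\<alpha> powi n) :: complex)"
  proof (rule affine_coeff_eq)
    show "of_real (A' * A) * w + (of_real A' * B + B') = of_real (\<alpha> powi n) * w + of_real r"
      if "Im w > 0" for w
      using comp(1)[OF that] by (simp add: algebra_simps)
  qed
  then have AA': "A' * A = \<alpha> powi n" by (simp only: of_real_eq_iff)
  then have A0: "A \<noteq> 0" using X.alpha_powi_pos[of n] by auto
  have "p' * p = \<beta> powi n"
  proof (rule affine_coeff_eq)
    show "p' * p * z + (e' * (of_real A * \<i> + B) + p' * (e * \<i> + c) + c') = \<beta> powi n * z + s" for z
      using comp(2)[of \<i> z] by (simp add: algebra_simps)
  qed
  then have p0: "p \<noteq> 0" using X.beta_neq_0 by auto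
  show "\<exists>A. A \<noteq> 0 \<and> (*) A ` fst ` L = fst ` L'"
    by (intro exI[of _ A] conjI A0 scaling_imp_image_eq[OF AL AL' AA'])
  \<comment> \<open>The homothety must correspond to an element with exponent \<open>n' = 1\<close>,
    since \<open>A \<noteq> 0\<close> and the powers of \<open>\<alpha>\<close> are distinct. The
    coefficients of \<open>z\<close> then compare \<open>\<beta>\<close> with
    \<open>\<beta>'\<close>.\<close>
  obtain g' where g': "g' \<in> inoue_maps \<alpha> \<beta>' L'"
      "\<forall>x\<in>inoue_domain. f (inoue_act \<alpha> \<beta> 1 0 0 x) = g' (f x)"
    using ef[OF inoue_mapsI[OF X.zero_mem]] by blast
  obtain n' r' s' where n': "g' = inoue_act \<alpha> \<beta>' n' r' s'" using g'(1) by (elim inoue_mapsE)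
  have equ: "of_real A * (of_real \<alpha> * w) + B = of_real (\<alpha> powi n') * (of_real A * w + B) + of_real r'" (is ?thesis1)
      "e * (of_real \<alpha> * w) + p * (\<beta> * z) + c = \<beta>' powi n' * (e * w + p * z + c) + s'" (is ?thesis2)
    if "Im w > 0" for w z
  proof -
    have aw: "Im (of_real \<alpha> * w) > 0" using that X.alpha_gt_1 by simp
    have "f (of_real \<alpha> * w, \<beta> * z) = g' (f (w, z))"
      using g'(2)[rule_format, of "(w, z)"] that by (simp add: inoue_domain_iff)
    then show ?thesis1 ?thesis2
      using f_aff[OF aw, of "\<beta> * z"] f_aff[OF that, of z] dom[OF that] n' by simp_all
  qed
  have "of_real (A * \<alpha>) = (of_real (A * \<alpha> powi n') :: complex)"
  proof (rule affine_coeff_eq)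
    show "of_real (A * \<alpha>) * w + B = of_real (A * \<alpha> powi n') * w + (of_real (\<alpha> powi n') * B + of_real r')"
      if "Im w > 0" for w
      using equ(1)[OF that] by (simp add: algebra_simps)
  qed
  then have "\<alpha> = \<alpha> powi n'" using A0 by (simp only: of_real_eq_iff mult_cancel_left) simp
  then have "\<alpha> powi (n' - 1) = 1" using X.alpha_gt_1 by (simp add: power_int_diff)
  then have "n' = 1" using power_int_eq_1D[OF X.alpha_gt_1, of "n' - 1"] by simp
  have "p * \<beta> = p * \<beta>'"
  proof (rule affine_coeff_eq)
    show "p * \<beta> * z + (e * (of_real \<alpha> * \<i>) + c) = p * \<beta>' * z + (\<beta>' * (e * \<i> + c) + s')" for z
      using equ(2)[of \<i> z] \<open>n' = 1\<close> by (simp add: algebra_simps)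
  qed
  then show "\<beta> = \<beta>'" using p0 by simp
qed

end

section \<open>Proportional lattices give biholomorphic surfaces\<close>

context inoue_lattice
begin

text \<open>The linear map conjugates \<open>act n r s\<close> into
  \<open>act n (A * r) (p * s)\<close> and so carries orbits onto orbits. As the points of the
  quotient are orbits, the induced map is simply the image of sets.\<close>

lemma scaled_lattices_holomorphic_map:
  assumes Y: "inoue_lattice \<theta>1 \<theta>2 \<alpha> \<beta> L'"
    and G: "carrier G = inoue_maps \<alpha> \<beta> L" and G': "carrier G' = inoue_maps \<alpha> \<beta> L'"
    and A: "A > 0" and AL: "\<And>r s. (r, s) \<in> L \<longleftrightarrow> (A * r, p * s) \<in> L'" and p: "p \<noteq> 0"
  shows "holomorphic_map (quotient_surface inoue_domain G) (quotient_surface inoue_domain G')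
    (image (\<lambda>(w, z). (of_real A * w, p * z)))"
proof (rule holomorphic_map_descend[OF free_pd_action_inoue[OF G] inoue_lattice.free_pd_action_inoue[OF Y G']])
  define f where "f = (\<lambda>(w, z). (of_real A * w :: complex, p * z))"
  show "holomorphic2_on f inoue_domain"
    using holomorphic2_on_affine[of "of_real A" 0 p 0] by (simp add: f_def)
  show "f ` inoue_domain \<subseteq> inoue_domain"
    using A by (auto simp: f_def inoue_domain_iff)
  have act: "f (act n r s (w, z)) = act n (A * r) (p * s) (f (w, z))" if "Im w > 0" for n r s w z
    using that A by (simp add: f_def algebra_simps)
  fix x assume "x \<in> inoue_domain"
  then obtain w z where x: "x = (w, z)" "Im w > 0" by (cases x) (simp add: inoue_domain_iff)
  show "f ` orbit G (\<lambda>g. g) x = orbit G' (\<lambda>g. g) (f x)"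
  proof (intro equalityI subsetI)
    fix y assume "y \<in> f ` orbit G (\<lambda>g. g) x"
    then obtain g where g: "g \<in> inoue_maps \<alpha> \<beta> L" "y = f (g x)" by (auto simp: orbit_def G)
    obtain n r s where n: "(r, s) \<in> L" "g = act n r s" using g(1) by (elim inoue_mapsE)
    then have "y = act n (A * r) (p * s) (f x)" using g(2) x act by simp
    then show "y \<in> orbit G' (\<lambda>g. g) (f x)" using n(1) AL inoue_mapsI[of "A * r" "p * s"] by (auto simp: orbit_def G')
  next
    fix y assume "y \<in> orbit G' (\<lambda>g. g) (f x)"
    then obtain g where g: "g \<in> inoue_maps \<alpha> \<beta> L'" "y = g (f x)" by (auto simp: orbit_def G')
    obtain n r s where n: "(r, s) \<in> L'" "g = act n r s" using g(1) by (elim inoue_mapsE)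
    have "(r / A, s / p) \<in> L" using n(1) AL[of "r / A" "s / p"] A p by simp
    moreover have "y = f (act n (r / A) (s / p) x)"
      using act[OF x(2), of n "r / A" "s / p" z] g(2) n(2) x A p by simp
    ultimately show "y \<in> f ` orbit G (\<lambda>g. g) x"
      using inoue_mapsI[of "r / A" "s / p"] unfolding orbit_def G by blast
  qed
qed

text \<open>For negative \<open>A\<close> the linear map would leave the upper half plane; since
  \<open>L'\<close> is symmetric, \<open>(A, p)\<close> may be replaced by
  \<open>(- A, - p)\<close>.\<close>

theorem scaled_lattices_biholomorphic:
  assumes Y: "inoue_lattice \<theta>1 \<theta>2 \<alpha> \<beta> L'"
    and G: "carrier G = inoue_maps \<alpha> \<beta> L" and G': "carrier G' = inoue_maps \<alpha> \<beta> L'"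
    and A: "A \<noteq> 0" and AL: "\<And>r s. (r, s) \<in> L \<longleftrightarrow> (A * r, p * s) \<in> L'" and p: "p \<noteq> 0"
  shows "biholomorphic (quotient_surface inoue_domain G) (quotient_surface inoue_domain G')"
proof -
  have *: "biholomorphic (quotient_surface inoue_domain G) (quotient_surface inoue_domain G')"
    if A: "A > 0" and AL: "\<And>r s. (r, s) \<in> L \<longleftrightarrow> (A * r, p * s) \<in> L'" and p: "p \<noteq> 0" for A p
  proof -
    have "(r, s) \<in> L' \<longleftrightarrow> (1 / A * r, 1 / p * s) \<in> L" for r s
      using AL[of "1 / A * r" "1 / p * s"] A p by simp
    then have "holomorphic_map (quotient_surface inoue_domain G') (quotient_surface inoue_domain G)
        (image (\<lambda>(w, z). (of_real (1 / A) * w, 1 / p * z)))"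
      using inoue_lattice.scaled_lattices_holomorphic_map[OF Y inoue_lattice_axioms G' G, of "1 / A" "1 / p"] A p
      by simp
    moreover have "(\<lambda>(w, z). (of_real (1 / A) * w, 1 / p * z)) ` (\<lambda>(w, z). (of_real A * w, p * z)) ` X = X"
      "(\<lambda>(w, z). (of_real A * w, p * z)) ` (\<lambda>(w, z). (of_real (1 / A) * w, 1 / p * z)) ` X = X"
      for X :: "(complex \<times> complex) set"
      using A p by (simp_all add: image_image case_prod_beta)
    ultimately show ?thesis
      using scaled_lattices_holomorphic_map[OF Y G G' A AL p] unfolding biholomorphic_def by blast
  qed
  show ?thesis
  proof (cases "A > 0")
    case True
    then show ?thesis using * AL p by blast
  next
    case False
    have "(r, s) \<in> L \<longleftrightarrow> (- A * r, - p * s) \<in> L'" for r s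
      using AL[of r s] inoue_lattice.minus_mem[OF Y, of "A * r" "p * s"] inoue_lattice.minus_mem[OF Y, of "- A * r" "- p * s"]
      by auto
    then show ?thesis using *[of "- A" "- p"] False A p by auto
  qed
qed

end

section \<open>Lattices of compatible pairs\<close>

no_notation fps_nth (infixl \<open>$\<close> 75)

text \<open>Vieta's relations encode the whole factorization of the cubic. The root equations and
  \<open>|\<beta>|^2 = 1 / \<alpha>\<close> are read off from them.\<close>

locale cubic_roots =
  fixes \<theta>1 \<theta>2 :: int and \<alpha> :: real and \<beta> :: complex
  assumes alpha_gt_1: "\<alpha> > 1" and beta_nonreal: "\<beta> \<notin> \<real>"
    and vieta1: "of_real \<alpha> + \<beta> + cnj \<beta> = of_int \<theta>2"
    and vieta2: "of_real \<alpha> * (\<beta> + cnj \<beta>) + \<beta> * cnj \<beta> = of_int \<theta>1"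
    and vieta3: "of_real \<alpha> * (\<beta> * cnj \<beta>) = 1"
begin

lemma cubic_factor:
  "x ^ 3 - of_int \<theta>2 * x\<^sup>2 + of_int \<theta>1 * x - 1 = (x - of_real \<alpha>) * (x - \<beta>) * (x - cnj \<beta>)" for x :: complex
proof -
  have "x ^ 3 - (of_real \<alpha> + \<beta> + cnj \<beta>) * x\<^sup>2 + (of_real \<alpha> * (\<beta> + cnj \<beta>) + \<beta> * cnj \<beta>) * x
      - of_real \<alpha> * (\<beta> * cnj \<beta>) = (x - of_real \<alpha>) * (x - \<beta>) * (x - cnj \<beta>)"
    by (simp add: algebra_simps power2_eq_square power3_eq_cube)
  then show ?thesis unfolding vieta1 vieta2 vieta3 .
qed

lemma norm_beta: "(norm \<beta>)\<^sup>2 = 1 / \<alpha>"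
proof -
  have "of_real (\<alpha> * (norm \<beta>)\<^sup>2) = (of_real 1 :: complex)"
    using vieta3 by (simp add: complex_norm_square del: of_real_power)
  then have "\<alpha> * (norm \<beta>)\<^sup>2 = 1" by (simp only: of_real_eq_iff)
  then show ?thesis using alpha_gt_1 by (simp add: field_simps)
qed

lemma norm_beta_lt_1: "norm \<beta> < 1"
proof (rule power2_less_imp_less)
  show "(norm \<beta>)\<^sup>2 < 1\<^sup>2" unfolding norm_beta using alpha_gt_1 by simp
qed simp

lemma cubic_beta: "\<beta> ^ 3 + of_int \<theta>1 * \<beta> = of_int \<theta>2 * \<beta>\<^sup>2 + 1"
  using cubic_factor[of \<beta>] by (simp add: algebra_simps)

lemma cubic_alpha_complex: "of_real \<alpha> ^ 3 + of_int \<theta>1 * of_real \<alpha> = of_int \<theta>2 * (of_real \<alpha>)\<^sup>2 + (1 :: complex)"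
  using cubic_factor[of "of_real \<alpha>"] by (simp add: algebra_simps)

lemma cubic_alpha: "\<alpha> ^ 3 + of_int \<theta>1 * \<alpha> = of_int \<theta>2 * \<alpha>\<^sup>2 + 1"
proof -
  have "of_real (\<alpha> ^ 3 + of_int \<theta>1 * \<alpha>) = (of_real (of_int \<theta>2 * \<alpha>\<^sup>2 + 1) :: complex)"
    using cubic_alpha_complex by simp
  then show ?thesis by (simp only: of_real_eq_iff)
qed

lemma beta_neq: "\<beta> \<noteq> 0" "\<beta> \<noteq> of_real x" "cnj \<beta> \<noteq> of_real x" "\<beta> \<noteq> cnj \<beta>"
proof -
  show *: "\<beta> \<noteq> of_real x" for x using beta_nonreal by auto
  show "\<beta> \<noteq> 0" using *[of 0] by simp
  show "cnj \<beta> \<noteq> of_real x" using *[of x] by (metis complex_cnj_cnj complex_cnj_complex_of_real)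
  show "\<beta> \<noteq> cnj \<beta>" using beta_nonreal by (metis Reals_cnj_iff)
qed

lemma theta_neq: "\<theta>1 \<noteq> \<theta>2"
proof
  assume "\<theta>1 = \<theta>2"
  then have "(1 - of_real \<alpha>) * (1 - \<beta>) * (1 - cnj \<beta>) = 0" using cubic_factor[of 1] by simp
  then show False using beta_neq(2,3)[of 1] alpha_gt_1 by auto
qed

end

text \<open>The part of \<open>compatible\<close> that does not involve
  \<open>\<beta>\<close>.\<close>

definition independent_conj :: "real^3 \<Rightarrow> complex^3 \<Rightarrow> bool" where
  "independent_conj a b \<longleftrightarrow> (\<forall>r s t :: complex.
     r *s (\<chi> i. of_real (a $ i)) + s *s b + t *s (\<chi> i. cnj (b $ i)) = 0 \<longrightarrow> r = 0 \<and> s = 0 \<and> t = 0)"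

lemma independent_conjD:
  assumes "independent_conj a b" "\<And>i. r * of_real (a $ i) + s * b $ i + t * cnj (b $ i) = 0"
  shows "r = 0" "s = 0" "t = 0"
proof -
  have "r *s (\<chi> i. of_real (a $ i)) + s *s b + t *s (\<chi> i. cnj (b $ i)) = 0"
    using assms(2) by (simp add: vec_eq_iff)
  then show "r = 0" "s = 0" "t = 0" using assms(1) unfolding independent_conj_def by blast+
qed

section \<open>The inverse of \<open>Q\<close> and the lattice spanned by a pair\<close>

lemma inoue_Q_nth [simp]:
  "inoue_Q a b $ i $ 1 = of_real (a $ i)" "inoue_Q a b $ i $ 2 = b $ i" "inoue_Q a b $ i $ 3 = cnj (b $ i)"
  by (simp_all add: inoue_Q_def transpose_def vector_3)

lemma inoue_Q_invertible:
  assumes "independent_conj a b"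
  shows "inoue_Q a b ** matrix_inv (inoue_Q a b) = mat 1" "matrix_inv (inoue_Q a b) ** inoue_Q a b = mat 1"
proof -
  have "x = 0" if x: "inoue_Q a b *v x = 0" for x
  proof -
    have "x $ 1 * of_real (a $ i) + x $ 2 * b $ i + x $ 3 * cnj (b $ i) = 0" for i
    proof -
      have "(inoue_Q a b *v x) $ i = 0" using x by simp
      then show ?thesis by (simp add: matrix_vector_mult_def sum_3 mult.commute)
    qed
    from independent_conjD[OF assms this] show "x = 0" by (simp add: vec_eq_iff forall_3)
  qed
  then have "invertible (inoue_Q a b)" unfolding invertible_left_inverse matrix_left_invertible_ker by blast
  then show "inoue_Q a b ** matrix_inv (inoue_Q a b) = mat 1" "matrix_inv (inoue_Q a b) ** inoue_Q a b = mat 1"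
    unfolding invertible_def matrix_inv_def by (metis (mono_tags, lifting) someI_ex)+
qed

text \<open>The vectors \<open>q1\<close> and \<open>q2\<close> are the first two rows of the
  inverse of \<open>Q\<close>. Complex conjugation exchanges the last two columns of
  \<open>Q\<close>, so by independence the first row of the inverse is real and the third is the
  conjugate of the second.\<close>

lemma dual_basis:
  assumes "independent_conj a b"
  obtains q1 :: "real^3" and q2 :: "complex^3" where
    "\<forall>i j. of_real (a $ i * q1 $ j) + b $ i * q2 $ j + cnj (b $ i * q2 $ j) = (if i = j then 1 else 0)"
    "(\<Sum>i\<in>UNIV. q1 $ i * a $ i) = 1" "(\<Sum>i\<in>UNIV. of_real (q1 $ i) * b $ i) = 0"
    "(\<Sum>i\<in>UNIV. q2 $ i * of_real (a $ i)) = 0" "(\<Sum>i\<in>UNIV. q2 $ i * b $ i) = 1"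
    "(\<Sum>i\<in>UNIV. q2 $ i * cnj (b $ i)) = 0"
proof -
  define P where "P = matrix_inv (inoue_Q a b)"
  note inv = inoue_Q_invertible[OF assms, folded P_def]
  have r: "of_real (a $ i) * P $ 1 $ j + b $ i * P $ 2 $ j + cnj (b $ i) * P $ 3 $ j = (if i = j then 1 else 0)" for i j
    using arg_cong[OF inv(1), of "\<lambda>M. M $ i $ j"] by (simp add: matrix_matrix_mult_def sum_3 mat_def)
  have l: "(\<Sum>i\<in>UNIV. P $ k $ i * inoue_Q a b $ i $ l) = (if k = l then 1 else 0)" for k l
    using arg_cong[OF inv(2), of "\<lambda>M. M $ k $ l"] by (simp add: matrix_matrix_mult_def mat_def)
  have eq: "P $ 1 $ j = cnj (P $ 1 $ j)" "P $ 3 $ j = cnj (P $ 2 $ j)" for j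
  proof -
    have "(P $ 1 $ j - cnj (P $ 1 $ j)) * of_real (a $ i) + (P $ 2 $ j - cnj (P $ 3 $ j)) * b $ i
        + (P $ 3 $ j - cnj (P $ 2 $ j)) * cnj (b $ i) = 0" for i
    proof -
      have "of_real (a $ i) * cnj (P $ 1 $ j) + cnj (b $ i) * cnj (P $ 2 $ j) + b $ i * cnj (P $ 3 $ j) =
          cnj (of_real (a $ i) * P $ 1 $ j + b $ i * P $ 2 $ j + cnj (b $ i) * P $ 3 $ j)"
        by simp
      also have "\<dots> = of_real (a $ i) * P $ 1 $ j + b $ i * P $ 2 $ j + cnj (b $ i) * P $ 3 $ j"
        unfolding r by simp
      finally show ?thesis by (simp add: algebra_simps)
    qed
    from independent_conjD[OF assms this] show "P $ 1 $ j = cnj (P $ 1 $ j)" "P $ 3 $ j = cnj (P $ 2 $ j)" by simp_all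
  qed
  define q1 :: "real^3" where "q1 = (\<chi> j. Re (P $ 1 $ j))"
  define q2 where "q2 = P $ 2"
  have q1: "P $ 1 $ j = of_real (q1 $ j)" for j
    using eq(1)[of j] by (simp add: q1_def complex_eq_iff)
  show ?thesis
  proof (rule that[of q1 q2], goal_cases)
    case 1
    show ?case
    proof (intro allI)
      fix i j
      show "of_real (a $ i * q1 $ j) + b $ i * q2 $ j + cnj (b $ i * q2 $ j) = (if i = j then 1 else 0)"
        using r[of i j] eq(2)[of j] by (simp add: q1 q2_def)
    qed
  next
    case 2
    have "of_real (\<Sum>i\<in>UNIV. q1 $ i * a $ i) = (of_real 1 :: complex)"
      using l[of 1 1] by (simp add: q1)
    then show ?case by (simp only: of_real_eq_iff)
  qed (use q1 eq(2) l[of 1 2] l[of 2 1] l[of 2 2] l[of 2 3] in \<open>simp_all add: q2_def\<close>)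
qed

abbreviation int_comb :: "(3 \<Rightarrow> int) \<Rightarrow> 'a::ring_1 ^ 3 \<Rightarrow> 'a" where
  "int_comb n v \<equiv> \<Sum>i\<in>UNIV. of_int (n i) * v $ i"

definition lattice_of :: "real^3 \<Rightarrow> complex^3 \<Rightarrow> (real \<times> complex) set" where
  "lattice_of a b = {(int_comb n a, int_comb n b) | n. True}"

lemma lattice_ofI: "(int_comb n a, int_comb n b) \<in> lattice_of a b"
  unfolding lattice_of_def by blast

lemma lattice_ofE:
  assumes "(r, s) \<in> lattice_of a b"
  obtains n :: "3 \<Rightarrow> int" where "r = int_comb n a" "s = int_comb n b"
  using assms unfolding lattice_of_def by blast

text \<open>The coordinates are the row vector \<open>(r, s, cnj s)\<close> times the inverse of
  \<open>Q\<close>; the conjugation symmetry of the rows makes them real.\<close>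

lemma real_coordinates:
  assumes "independent_conj a b"
  obtains c :: "3 \<Rightarrow> real" where "r = (\<Sum>i\<in>UNIV. c i * a $ i)" "s = (\<Sum>i\<in>UNIV. of_real (c i) * b $ i)"
proof -
  obtain q1 :: "real^3" and q2 :: "complex^3" where q:
    "(\<Sum>i\<in>UNIV. q1 $ i * a $ i) = 1" "(\<Sum>i\<in>UNIV. of_real (q1 $ i) * b $ i) = 0"
    "(\<Sum>i\<in>UNIV. q2 $ i * of_real (a $ i)) = 0" "(\<Sum>i\<in>UNIV. q2 $ i * b $ i) = 1"
    "(\<Sum>i\<in>UNIV. q2 $ i * cnj (b $ i)) = 0"
    by (rule dual_basis[OF assms])
  define c where "c i = r * q1 $ i + 2 * Re (s * q2 $ i)" for i
  have c: "of_real (c i) = of_real r * of_real (q1 $ i) + s * q2 $ i + cnj s * cnj (q2 $ i)" for i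
    by (simp add: c_def complex_eq_iff)
  have conj: "(\<Sum>i\<in>UNIV. cnj (q2 $ i) * of_real (a $ i)) = 0" "(\<Sum>i\<in>UNIV. cnj (q2 $ i) * b $ i) = 0"
    using arg_cong[OF q(3), of cnj] arg_cong[OF q(5), of cnj] by (simp_all add: cnj_sum)
  have "of_real (\<Sum>i\<in>UNIV. c i * a $ i) = of_real r * of_real (\<Sum>i\<in>UNIV. q1 $ i * a $ i)
      + s * (\<Sum>i\<in>UNIV. q2 $ i * of_real (a $ i)) + cnj s * (\<Sum>i\<in>UNIV. cnj (q2 $ i) * of_real (a $ i))"
    by (simp add: c distrib_right sum.distrib sum_distrib_left mult.assoc)
  then have "of_real (\<Sum>i\<in>UNIV. c i * a $ i) = (of_real r :: complex)" unfolding q conj by simp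
  then have "r = (\<Sum>i\<in>UNIV. c i * a $ i)" by (simp only: of_real_eq_iff)
  moreover have "(\<Sum>i\<in>UNIV. of_real (c i) * b $ i) = of_real r * (\<Sum>i\<in>UNIV. of_real (q1 $ i) * b $ i)
      + s * (\<Sum>i\<in>UNIV. q2 $ i * b $ i) + cnj s * (\<Sum>i\<in>UNIV. cnj (q2 $ i) * b $ i)"
    by (simp add: c distrib_right sum.distrib sum_distrib_left mult.assoc)
  then have "s = (\<Sum>i\<in>UNIV. of_real (c i) * b $ i)" unfolding q conj by simp
  ultimately show ?thesis by (rule that)
qed

text \<open>The dual basis recovers each integer coordinate linearly from \<open>(r, s)\<close>, so
  for a short vector all of them have absolute value below \<open>1\<close>. The summand
  \<open>1\<close> in \<open>K\<close> makes this bound strict.\<close>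

lemma lattice_of_discrete:
  assumes "independent_conj a b"
  shows "\<exists>\<epsilon>>0. \<forall>r s. (r, s) \<in> lattice_of a b \<longrightarrow> \<bar>r\<bar> < \<epsilon> \<longrightarrow> norm s < \<epsilon> \<longrightarrow> r = 0 \<and> s = 0"
proof -
  obtain q1 :: "real^3" and q2 :: "complex^3" where q:
    "\<forall>i j. of_real (a $ i * q1 $ j) + b $ i * q2 $ j + cnj (b $ i * q2 $ j) = (if i = j then 1 else 0)"
    by (rule dual_basis[OF assms])
  define K where "K = 1 + (\<Sum>j\<in>UNIV. \<bar>q1 $ j\<bar> + 2 * norm (q2 $ j))"
  have K0: "K > 0" unfolding K_def by (intro add_pos_nonneg sum_nonneg) auto
  have "r = 0 \<and> s = 0" if rs: "(r, s) \<in> lattice_of a b" "\<bar>r\<bar> < 1 / K" "norm s < 1 / K" for r s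
  proof -
    obtain n where n: "r = int_comb n a" "s = int_comb n b"
      using rs(1) by (rule lattice_ofE)
    have "n j = 0" for j
    proof -
      have "of_real r * of_real (q1 $ j) + s * q2 $ j + cnj (s * q2 $ j) =
          (\<Sum>i\<in>UNIV. of_int (n i) * (of_real (a $ i * q1 $ j) + b $ i * q2 $ j + cnj (b $ i * q2 $ j)))"
        by (simp add: n cnj_sum sum_distrib_right distrib_left sum.distrib mult.assoc)
      also have "\<dots> = of_int (n j)" unfolding q[rule_format] by (simp add: if_distrib sum.delta cong: if_cong)
      finally have "norm (of_int (n j) :: complex) \<le> \<bar>r\<bar> * \<bar>q1 $ j\<bar> + norm s * norm (q2 $ j) + norm s * norm (q2 $ j)"
        by (metis (no_types, lifting) norm_triangle_mono[OF norm_triangle_mono] complex_mod_cnj norm_mult norm_of_real order_refl)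
      also have "\<dots> \<le> 1 / K * \<bar>q1 $ j\<bar> + 1 / K * norm (q2 $ j) + 1 / K * norm (q2 $ j)"
        using rs by (intro add_mono mult_right_mono) auto
      also have "\<dots> = (\<bar>q1 $ j\<bar> + 2 * norm (q2 $ j)) / K" using K0 by (simp add: field_simps)
      also have "\<dots> < 1"
      proof -
        have "\<bar>q1 $ j\<bar> + 2 * norm (q2 $ j) \<le> (\<Sum>j\<in>UNIV. \<bar>q1 $ j\<bar> + 2 * norm (q2 $ j))"
          by (rule member_le_sum[of j UNIV "\<lambda>j. \<bar>q1 $ j\<bar> + 2 * norm (q2 $ j)"]) auto
        then show ?thesis using K0 by (simp add: K_def)
      qed
      finally show ?thesis by simp
    qed
    then show ?thesis by (simp add: n)
  qed
  then show ?thesis using K0 by (intro exI[of _ "1 / K"]) auto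
qed

text \<open>Rounding the real coordinates down leaves an error with coefficients in the unit
  interval, bounded by the sizes of the basis vectors.\<close>

lemma lattice_of_cocompact:
  assumes "independent_conj a b"
  shows "\<exists>R. \<forall>r s. \<exists>r' s'. (r', s') \<in> lattice_of a b \<and> \<bar>r - r'\<bar> \<le> R \<and> norm (s - s') \<le> R"
proof (rule exI, intro allI)
  fix r s
  obtain c :: "3 \<Rightarrow> real" where c: "r = (\<Sum>i\<in>UNIV. c i * a $ i)" "s = (\<Sum>i\<in>UNIV. of_real (c i) * b $ i)"
    by (rule real_coordinates[OF assms])
  have fl: "\<bar>c i - of_int \<lfloor>c i\<rfloor>\<bar> \<le> 1" for i by linarith
  define r' where "r' = (\<Sum>i\<in>UNIV. of_int \<lfloor>c i\<rfloor> * a $ i)"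
  define s' where "s' = (\<Sum>i\<in>UNIV. of_int \<lfloor>c i\<rfloor> * b $ i)"
  have "\<bar>r - r'\<bar> = \<bar>\<Sum>i\<in>UNIV. (c i - of_int \<lfloor>c i\<rfloor>) * a $ i\<bar>"
    by (simp add: c r'_def sum_subtractf left_diff_distrib)
  also have "\<dots> \<le> (\<Sum>i\<in>UNIV. \<bar>(c i - of_int \<lfloor>c i\<rfloor>) * a $ i\<bar>)" by (rule sum_abs)
  also have "\<dots> \<le> (\<Sum>i\<in>UNIV. 1 * \<bar>a $ i\<bar>)"
    unfolding abs_mult by (intro sum_mono mult_right_mono fl) auto
  finally have 1: "\<bar>r - r'\<bar> \<le> (\<Sum>i\<in>UNIV. \<bar>a $ i\<bar>)" by simp
  have "norm (s - s') = norm (\<Sum>i\<in>UNIV. of_real (c i - of_int \<lfloor>c i\<rfloor>) * b $ i)"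
    by (simp add: c s'_def sum_subtractf left_diff_distrib)
  also have "\<dots> \<le> (\<Sum>i\<in>UNIV. norm (of_real (c i - of_int \<lfloor>c i\<rfloor>) * b $ i))" by (rule norm_sum)
  also have "\<dots> \<le> (\<Sum>i\<in>UNIV. 1 * norm (b $ i))"
    unfolding norm_mult norm_of_real by (intro sum_mono mult_right_mono fl) auto
  finally have 2: "norm (s - s') \<le> (\<Sum>i\<in>UNIV. norm (b $ i))" by simp
  have "(\<Sum>i\<in>UNIV. \<bar>a $ i\<bar>) \<ge> 0" "(\<Sum>i\<in>UNIV. norm (b $ i)) \<ge> 0" by (simp_all add: sum_nonneg)
  then show "\<exists>r' s'. (r', s') \<in> lattice_of a b \<and> \<bar>r - r'\<bar> \<le> (\<Sum>i\<in>UNIV. \<bar>a $ i\<bar>) + (\<Sum>i\<in>UNIV. norm (b $ i))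
      \<and> norm (s - s') \<le> (\<Sum>i\<in>UNIV. \<bar>a $ i\<bar>) + (\<Sum>i\<in>UNIV. norm (b $ i))"
    using 1 2 lattice_ofI[of "\<lambda>i. \<lfloor>c i\<rfloor>" a b, folded r'_def s'_def]
    by (intro exI[of _ r'] exI[of _ s'] conjI) linarith+
qed

lemma lattice_of_add:
  assumes "(r, s) \<in> lattice_of a b" "(r', s') \<in> lattice_of a b"
  shows "(r + r', s + s') \<in> lattice_of a b"
proof -
  obtain n where n: "r = int_comb n a" "s = int_comb n b"
    using assms(1) by (rule lattice_ofE)
  obtain n' where n': "r' = int_comb n' a" "s' = int_comb n' b"
    using assms(2) by (rule lattice_ofE)
  show ?thesis using lattice_ofI[of "\<lambda>i. n i + n' i" a b]
    by (simp add: n n' distrib_right sum.distrib)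
qed

lemma lattice_of_int_mult:
  assumes "(r, s) \<in> lattice_of a b"
  shows "(of_int k * r, of_int k * s) \<in> lattice_of a b"
proof -
  obtain n where n: "r = int_comb n a" "s = int_comb n b"
    using assms(1) by (rule lattice_ofE)
  show ?thesis using lattice_ofI[of "\<lambda>i. k * n i" a b]
    by (simp add: n sum_distrib_left mult.assoc)
qed

lemma (in cubic_roots) inoue_lattice_of:
  assumes ind: "independent_conj a b"
    and ma: "\<And>i. \<alpha> * a $ i = int_comb (m i) a"
    and mb: "\<And>i. \<beta> * b $ i = int_comb (m i) b"
  shows "inoue_lattice \<theta>1 \<theta>2 \<alpha> \<beta> (lattice_of a b)"
proof -
  have scale: "(\<alpha> * r, \<beta> * s) \<in> lattice_of a b" if rs: "(r, s) \<in> lattice_of a b" for r s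
  proof -
    obtain n where n: "r = int_comb n a" "s = int_comb n b"
      using rs by (rule lattice_ofE)
    have "\<alpha> * r = (\<Sum>i\<in>UNIV. of_int (n i) * (\<alpha> * a $ i))" by (simp add: n sum_distrib_left mult_ac)
    also have "\<dots> = (\<Sum>j\<in>UNIV. of_int (\<Sum>i\<in>UNIV. n i * m i j) * a $ j)"
      unfolding ma by (simp add: sum_distrib_left sum_distrib_right mult.assoc) (rule sum.swap)
    finally have 1: "\<alpha> * r = \<dots>" .
    have "\<beta> * s = (\<Sum>i\<in>UNIV. of_int (n i) * (\<beta> * b $ i))" by (simp add: n sum_distrib_left mult_ac)
    also have "\<dots> = (\<Sum>j\<in>UNIV. of_int (\<Sum>i\<in>UNIV. n i * m i j) * b $ j)"
      unfolding mb by (simp add: sum_distrib_left sum_distrib_right mult.assoc) (rule sum.swap)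
    finally show ?thesis unfolding 1 by (simp only: lattice_ofI)
  qed
  show ?thesis
  proof
    show "(r / \<alpha>, s / \<beta>) \<in> lattice_of a b" if rs: "(r, s) \<in> lattice_of a b" for r s
    proof -
      \<comment> \<open>The constant term of the cubic is \<open>-1\<close>, so \<open>1 / \<alpha>
        = \<alpha>\<^sup>2 - \<theta>2 * \<alpha> + \<theta>1\<close> is again an integer polynomial
        in \<open>\<alpha>\<close>, and likewise for \<open>\<beta>\<close>.\<close>
      have "\<alpha> * (\<alpha>\<^sup>2 * r + of_int (- \<theta>2) * (\<alpha> * r) + of_int \<theta>1 * r) = r"
        using arg_cong[OF cubic_alpha, of "\<lambda>x. x * r"] by (simp add: algebra_simps power2_eq_square power3_eq_cube)
      moreover have "\<beta> * (\<beta>\<^sup>2 * s + of_int (- \<theta>2) * (\<beta> * s) + of_int \<theta>1 * s) = s"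
        using arg_cong[OF cubic_beta, of "\<lambda>x. x * s"] by (simp add: algebra_simps power2_eq_square power3_eq_cube)
      ultimately have "r / \<alpha> = \<alpha> * (\<alpha> * r) + of_int (- \<theta>2) * (\<alpha> * r) + of_int \<theta>1 * r"
        "s / \<beta> = \<beta> * (\<beta> * s) + of_int (- \<theta>2) * (\<beta> * s) + of_int \<theta>1 * s"
        using alpha_gt_1 beta_neq(1) by (simp_all add: field_simps power2_eq_square)
      then show ?thesis
        using rs by (simp only:) (intro lattice_of_add scale lattice_of_int_mult)
    qed
    show "(0, 0) \<in> lattice_of a b" using lattice_ofI[of "\<lambda>i. 0" a b] by simp
    show "(- r, - s) \<in> lattice_of a b" if "(r, s) \<in> lattice_of a b" for r s
      using lattice_of_int_mult[OF that, of "- 1"] by simp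
  qed (fact alpha_gt_1 norm_beta cubic_alpha cubic_beta theta_neq lattice_of_add scale
        lattice_of_discrete[OF ind] lattice_of_cocompact[OF ind])+
qed

context inoue_lattice
begin

lemma norm_beta_lt_1: "norm \<beta> < 1"
proof (rule power2_less_imp_less)
  show "(norm \<beta>)\<^sup>2 < 1\<^sup>2" unfolding norm_beta using alpha_gt_1 by simp
qed simp

text \<open>Positive powers of \<open>(\<alpha>, \<beta>)\<close> shrink a vector
  \<open>(0, s)\<close> and negative ones shrink \<open>(r, 0)\<close>, both within
  \<open>L\<close>; discreteness forces the vector to be zero.\<close>

lemma eq_zero_iff:
  assumes rs: "(r, s) \<in> L"
  shows "r = 0 \<longleftrightarrow> s = 0"
proof -
  obtain \<epsilon> where \<epsilon>: "\<epsilon> > 0" "\<And>r s. (r, s) \<in> L \<Longrightarrow> \<bar>r\<bar> < \<epsilon> \<Longrightarrow> norm s < \<epsilon> \<Longrightarrow> r = 0 \<and> s = 0"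
    using discrete by blast
  show ?thesis
  proof
    assume r: "r = 0"
    have "(\<lambda>n. norm \<beta> ^ n * norm s) \<longlonglongrightarrow> 0 * norm s"
      by (intro tendsto_mult tendsto_const LIMSEQ_power_zero) (use norm_beta_lt_1 in simp)
    then have "eventually (\<lambda>n. norm \<beta> ^ n * norm s < \<epsilon>) sequentially"
      using \<epsilon>(1) by (intro order_tendstoD(2)) auto
    then obtain n where "norm (\<beta> ^ n * s) < \<epsilon>" by (auto simp: eventually_sequentially norm_mult norm_power)
    moreover have "(\<alpha> ^ n * r, \<beta> ^ n * s) \<in> L" using powi_mem[OF rs, of "int n"] by simp
    ultimately show "s = 0" using \<epsilon> r beta_neq_0 by fastforce
  next
    assume s: "s = 0"
    have "(\<lambda>n. (1 / \<alpha>) ^ n * \<bar>r\<bar>) \<longlonglongrightarrow> 0 * \<bar>r\<bar>"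
      by (intro tendsto_mult tendsto_const LIMSEQ_power_zero) (use alpha_gt_1 in simp)
    then have "eventually (\<lambda>n. (1 / \<alpha>) ^ n * \<bar>r\<bar> < \<epsilon>) sequentially"
      using \<epsilon>(1) by (intro order_tendstoD(2)) auto
    then obtain n where "(1 / \<alpha>) ^ n * \<bar>r\<bar> < \<epsilon>" by (auto simp: eventually_sequentially)
    then have "\<bar>(1 / \<alpha>) ^ n * r\<bar> < \<epsilon>" using alpha_gt_1 by (simp add: abs_mult)
    moreover have "((1 / \<alpha>) ^ n * r, \<beta> powi (- int n) * s) \<in> L"
      using powi_mem[OF rs, of "- int n"] alpha_gt_1 by (simp add: power_int_minus power_inverse field_simps)
    ultimately have "(1 / \<alpha>) ^ n * r = 0" using \<epsilon> s by fastforce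
    then show "r = 0" using alpha_gt_1 by simp
  qed
qed

end

section \<open>Ideals of the cubic order\<close>

abbreviation ipoly :: "int poly \<Rightarrow> 'a::comm_ring_1 \<Rightarrow> 'a" where
  "ipoly p x \<equiv> poly (map_poly of_int p) x"

lemma ipoly_pCons: "ipoly (pCons k p) x = of_int k + x * ipoly p x"
  by (simp add: map_poly_pCons)

lemma ipoly_const: "ipoly [:k:] x = of_int k"
  by (simp add: map_poly_pCons)

lemma ipoly_add: "ipoly (p + q) x = ipoly p x + ipoly q x"
proof -
  have "map_poly of_int (p + q) = (map_poly of_int p + map_poly of_int q :: 'a poly)"
    by (simp add: poly_eq_iff coeff_map_poly)
  then show ?thesis by simp
qed

lemma ipoly_smult: "ipoly (smult k p) x = of_int k * ipoly p x"
proof -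
  have "map_poly of_int (smult k p) = (smult (of_int k) (map_poly of_int p) :: 'a poly)"
    by (simp add: poly_eq_iff coeff_map_poly)
  then show ?thesis by simp
qed

lemma ipoly_minus: "ipoly (- p) x = - ipoly p x"
  using ipoly_smult[of "- 1" p x] by simp

lemma ipoly_diff: "ipoly (p - q) x = ipoly p x - ipoly q x"
  using ipoly_add[of p "- q" x] by (simp add: ipoly_minus)

lemma ipoly_mult: "ipoly (p * q) x = ipoly p x * ipoly q x"
proof (induction p)
  case (pCons k p)
  have "ipoly (pCons k p * q) x = ipoly (smult k q + pCons 0 (p * q)) x" by simp
  also have "\<dots> = of_int k * ipoly q x + x * (ipoly p x * ipoly q x)"
    by (simp only: ipoly_add ipoly_smult ipoly_pCons pCons.IH of_int_0 add_0)
  finally show ?case by (simp add: ipoly_pCons algebra_simps)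
qed simp

lemma ipoly_sum: "ipoly (sum f A) x = (\<Sum>i\<in>A. ipoly (f i) x)"
  by (induction A rule: infinite_finite_induct) (simp_all add: ipoly_add)

definition Zset :: "real \<Rightarrow> real set" where
  "Zset \<alpha> = range (\<lambda>p. ipoly p \<alpha>)"

lemma ZsetI: "ipoly p \<alpha> \<in> Zset \<alpha>"
  by (simp add: Zset_def)

lemma Zset_add: "x \<in> Zset \<alpha> \<Longrightarrow> y \<in> Zset \<alpha> \<Longrightarrow> x + y \<in> Zset \<alpha>"
  unfolding Zset_def by (auto simp flip: ipoly_add)

lemma Zset_mult: "x \<in> Zset \<alpha> \<Longrightarrow> y \<in> Zset \<alpha> \<Longrightarrow> x * y \<in> Zset \<alpha>"
  unfolding Zset_def by (auto simp flip: ipoly_mult)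

lemma Zset_of_int: "of_int k \<in> Zset \<alpha>"
  using ZsetI[of "[:k:]" \<alpha>] by (simp add: ipoly_const)

lemma Zset_minus: "x \<in> Zset \<alpha> \<Longrightarrow> - x \<in> Zset \<alpha>"
  using Zset_mult[of "of_int (- 1)" \<alpha> x] Zset_of_int[of "- 1" \<alpha>] by simp

lemma Zset_self: "\<alpha> \<in> Zset \<alpha>"
  using ZsetI[of "[:0, 1:]" \<alpha>] by (simp add: ipoly_pCons)

lemma Z_adjoin_simps:
  "carrier (Z_adjoin \<alpha>) = Zset \<alpha>" "x \<otimes>\<^bsub>Z_adjoin \<alpha>\<^esub> y = x * y" "x \<oplus>\<^bsub>Z_adjoin \<alpha>\<^esub> y = x + y"
  "\<one>\<^bsub>Z_adjoin \<alpha>\<^esub> = 1" "\<zero>\<^bsub>Z_adjoin \<alpha>\<^esub> = 0"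
  by (auto simp: Z_adjoin_def Zset_def)

lemma ring_Z_adjoin: "ring (Z_adjoin \<alpha>)"
proof (intro ringI abelian_groupI monoidI, unfold Z_adjoin_simps)
  show "0 \<in> Zset \<alpha>" "1 \<in> Zset \<alpha>" using Zset_of_int[of 0] Zset_of_int[of 1] by simp_all
  show "\<exists>y\<in>Zset \<alpha>. y + x = 0" if "x \<in> Zset \<alpha>" for x
    using Zset_minus[OF that] by (intro bexI[of _ "- x"]) simp_all
qed (auto simp: Zset_add Zset_mult algebra_simps)

lemma ideal_Z_adjoin_iff:
  "ideal I (Z_adjoin \<alpha>) \<longleftrightarrow> I \<subseteq> Zset \<alpha> \<and> 0 \<in> I \<and> (\<forall>x\<in>I. \<forall>y\<in>I. x + y \<in> I) \<and> (\<forall>x\<in>I. \<forall>r\<in>Zset \<alpha>. r * x \<in> I)"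
proof
  assume "ideal I (Z_adjoin \<alpha>)"
  then interpret ideal I "Z_adjoin \<alpha>" .
  show "I \<subseteq> Zset \<alpha> \<and> 0 \<in> I \<and> (\<forall>x\<in>I. \<forall>y\<in>I. x + y \<in> I) \<and> (\<forall>x\<in>I. \<forall>r\<in>Zset \<alpha>. r * x \<in> I)"
    using a_subset additive_subgroup.zero_closed[OF additive_subgroup_axioms]
      additive_subgroup.a_closed[OF additive_subgroup_axioms] I_l_closed
    unfolding Z_adjoin_simps by auto
next
  assume I: "I \<subseteq> Zset \<alpha> \<and> 0 \<in> I \<and> (\<forall>x\<in>I. \<forall>y\<in>I. x + y \<in> I) \<and> (\<forall>x\<in>I. \<forall>r\<in>Zset \<alpha>. r * x \<in> I)"
  interpret ring "Z_adjoin \<alpha>" by (rule ring_Z_adjoin)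
  have neg: "\<ominus>\<^bsub>Z_adjoin \<alpha>\<^esub> x = - x" if "x \<in> I" for x
    using that I Zset_minus by (intro minus_equality) (auto simp: Z_adjoin_simps)
  show "ideal I (Z_adjoin \<alpha>)"
  proof (rule idealI[OF ring_Z_adjoin])
    show "subgroup I (add_monoid (Z_adjoin \<alpha>))"
    proof
      show "inv\<^bsub>add_monoid (Z_adjoin \<alpha>)\<^esub> x \<in> I" if "x \<in> I" for x
      proof -
        have "of_int (- 1) * x \<in> I" using I that Zset_of_int by blast
        then show ?thesis using neg[OF that] by (simp add: a_inv_def)
      qed
    qed (use I in \<open>auto simp: Z_adjoin_simps\<close>)
  qed (use I in \<open>auto simp: Z_adjoin_simps mult.commute\<close>)
qed

lemma nonzero_ideals_iff:
  "J \<in> nonzero_ideals \<alpha> \<longleftrightarrow> J \<subseteq> Zset \<alpha> \<and> (\<forall>x\<in>J. \<forall>y\<in>J. x + y \<in> J) \<and> (\<forall>x\<in>J. \<forall>r\<in>Zset \<alpha>. r * x \<in> J)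
     \<and> (\<exists>x\<in>J. x \<noteq> 0)"
proof -
  have "0 \<in> J" if "x \<in> J" "\<forall>x\<in>J. \<forall>r\<in>Zset \<alpha>. r * x \<in> J" for x
    using that Zset_of_int[of 0 \<alpha>] by fastforce
  then show ?thesis unfolding nonzero_ideals_def ideal_Z_adjoin_iff by blast
qed

lemma nonzero_idealsD:
  assumes "J \<in> nonzero_ideals \<alpha>"
  shows "x \<in> J \<Longrightarrow> x \<in> Zset \<alpha>" "x \<in> J \<Longrightarrow> y \<in> J \<Longrightarrow> x + y \<in> J" "x \<in> J \<Longrightarrow> r \<in> Zset \<alpha> \<Longrightarrow> r * x \<in> J"
    "x \<in> J \<Longrightarrow> of_int k * x \<in> J" "x \<in> J \<Longrightarrow> y \<in> J \<Longrightarrow> x - y \<in> J"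
proof -
  show 1: "x \<in> J \<Longrightarrow> x \<in> Zset \<alpha>" "x \<in> J \<Longrightarrow> y \<in> J \<Longrightarrow> x + y \<in> J" "x \<in> J \<Longrightarrow> r \<in> Zset \<alpha> \<Longrightarrow> r * x \<in> J" for x y r
    using assms unfolding nonzero_ideals_iff by auto
  show 2: "x \<in> J \<Longrightarrow> of_int k * x \<in> J" for x k by (rule 1(3)[OF _ Zset_of_int])
  show "x \<in> J \<Longrightarrow> y \<in> J \<Longrightarrow> x - y \<in> J" using 1(2)[of x "of_int (- 1) * y"] 2[of y "- 1"] by simp
qed

text \<open>A real factor \<open>\<mu>\<close> with \<open>\<mu> I = J\<close> is automatically a
  quotient of elements of the order: for nonzero \<open>u\<close> in \<open>I\<close>, both
  \<open>\<mu> * u\<close> and \<open>u\<close> lie in it.\<close>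

lemma ideal_equiv_iff:
  "(I, J) \<in> ideal_equiv \<alpha> \<longleftrightarrow> I \<in> nonzero_ideals \<alpha> \<and> J \<in> nonzero_ideals \<alpha> \<and> (\<exists>\<mu>. \<mu> \<noteq> 0 \<and> (*) \<mu> ` I = J)"
proof
  assume "(I, J) \<in> ideal_equiv \<alpha>"
  then obtain x y where IJ: "I \<in> nonzero_ideals \<alpha>" "J \<in> nonzero_ideals \<alpha>"
    and xy: "x \<noteq> 0" "y \<noteq> 0" "(*) x ` I = (*) y ` J"
    by (auto simp: ideal_equiv_def)
  have "(*) (x / y) ` I = (\<lambda>t. t / y) ` (*) x ` I" by (simp add: image_image)
  also have "\<dots> = J" using xy by (simp add: image_image)
  finally show "I \<in> nonzero_ideals \<alpha> \<and> J \<in> nonzero_ideals \<alpha> \<and> (\<exists>\<mu>. \<mu> \<noteq> 0 \<and> (*) \<mu> ` I = J)"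
    using IJ xy by (intro conjI exI[of _ "x / y"]) auto
next
  assume *: "I \<in> nonzero_ideals \<alpha> \<and> J \<in> nonzero_ideals \<alpha> \<and> (\<exists>\<mu>. \<mu> \<noteq> 0 \<and> (*) \<mu> ` I = J)"
  then obtain \<mu> where \<mu>: "\<mu> \<noteq> 0" "(*) \<mu> ` I = J" by blast
  obtain u where u: "u \<in> I" "u \<noteq> 0" using * unfolding nonzero_ideals_iff by blast
  have "\<mu> * u \<in> J" using u \<mu> by blast
  then have Z: "\<mu> * u \<in> Zset \<alpha>" "u \<in> Zset \<alpha>" using * u nonzero_idealsD(1) by blast+
  have "(*) (\<mu> * u) ` I = (*) u ` J" unfolding \<mu>(2)[symmetric] image_image by (simp add: mult_ac)
  then have "\<exists>x\<in>Zset \<alpha>. \<exists>y\<in>Zset \<alpha>. x \<noteq> 0 \<and> y \<noteq> 0 \<and> (*) x ` I = (*) y ` J"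
    by (intro rev_bexI[OF Z(1)] rev_bexI[OF Z(2)]) (use u(2) \<mu>(1) in simp)
  then show "(I, J) \<in> ideal_equiv \<alpha>"
    using * by (simp add: ideal_equiv_def Z_adjoin_simps)
qed

lemma equiv_ideal_equiv: "equiv (nonzero_ideals \<alpha>) (ideal_equiv \<alpha>)"
proof (rule equivI)
  show "ideal_equiv \<alpha> \<subseteq> nonzero_ideals \<alpha> \<times> nonzero_ideals \<alpha>" by (auto simp: ideal_equiv_def)
  show "refl_on (nonzero_ideals \<alpha>) (ideal_equiv \<alpha>)"
    by (auto simp: refl_on_def ideal_equiv_iff intro!: exI[of _ 1])
  show "sym (ideal_equiv \<alpha>)"
    unfolding sym_def ideal_equiv_iff
  proof (intro allI impI conjI; elim conjE exE)
    fix I J :: "real set" and \<mu> :: real assume "\<mu> \<noteq> 0" "(*) \<mu> ` I = J"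
    then have "(*) (1 / \<mu>) ` J = I" by (auto simp: image_image)
    then show "\<exists>\<mu>. \<mu> \<noteq> 0 \<and> (*) \<mu> ` J = I" using \<open>\<mu> \<noteq> 0\<close> by (intro exI[of _ "1 / \<mu>"]) auto
  qed
  show "trans (ideal_equiv \<alpha>)"
    unfolding trans_def ideal_equiv_iff
  proof (intro allI impI conjI; elim conjE exE)
    fix I J K :: "real set" and \<mu> \<nu> :: real assume *: "\<mu> \<noteq> 0" "(*) \<mu> ` I = J" "\<nu> \<noteq> 0" "(*) \<nu> ` J = K"
    then have "(*) (\<nu> * \<mu>) ` I = K" by (auto simp: image_image mult.assoc)
    then show "\<exists>\<mu>. \<mu> \<noteq> 0 \<and> (*) \<mu> ` I = K" using * by (intro exI[of _ "\<nu> * \<mu>"]) auto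
  qed
qed

section \<open>The order and its ideals as lattices in
  \<open>\<real> \<times> \<complex>\<close>\<close>

context cubic_roots
begin

text \<open>The image of \<open>J\<close> under the real and the complex embedding jointly;
  \<open>UNIV\<close> yields the image of the whole order.\<close>

definition conj_lattice :: "real set \<Rightarrow> (real \<times> complex) set" where
  "conj_lattice J = {(ipoly p \<alpha>, ipoly p \<beta>) | p. ipoly p \<alpha> \<in> J}"

definition power_a :: "real^3" where "power_a = vector [1, \<alpha>, \<alpha>\<^sup>2]"
definition power_b :: "complex^3" where "power_b = vector [1, \<beta>, \<beta>\<^sup>2]"

lemma power_nth [simp]:
  "power_a $ 1 = 1" "power_a $ 2 = \<alpha>" "power_a $ 3 = \<alpha>\<^sup>2"
  "power_b $ 1 = 1" "power_b $ 2 = \<beta>" "power_b $ 3 = \<beta>\<^sup>2"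
  by (simp_all add: power_a_def power_b_def vector_3)

text \<open>Combining the equations by the quadratic polynomial that vanishes at two of the roots
  isolates the coefficient of the third, as in Lagrange interpolation; the roots are
  distinct.\<close>

lemma vandermonde_zero:
  fixes r s t :: complex
  assumes 1: "r + s + t = 0" and 2: "r * of_real \<alpha> + s * \<beta> + t * cnj \<beta> = 0"
    and 3: "r * (of_real \<alpha>)\<^sup>2 + s * \<beta>\<^sup>2 + t * (cnj \<beta>)\<^sup>2 = 0"
  shows "r = 0 \<and> s = 0 \<and> t = 0"
proof -
  let ?a = "of_real \<alpha> :: complex" and ?c = "cnj \<beta>"
  have "r * ((?a - \<beta>) * (?a - ?c)) = 0"
  proof -
    have "r * ((?a - \<beta>) * (?a - ?c)) = (r * ?a\<^sup>2 + s * \<beta>\<^sup>2 + t * ?c\<^sup>2) - (\<beta> + ?c) * (r * ?a + s * \<beta> + t * ?c)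
        + \<beta> * ?c * (r + s + t)" by (simp add: algebra_simps power2_eq_square)
    then show ?thesis unfolding 1 2 3 by simp
  qed
  moreover have "s * ((\<beta> - ?a) * (\<beta> - ?c)) = 0"
  proof -
    have "s * ((\<beta> - ?a) * (\<beta> - ?c)) = (r * ?a\<^sup>2 + s * \<beta>\<^sup>2 + t * ?c\<^sup>2) - (?a + ?c) * (r * ?a + s * \<beta> + t * ?c)
        + ?a * ?c * (r + s + t)" by (simp add: algebra_simps power2_eq_square)
    then show ?thesis unfolding 1 2 3 by simp
  qed
  ultimately have "r = 0" "s = 0" using beta_neq(2)[of \<alpha>] beta_neq(3)[of \<alpha>] beta_neq(4) by auto
  then show ?thesis using 1 by simp
qed

lemma independent_power: "independent_conj power_a power_b"
  unfolding independent_conj_def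
proof (intro allI impI)
  fix r s t :: complex
  assume "r *s (\<chi> i. of_real (power_a $ i)) + s *s power_b + t *s (\<chi> i. cnj (power_b $ i)) = 0"
  then show "r = 0 \<and> s = 0 \<and> t = 0"
    by (intro vandermonde_zero) (simp_all add: vec_eq_iff forall_3)
qed

text \<open>Reduction modulo the cubic is independent of the root inserted, so the same integers
  serve \<open>\<alpha>\<close> and \<open>\<beta>\<close>.\<close>

lemma ipoly_reduce:
  "\<exists>x y z :: int. ipoly p \<alpha> = of_int x + of_int y * \<alpha> + of_int z * \<alpha>\<^sup>2 \<and>
     ipoly p \<beta> = of_int x + of_int y * \<beta> + of_int z * \<beta>\<^sup>2"
proof (induction p)
  case 0
  show ?case by (intro exI[of _ 0]) simp
next
  case (pCons k p)
  then obtain x y z :: int where IH: "ipoly p \<alpha> = of_int x + of_int y * \<alpha> + of_int z * \<alpha>\<^sup>2"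
     "ipoly p \<beta> = of_int x + of_int y * \<beta> + of_int z * \<beta>\<^sup>2" by blast
  have "\<alpha> * \<alpha>\<^sup>2 = of_int \<theta>2 * \<alpha>\<^sup>2 + 1 - of_int \<theta>1 * \<alpha>" "\<beta> * \<beta>\<^sup>2 = of_int \<theta>2 * \<beta>\<^sup>2 + 1 - of_int \<theta>1 * \<beta>"
    using cubic_alpha cubic_beta by (simp_all add: power2_eq_square power3_eq_cube algebra_simps)
  then have cube: "\<alpha> * (of_int z * \<alpha>\<^sup>2) = of_int z * (of_int \<theta>2 * \<alpha>\<^sup>2 + 1 - of_int \<theta>1 * \<alpha>)"
    "\<beta> * (of_int z * \<beta>\<^sup>2) = of_int z * (of_int \<theta>2 * \<beta>\<^sup>2 + 1 - of_int \<theta>1 * \<beta>)"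
    by (metis mult.left_commute)+
  \<comment> \<open>Multiplying by the root creates a cube with coefficient \<open>z\<close>, which
    the cubic equation redistributes as \<open>z\<close>, \<open>- z * \<theta>1\<close> and
    \<open>z * \<theta>2\<close>.\<close>
  show ?case
    by (rule exI[of _ "k + z"], rule exI[of _ "x - z * \<theta>1"], rule exI[of _ "y + z * \<theta>2"])
       (simp add: ipoly_pCons IH distrib_left cube, simp add: algebra_simps power2_eq_square)
qed

lemma lattice_of_power: "lattice_of power_a power_b = conj_lattice UNIV"
proof (intro equalityI subrelI)
  fix r s assume "(r, s) \<in> lattice_of power_a power_b"
  then obtain n where n: "r = (\<Sum>i\<in>UNIV. of_int (n i) * power_a $ i)" "s = (\<Sum>i\<in>UNIV. of_int (n i) * power_b $ i)"
    by (rule lattice_ofE)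
  have "r = ipoly [:n 1, n 2, n 3:] \<alpha>" "s = ipoly [:n 1, n 2, n 3:] \<beta>"
    by (simp_all add: n sum_3 ipoly_pCons power2_eq_square algebra_simps)
  then show "(r, s) \<in> conj_lattice UNIV" unfolding conj_lattice_def by blast
next
  fix r s assume "(r, s) \<in> conj_lattice UNIV"
  then obtain p where p: "r = ipoly p \<alpha>" "s = ipoly p \<beta>" unfolding conj_lattice_def by blast
  obtain x y z :: int where xyz: "ipoly p \<alpha> = of_int x + of_int y * \<alpha> + of_int z * \<alpha>\<^sup>2"
     "ipoly p \<beta> = of_int x + of_int y * \<beta> + of_int z * \<beta>\<^sup>2" using ipoly_reduce by blast
  show "(r, s) \<in> lattice_of power_a power_b"
    using lattice_ofI[of "\<lambda>i. (vector [x, y, z] :: int^3) $ i" power_a power_b]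
    by (simp add: p xyz sum_3 vector_3)
qed

lemma inoue_lattice_UNIV: "inoue_lattice \<theta>1 \<theta>2 \<alpha> \<beta> (conj_lattice UNIV)"
proof -
  \<comment> \<open>The companion matrix of the cubic.\<close>
  define m :: "int^3^3" where "m = vector [vector [0, 1, 0], vector [0, 0, 1], vector [1, - \<theta>1, \<theta>2]]"
  have "\<alpha> * power_a $ i = (\<Sum>j\<in>UNIV. of_int (m $ i $ j) * power_a $ j)" for i
    using exhaust_3[of i] cubic_alpha
    by (auto simp: m_def sum_3 vector_3 power2_eq_square power3_eq_cube algebra_simps)
  moreover have "\<beta> * power_b $ i = (\<Sum>j\<in>UNIV. of_int (m $ i $ j) * power_b $ j)" for i
    using exhaust_3[of i] cubic_beta
    by (auto simp: m_def sum_3 vector_3 power2_eq_square power3_eq_cube algebra_simps)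
  ultimately show ?thesis
    using inoue_lattice_of[OF independent_power, of "\<lambda>i j. m $ i $ j"] by (simp add: lattice_of_power)
qed

text \<open>This is what makes \<open>\<alpha> \<mapsto> \<beta>\<close> a well-defined and
  injective map on the order. It is \<open>eq_zero_iff\<close> for the lattice of the whole
  order.\<close>

lemma ipoly_eq_0_iff: "ipoly p \<alpha> = 0 \<longleftrightarrow> ipoly p \<beta> = 0"
  using inoue_lattice.eq_zero_iff[OF inoue_lattice_UNIV, of "ipoly p \<alpha>" "ipoly p \<beta>"]
  unfolding conj_lattice_def by blast

lemma ipoly_eq_iff: "ipoly p \<alpha> = ipoly q \<alpha> \<longleftrightarrow> ipoly p \<beta> = ipoly q \<beta>"
  using ipoly_eq_0_iff[of "p - q"] by (simp add: ipoly_diff)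

lemma scale_ideal_closed:
  assumes "r \<in> Zset \<alpha>" "x \<in> J"
    and add: "\<And>x y. x \<in> J \<Longrightarrow> y \<in> J \<Longrightarrow> x + y \<in> J" and int: "\<And>k x. x \<in> J \<Longrightarrow> of_int k * x \<in> J"
    and mult: "\<And>x. x \<in> J \<Longrightarrow> \<alpha> * x \<in> J"
  shows "r * x \<in> J"
proof -
  have "ipoly p \<alpha> * x \<in> J" if "x \<in> J" for p x
    using that
  proof (induction p arbitrary: x)
    case 0
    then show ?case using int[of x 0] by simp
  next
    case (pCons k p)
    have "of_int k * x + ipoly p \<alpha> * (\<alpha> * x) \<in> J" by (intro add int mult pCons)
    then show ?case by (simp add: ipoly_pCons algebra_simps)
  qed
  then show ?thesis using assms(1,2) by (auto simp: Zset_def)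
qed

text \<open>The matrix \<open>M\<^sup>2 - (\<theta>\<^sub>2 - X) M + (X\<^sup>2 - \<theta>\<^sub>2 X + \<theta>\<^sub>1)\<close> at \<open>X = x\<close> is \<open>P'(x)\<close> times the projection onto the
  \<open>x\<close>-eigenline for every root \<open>x\<close> of the cubic, so a suitable column of this matrix is an eigenvector
  with entries in \<open>\<int>[x]\<close>.\<close>

lemma lattice_of_normal_form:
  assumes ind: "independent_conj a b"
    and ma: "\<And>i. \<alpha> * a $ i = int_comb (m i) a"
    and mb: "\<And>i. \<beta> * b $ i = int_comb (m i) b"
  obtains J c c' where "J \<in> nonzero_ideals \<alpha>" "c \<noteq> 0" "c' \<noteq> 0"
    "\<And>r s. (r, s) \<in> lattice_of a b \<longleftrightarrow> (c * r, c' * s) \<in> conj_lattice J"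
proof -
  obtain q1 :: "real^3" and q2 :: "complex^3" where
    dual: "\<forall>i j. of_real (a $ i * q1 $ j) + b $ i * q2 $ j + cnj (b $ i * q2 $ j) = (if i = j then 1 else 0)"
    and q1a: "(\<Sum>i\<in>UNIV. q1 $ i * a $ i) = 1"
    by (rule dual_basis[OF ind])
  \<comment> \<open>The column index is chosen so that the unit vector has a nonzero component in
    the \<open>\<alpha>\<close>-eigenline.\<close>
  obtain j where j: "q1 $ j \<noteq> 0" using q1a by (fastforce simp: sum_3)
  \<comment> \<open>Here \<open>d\<close> is the \<open>j\<close>-th unit vector, and
    \<open>m i j\<close> and \<open>m2 i\<close> are the entries of \<open>M d\<close> and
    \<open>M (M d)\<close>. The vectors \<open>X\<close>, \<open>Y\<close> and \<open>cnj Y\<close>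
    are the components of \<open>d\<close> for the eigenvalues \<open>\<alpha>\<close>,
    \<open>\<beta>\<close> and \<open>cnj \<beta>\<close>.\<close>
  define d :: "3 \<Rightarrow> int" where "d i = (if i = j then 1 else 0)" for i
  define m2 where "m2 i = (\<Sum>k\<in>UNIV. m i k * m k j)" for i
  define X where "X i = (of_real (a $ i * q1 $ j) :: complex)" for i
  define Y where "Y i = b $ i * q2 $ j" for i
  have mX: "(\<Sum>k\<in>UNIV. of_int (m i k) * X k) = of_real \<alpha> * X i" for i
  proof -
    have "(\<Sum>k\<in>UNIV. of_int (m i k) * X k) = of_real (int_comb (m i) a * q1 $ j)"
      by (simp add: X_def sum_distrib_right mult.assoc)
    then show ?thesis unfolding ma[symmetric] X_def by simp
  qed
  have mY: "(\<Sum>k\<in>UNIV. of_int (m i k) * Y k) = \<beta> * Y i" for i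
  proof -
    have "(\<Sum>k\<in>UNIV. of_int (m i k) * Y k) = int_comb (m i) b * q2 $ j"
      by (simp add: Y_def sum_distrib_right mult.assoc)
    then show ?thesis unfolding mb[symmetric] Y_def by simp
  qed
  have mY': "(\<Sum>k\<in>UNIV. of_int (m i k) * cnj (Y k)) = cnj \<beta> * cnj (Y i)" for i
    using arg_cong[OF mY[of i], of cnj] by (simp add: cnj_sum)
  have d: "of_int (d i) = X i + Y i + cnj (Y i)" for i
    using dual by (simp add: d_def X_def Y_def)
  have md: "m i j = (\<Sum>k\<in>UNIV. m i k * d k)" for i by (simp add: d_def if_distrib sum.delta cong: if_cong)
  have m: "of_int (m i j) = of_real \<alpha> * X i + \<beta> * Y i + cnj \<beta> * cnj (Y i)" for i
    unfolding md by (simp add: d distrib_left sum.distrib mX mY mY')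
  have m2: "of_int (m2 i) = (of_real \<alpha>)\<^sup>2 * X i + \<beta>\<^sup>2 * Y i + (cnj \<beta>)\<^sup>2 * cnj (Y i)" for i
  proof -
    have "of_int (m2 i) = (\<Sum>k\<in>UNIV. of_int (m i k) * (of_real \<alpha> * X k + \<beta> * Y k + cnj \<beta> * cnj (Y k)))"
      by (simp add: m2_def m)
    also have "\<dots> = of_real \<alpha> * (\<Sum>k\<in>UNIV. of_int (m i k) * X k) + \<beta> * (\<Sum>k\<in>UNIV. of_int (m i k) * Y k)
        + cnj \<beta> * (\<Sum>k\<in>UNIV. of_int (m i k) * cnj (Y k))"
      by (simp add: distrib_left sum.distrib sum_distrib_left mult_ac)
    finally show ?thesis unfolding mX mY mY' by (simp add: power2_eq_square mult.assoc)
  qed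
  define e where "e i = [:m2 i - \<theta>2 * m i j + \<theta>1 * d i, m i j - \<theta>2 * d i, d i:]" for i
  have e: "ipoly (e i) x = (x\<^sup>2 - of_int \<theta>2 * x + of_int \<theta>1) * of_int (d i) + (x - of_int \<theta>2) * of_int (m i j) + of_int (m2 i)"
    for i and x :: complex
    by (simp add: e_def ipoly_pCons power2_eq_square algebra_simps)
  have eX: "ipoly (e i) (of_real \<alpha>) = (of_real \<alpha> - \<beta>) * (of_real \<alpha> - cnj \<beta>) * X i" for i
    unfolding e d m m2 vieta1[symmetric] vieta2[symmetric] by (simp add: algebra_simps power2_eq_square)
  have eY: "ipoly (e i) \<beta> = (\<beta> - of_real \<alpha>) * (\<beta> - cnj \<beta>) * Y i" for i
    unfolding e d m m2 vieta1[symmetric] vieta2[symmetric] by (simp add: algebra_simps power2_eq_square)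
  \<comment> \<open>The other two roots are conjugate, so \<open>P'(\<alpha>)\<close> is the real
    number \<open>|\<alpha> - \<beta>|^2\<close>.\<close>
  define c where "c = (norm (of_real \<alpha> - \<beta>))\<^sup>2 * q1 $ j"
  define c' where "c' = (\<beta> - of_real \<alpha>) * (\<beta> - cnj \<beta>) * q2 $ j"
  have ea: "ipoly (e i) \<alpha> = c * a $ i" for i
  proof -
    have "of_real (ipoly (e i) \<alpha>) = ipoly (e i) (of_real \<alpha> :: complex)"
      by (simp add: e_def ipoly_pCons)
    also have "\<dots> = of_real (c * a $ i)"
      unfolding eX by (simp add: X_def c_def complex_norm_square del: of_real_power)
    finally show ?thesis by (simp only: of_real_eq_iff)
  qed
  have eb: "ipoly (e i) \<beta> = c' * b $ i" for i
    unfolding eY by (simp add: Y_def c'_def mult_ac)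
  have c0: "c \<noteq> 0" using j beta_neq(2)[of \<alpha>] by (auto simp: c_def)
  obtain i0 where i0: "a $ i0 \<noteq> 0" using q1a by (fastforce simp: sum_3)
  \<comment> \<open>Only \<open>q1 $ j\<close> was chosen nonzero. The transfer of zeros between
    \<open>\<alpha>\<close> and \<open>\<beta>\<close> rules out that \<open>q2 $ j\<close>
    vanishes.\<close>
  have c'0: "c' \<noteq> 0"
  proof
    assume "c' = 0"
    then have "ipoly (e i0) \<alpha> = 0" unfolding ipoly_eq_0_iff eb by simp
    then show False using c0 i0 by (simp add: ea)
  qed
  have L: "\<exists>p. c * r = ipoly p \<alpha> \<and> c' * s = ipoly p \<beta>" if rs: "(r, s) \<in> lattice_of a b" for r s
  proof -
    obtain n where n: "r = int_comb n a" "s = int_comb n b"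
      using rs by (rule lattice_ofE)
    have "c * r = ipoly (\<Sum>i\<in>UNIV. smult (n i) (e i)) \<alpha>" "c' * s = ipoly (\<Sum>i\<in>UNIV. smult (n i) (e i)) \<beta>"
      by (simp_all add: n ipoly_sum ipoly_smult ea eb sum_distrib_left mult_ac)
    then show ?thesis by blast
  qed
  interpret inoue_lattice \<theta>1 \<theta>2 \<alpha> \<beta> "lattice_of a b" by (rule inoue_lattice_of[OF ind ma mb])
  define J where "J = (*) c ` fst ` lattice_of a b"
  have JI: "c * r \<in> J" if "(r, s) \<in> lattice_of a b" for r s
    using that unfolding J_def by force
  have JE: "\<exists>r s. (r, s) \<in> lattice_of a b \<and> x = c * r" if "x \<in> J" for x
    using that unfolding J_def by force
  have J_add: "x + y \<in> J" if xy: "x \<in> J" "y \<in> J" for x y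
  proof -
    obtain r s r' s' where "(r, s) \<in> lattice_of a b" "x = c * r" "(r', s') \<in> lattice_of a b" "y = c * r'"
      using JE[OF xy(1)] JE[OF xy(2)] by blast
    then show ?thesis using JI[OF add_mem] by (simp add: distrib_left)
  qed
  have J_int: "of_int k * x \<in> J" if x: "x \<in> J" for k x
  proof -
    obtain r s where rs: "(r, s) \<in> lattice_of a b" "x = c * r" using JE[OF x] by blast
    show ?thesis using JI[OF of_int_mult_mem[OF rs(1)], of k] by (simp add: rs(2) mult.left_commute)
  qed
  have J_alpha: "\<alpha> * x \<in> J" if x: "x \<in> J" for x
  proof -
    obtain r s where rs: "(r, s) \<in> lattice_of a b" "x = c * r" using JE[OF x] by blast
    show ?thesis using JI[OF scale_mem[OF rs(1)]] by (simp add: rs(2) mult.left_commute)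
  qed
  have J: "J \<in> nonzero_ideals \<alpha>"
    unfolding nonzero_ideals_iff
  proof (intro conjI ballI)
    show "J \<subseteq> Zset \<alpha>" using JE L unfolding Zset_def by fastforce
    show "\<exists>x\<in>J. x \<noteq> 0" using obtain_nonzero JI c0 by (metis mult_eq_0_iff)
  qed (use J_add scale_ideal_closed[OF _ _ J_add J_int J_alpha] in auto)
  have "(r, s) \<in> lattice_of a b \<longleftrightarrow> (c * r, c' * s) \<in> conj_lattice J" for r s
  proof
    assume rs: "(r, s) \<in> lattice_of a b"
    show "(c * r, c' * s) \<in> conj_lattice J" using L[OF rs] JI[OF rs] unfolding conj_lattice_def by auto
  next
    assume "(c * r, c' * s) \<in> conj_lattice J"
    then obtain p where p: "c * r = ipoly p \<alpha>" "c' * s = ipoly p \<beta>" "ipoly p \<alpha> \<in> J"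
      unfolding conj_lattice_def by blast
    obtain r0 s0 where rs0: "(r0, s0) \<in> lattice_of a b" "ipoly p \<alpha> = c * r0" using JE[OF p(3)] by blast
    obtain p0 where p0: "c * r0 = ipoly p0 \<alpha>" "c' * s0 = ipoly p0 \<beta>" using L[OF rs0(1)] by blast
    have "ipoly p \<beta> = ipoly p0 \<beta>" using p0(1) rs0(2) ipoly_eq_iff by metis
    then have "c' * s = c' * s0" "c * r = c * r0" using p p0 rs0 by simp_all
    then have "s = s0" "r = r0" using c0 c'0 by simp_all
    then show "(r, s) \<in> lattice_of a b" using rs0 by simp
  qed
  then show ?thesis using that J c0 c'0 by blast
qed

lemma int_subgroup_generator:
  fixes S :: "int set"
  assumes pos: "k \<in> S" "k > 0" and sub: "\<And>x y n. x \<in> S \<Longrightarrow> y \<in> S \<Longrightarrow> x - n * y \<in> S"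
  obtains d where "d \<in> S" "d > 0" "\<forall>x\<in>S. d dvd x"
proof -
  define D where "D = (LEAST n. n > 0 \<and> int n \<in> S)"
  have "nat k > 0 \<and> int (nat k) \<in> S" using pos by simp
  then have D: "D > 0" "int D \<in> S" unfolding D_def by (metis (mono_tags, lifting) LeastI)+
  have "int D dvd x" if x: "x \<in> S" for x
  proof (rule ccontr)
    assume "\<not> int D dvd x"
    then have "x mod int D \<noteq> 0" using dvd_eq_mod_eq_0[of "int D" x] by blast
    moreover have "x mod int D \<ge> 0" using D(1) by (intro pos_mod_sign) simp
    moreover have rD: "x mod int D < int D" using D(1) by (intro pos_mod_bound) simp
    ultimately have r: "x mod int D > 0" by linarith
    have "x mod int D \<in> S" using sub[OF x D(2), of "x div int D"] by (simp add: minus_div_mult_eq_mod)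
    then have "nat (x mod int D) > 0 \<and> int (nat (x mod int D)) \<in> S" using r by simp
    then have "D \<le> nat (x mod int D)" unfolding D_def by (rule Least_le)
    then show False using r rD by linarith
  qed
  then show ?thesis using that[of "int D"] D by simp
qed

text \<open>The basis is in Hermite normal form with respect to \<open>1, \<alpha>, \<alpha>\<^sup>2\<close>.\<close>

lemma ideal_basis:
  assumes J: "J \<in> nonzero_ideals \<alpha>" and k: "of_int k \<in> J" "k > 0"
  obtains a b m where "independent_conj a b"
    "\<And>i. \<alpha> * a $ i = int_comb (m i) a"
    "\<And>i. \<beta> * b $ i = int_comb (m i) b"
    "lattice_of a b = conj_lattice J"
proof -
  note JD = nonzero_idealsD[OF J]
  have ak: "\<alpha> * of_int k \<in> J" "\<alpha>\<^sup>2 * of_int k \<in> J"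
    using JD(3)[OF k(1) Zset_self] JD(3)[OF JD(3)[OF k(1) Zset_self] Zset_self]
    by (simp_all add: power2_eq_square mult.assoc)
  have sub: "ipoly (p - smult n q) \<alpha> \<in> J" if "ipoly p \<alpha> \<in> J" "ipoly q \<alpha> \<in> J" for p q n
    unfolding ipoly_diff ipoly_smult by (rule JD(5)[OF that(1) JD(4)[OF that(2)]])
  \<comment> \<open>These are the possible leading coefficients of elements of \<open>J\<close>
    written with degree at most 0, 1 and 2 in \<open>\<alpha>\<close>. Each contains
    \<open>k\<close>, since \<open>J\<close> contains the products of \<open>k\<close> with
    \<open>1\<close>, \<open>\<alpha>\<close> and \<open>\<alpha>\<^sup>2\<close>.\<close>
  define S1 where "S1 = {x. ipoly [:x:] \<alpha> \<in> J}"
  define S2 where "S2 = {y. \<exists>x. ipoly [:x, y:] \<alpha> \<in> J}"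
  define S3 where "S3 = {z. \<exists>x y. ipoly [:x, y, z:] \<alpha> \<in> J}"
  have S1: "x - n * y \<in> S1" if "x \<in> S1" "y \<in> S1" for x y n
  proof -
    have "ipoly ([:x:] - smult n [:y:]) \<alpha> \<in> J"
      using that unfolding S1_def mem_Collect_eq by (rule sub)
    then show ?thesis by (simp add: S1_def)
  qed
  have S2: "y - n * y' \<in> S2" if "y \<in> S2" "y' \<in> S2" for y y' n
  proof -
    obtain x x' where "ipoly [:x, y:] \<alpha> \<in> J" "ipoly [:x', y':] \<alpha> \<in> J" using \<open>y \<in> S2\<close> \<open>y' \<in> S2\<close> unfolding S2_def by blast
    then have "ipoly ([:x, y:] - smult n [:x', y':]) \<alpha> \<in> J" by (rule sub)
    then have "ipoly [:x - n * x', y - n * y':] \<alpha> \<in> J" by simp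
    then show ?thesis unfolding S2_def by blast
  qed
  have S3: "z - n * z' \<in> S3" if "z \<in> S3" "z' \<in> S3" for z z' n
  proof -
    obtain x y x' y' where "ipoly [:x, y, z:] \<alpha> \<in> J" "ipoly [:x', y', z':] \<alpha> \<in> J"
      using \<open>z \<in> S3\<close> \<open>z' \<in> S3\<close> unfolding S3_def by blast
    then have "ipoly ([:x, y, z:] - smult n [:x', y', z':]) \<alpha> \<in> J" by (rule sub)
    then have "ipoly [:x - n * x', y - n * y', z - n * z':] \<alpha> \<in> J" by simp
    then show ?thesis unfolding S3_def by blast
  qed
  have "k \<in> S1" using k by (simp add: S1_def ipoly_pCons)
  then obtain d1 where d1: "d1 \<in> S1" "d1 > 0" "\<forall>x\<in>S1. d1 dvd x"
    by (rule int_subgroup_generator[OF _ k(2) S1])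
  have "ipoly [:0, k:] \<alpha> \<in> J" "ipoly [:0, 0, k:] \<alpha> \<in> J"
    using ak by (simp_all add: ipoly_pCons power2_eq_square mult.assoc)
  then have "k \<in> S2" "k \<in> S3" unfolding S2_def S3_def by blast+
  obtain d2 where d2: "d2 \<in> S2" "d2 > 0" "\<forall>x\<in>S2. d2 dvd x"
    by (rule int_subgroup_generator[OF \<open>k \<in> S2\<close> k(2) S2])
  obtain d3 where d3: "d3 \<in> S3" "d3 > 0" "\<forall>x\<in>S3. d3 dvd x"
    by (rule int_subgroup_generator[OF \<open>k \<in> S3\<close> k(2) S3])
  obtain x2 where x2: "ipoly [:x2, d2:] \<alpha> \<in> J" using d2(1) unfolding S2_def by blast
  obtain x3 y3 where x3: "ipoly [:x3, y3, d3:] \<alpha> \<in> J" using d3(1) unfolding S3_def by blast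
  define A :: "3 \<Rightarrow> int poly" where
    "A i = (if i = 1 then [:d1:] else if i = 2 then [:x2, d2:] else [:x3, y3, d3:])" for i
  have AJ: "ipoly (A i) \<alpha> \<in> J" for i using d1(1) x2 x3 unfolding A_def S1_def by simp
  \<comment> \<open>Division by the leading coefficients \<open>d3\<close>, \<open>d2\<close>,
    \<open>d1\<close> in turn eliminates one degree at a time, each remainder staying in
    \<open>J\<close>.\<close>
  have span: "\<exists>n. ipoly p \<alpha> = ipoly (\<Sum>i\<in>UNIV. smult (n i) (A i)) \<alpha>" if p: "ipoly p \<alpha> \<in> J" for p
  proof -
    obtain x y z where xyz: "ipoly p \<alpha> = of_int x + of_int y * \<alpha> + of_int z * \<alpha>\<^sup>2" using ipoly_reduce by blast
    then have p': "ipoly p \<alpha> = ipoly [:x, y, z:] \<alpha>" by (simp add: ipoly_pCons power2_eq_square algebra_simps)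
    then have "z \<in> S3" using p unfolding S3_def by auto
    then obtain n3 where n3: "z = d3 * n3" using d3(3) by blast
    have "ipoly ([:x, y, z:] - smult n3 [:x3, y3, d3:]) \<alpha> \<in> J"
      by (rule sub[OF _ x3]) (use p p' in simp)
    then have y: "ipoly [:x - n3 * x3, y - n3 * y3:] \<alpha> \<in> J" by (simp add: n3 mult.commute)
    then have "y - n3 * y3 \<in> S2" unfolding S2_def by blast
    then obtain n2 where n2: "y - n3 * y3 = d2 * n2" using d2(3) by blast
    have "ipoly ([:x - n3 * x3, y - n3 * y3:] - smult n2 [:x2, d2:]) \<alpha> \<in> J"
      by (rule sub[OF y x2])
    then have "ipoly [:x - n3 * x3 - n2 * x2:] \<alpha> \<in> J" by (simp add: n2 mult.commute)
    then have "x - n3 * x3 - n2 * x2 \<in> S1" unfolding S1_def by simp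
    then obtain n1 where n1: "x - n3 * x3 - n2 * x2 = d1 * n1" using d1(3) by blast
    have "x = d1 * n1 + n2 * x2 + n3 * x3" "y = d2 * n2 + n3 * y3" using n1 n2 by simp_all
    then have "[:x, y, z:] = (\<Sum>i\<in>UNIV. smult ((vector [n1, n2, n3] :: int^3) $ i) (A i))"
      by (simp add: sum_3 vector_3 A_def n3 mult.commute)
    then show ?thesis using p' by metis
  qed
  define a :: "real^3" where "a = (\<chi> i. ipoly (A i) \<alpha>)"
  define b :: "complex^3" where "b = (\<chi> i. ipoly (A i) \<beta>)"
  have comb: "int_comb n a = ipoly (\<Sum>i\<in>UNIV. smult (n i) (A i)) \<alpha>"
    "int_comb n b = ipoly (\<Sum>i\<in>UNIV. smult (n i) (A i)) \<beta>" for n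
    by (simp_all add: a_def b_def ipoly_sum ipoly_smult)
  have "\<exists>n. ipoly (pCons 0 (A i)) \<alpha> = ipoly (\<Sum>j\<in>UNIV. smult (n j) (A j)) \<alpha>" for i
  proof -
    have "ipoly (pCons 0 (A i)) \<alpha> \<in> J" using JD(3)[OF AJ Zset_self] by (simp add: ipoly_pCons)
    then show ?thesis using span by blast
  qed
  then obtain m where m: "\<And>i. ipoly (pCons 0 (A i)) \<alpha> = ipoly (\<Sum>j\<in>UNIV. smult (m i j) (A j)) \<alpha>" by metis
  show ?thesis
  proof (rule that)
    show "\<alpha> * a $ i = int_comb (m i) a" for i
      unfolding comb m[symmetric] by (simp add: a_def ipoly_pCons)
    show "\<beta> * b $ i = int_comb (m i) b" for i
      unfolding comb m[of i, unfolded ipoly_eq_iff, symmetric] by (simp add: b_def ipoly_pCons)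
    show "lattice_of a b = conj_lattice J"
    proof (intro equalityI subrelI)
      fix r s assume "(r, s) \<in> lattice_of a b"
      then obtain n where n: "r = int_comb n a" "s = int_comb n b"
        by (rule lattice_ofE)
      have "ipoly (\<Sum>i\<in>UNIV. smult (n i) (A i)) \<alpha> \<in> J"
        using AJ JD(2,4) by (simp add: sum_3 ipoly_add ipoly_smult)
      then show "(r, s) \<in> conj_lattice J" unfolding n comb conj_lattice_def by blast
    next
      fix r s assume "(r, s) \<in> conj_lattice J"
      then obtain p where p: "r = ipoly p \<alpha>" "s = ipoly p \<beta>" "ipoly p \<alpha> \<in> J" unfolding conj_lattice_def by blast
      obtain n where n: "ipoly p \<alpha> = ipoly (\<Sum>i\<in>UNIV. smult (n i) (A i)) \<alpha>" using span[OF p(3)] by blast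
      have "ipoly p \<beta> = ipoly (\<Sum>i\<in>UNIV. smult (n i) (A i)) \<beta>" using n ipoly_eq_iff by blast
      then show "(r, s) \<in> lattice_of a b" using lattice_ofI[of n a b] n by (simp add: p comb)
    qed
    show "independent_conj a b"
      unfolding independent_conj_def
    proof (intro allI impI)
      fix r s t :: complex
      assume "r *s (\<chi> i. of_real (a $ i)) + s *s b + t *s (\<chi> i. cnj (b $ i)) = 0"
      then have eq: "r * of_real (a $ i) + s * b $ i + t * cnj (b $ i) = 0" for i
        by (simp add: vec_eq_iff)
      \<comment> \<open>The basis is triangular in \<open>1, \<alpha>, \<alpha>\<^sup>2\<close> with
        positive diagonal \<open>d1\<close>, \<open>d2\<close>, \<open>d3\<close>, so independence
        reduces to that of the powers.\<close>
      define e0 where "e0 = r + s + t"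
      define e1 where "e1 = r * of_real \<alpha> + s * \<beta> + t * cnj \<beta>"
      define e2 where "e2 = r * (of_real \<alpha>)\<^sup>2 + s * \<beta>\<^sup>2 + t * (cnj \<beta>)\<^sup>2"
      have "of_int d1 * e0 = 0" using eq[of 1]
        by (simp add: a_def b_def A_def ipoly_pCons e0_def algebra_simps)
      then have 0: "e0 = 0" using d1(2) by simp
      have "of_int x2 * e0 + of_int d2 * e1 = 0" using eq[of 2]
        by (simp add: a_def b_def A_def ipoly_pCons e0_def e1_def algebra_simps)
      then have 1: "e1 = 0" using d2(2) 0 by simp
      have "of_int x3 * e0 + of_int y3 * e1 + of_int d3 * e2 = 0" using eq[of 3]
        by (simp add: a_def b_def A_def ipoly_pCons e0_def e1_def e2_def algebra_simps power2_eq_square)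
      then have 2: "e2 = 0" using d3(2) 0 1 by simp
      show "r = 0 \<and> s = 0 \<and> t = 0"
        using vandermonde_zero 0 1 2 unfolding e0_def e1_def e2_def by blast
    qed
  qed
qed

end

section \<open>Finiteness of the class number\<close>

context cubic_roots
begin

text \<open>The field norm: the squared modulus collects the factors at \<open>\<beta>\<close> and
  \<open>cnj \<beta>\<close>.\<close>

definition norm_elt :: "int poly \<Rightarrow> real" where
  "norm_elt p = ipoly p \<alpha> * (norm (ipoly p \<beta>))\<^sup>2"

lemma norm_elt_integer: "\<exists>k :: int. norm_elt p = of_int k"
proof -
  obtain x y z :: int where xyz: "ipoly p \<alpha> = of_int x + of_int y * \<alpha> + of_int z * \<alpha>\<^sup>2"
     "ipoly p \<beta> = of_int x + of_int y * \<beta> + of_int z * \<beta>\<^sup>2" using ipoly_reduce by blast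
  define A B C where "A = (of_real \<alpha> :: complex)" and "B = \<beta>" and "C = cnj \<beta>"
  \<comment> \<open>The norm form of \<open>x + y * X + z * X^2\<close>, expanded in the elementary
    symmetric functions of the roots with the values \<open>\<theta>2\<close>,
    \<open>\<theta>1\<close> and \<open>1\<close>.\<close>
  define k where "k = x ^ 3 + x * x * y * \<theta>2 + x * x * z * (\<theta>2 * \<theta>2 - 2 * \<theta>1) + x * y * y * \<theta>1
      + x * y * z * (\<theta>2 * \<theta>1 - 3) + x * z * z * (\<theta>1 * \<theta>1 - 2 * \<theta>2) + y ^ 3 + y * y * z * \<theta>2
      + y * z * z * \<theta>1 + z ^ 3"
  have id: "(x + y * A + z * A\<^sup>2) * ((x + y * B + z * B\<^sup>2) * (x + y * C + z * C\<^sup>2)) =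
      x ^ 3 + x * x * y * e1 + x * x * z * (e1 * e1 - 2 * e2) + x * y * y * e2 + x * y * z * (e1 * e2 - 3 * e3)
      + x * z * z * (e2 * e2 - 2 * e1 * e3) + y ^ 3 * e3 + y * y * z * e1 * e3 + y * z * z * e2 * e3 + z ^ 3 * e3 * e3"
    if "e1 = A + B + C" "e2 = A * (B + C) + B * C" "e3 = A * (B * C)" for x y z e1 e2 e3 :: complex
    unfolding that by (simp add: algebra_simps power2_eq_square power3_eq_cube)
  have "of_real (norm_elt p) = (of_int x + of_int y * A + of_int z * A\<^sup>2) *
      ((of_int x + of_int y * B + of_int z * B\<^sup>2) * (of_int x + of_int y * C + of_int z * C\<^sup>2))"
    unfolding norm_elt_def of_real_mult complex_norm_square xyz by (simp add: A_def B_def C_def)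
  also have "\<dots> = of_int k"
    unfolding k_def
    by (subst id[of "of_int \<theta>2" "of_int \<theta>1" 1])
       (simp_all add: A_def B_def C_def vieta1 vieta2 vieta3)
  finally have "of_real (norm_elt p) = (of_real (of_int k) :: complex)" by (simp only: of_real_of_int_eq)
  then have "norm_elt p = of_int k" by (simp only: of_real_eq_iff)
  then show ?thesis by blast
qed

lemma norm_elt_eq_0_iff: "norm_elt p = 0 \<longleftrightarrow> ipoly p \<alpha> = 0"
  using ipoly_eq_0_iff[of p] by (auto simp: norm_elt_def)

text \<open>Absolute norms are natural numbers, so a least one among the nonzero elements is
  attained.\<close>

lemma obtain_minimal_norm:
  assumes "J \<in> nonzero_ideals \<alpha>"
  obtains p where "ipoly p \<alpha> \<in> J" "ipoly p \<alpha> \<noteq> 0"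
    "\<And>q. ipoly q \<alpha> \<in> J \<Longrightarrow> ipoly q \<alpha> \<noteq> 0 \<Longrightarrow> \<bar>norm_elt p\<bar> \<le> \<bar>norm_elt q\<bar>"
proof -
  define K where "K p = nat \<lfloor>\<bar>norm_elt p\<bar>\<rfloor>" for p
  have K: "real (K p) = \<bar>norm_elt p\<bar>" for p
  proof -
    obtain k :: int where "norm_elt p = of_int k" using norm_elt_integer by blast
    then show ?thesis by (simp add: K_def)
  qed
  obtain x where "x \<in> J" "x \<noteq> 0" using assms unfolding nonzero_ideals_iff by blast
  moreover from this obtain p0 where "x = ipoly p0 \<alpha>" using nonzero_idealsD(1)[OF assms] unfolding Zset_def by blast
  ultimately have "ipoly p0 \<alpha> \<in> J \<and> ipoly p0 \<alpha> \<noteq> 0" by simp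
  from ex_has_least_nat[where P = "\<lambda>p. ipoly p \<alpha> \<in> J \<and> ipoly p \<alpha> \<noteq> 0" and m = K, OF this]
  obtain p where p: "ipoly p \<alpha> \<in> J" "ipoly p \<alpha> \<noteq> 0"
      "\<And>q. ipoly q \<alpha> \<in> J \<and> ipoly q \<alpha> \<noteq> 0 \<Longrightarrow> K p \<le> K q" by blast
  show ?thesis
  proof (rule that[OF p(1,2)])
    show "\<bar>norm_elt p\<bar> \<le> \<bar>norm_elt q\<bar>" if "ipoly q \<alpha> \<in> J" "ipoly q \<alpha> \<noteq> 0" for q
      using p(3)[of q] that unfolding K[symmetric] by simp
  qed
qed

text \<open>The value at \<open>\<alpha>\<close> is at most \<open>3 * \<alpha>\<^sup>2 / N\<close>
  and the one at \<open>\<beta>\<close> at most \<open>3 / N\<close>, because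
  \<open>|\<beta>| < 1\<close>. With the latter squared this produces the constant
  \<open>27 = 3 * 3^2\<close>.\<close>

lemma approx_bounds:
  assumes \<delta>: "\<bar>\<delta>1\<bar> < 1 / N" "\<bar>\<delta>2\<bar> < 1 / N" "\<bar>\<delta>3\<bar> < 1 / N" and N: "N > 27 * \<alpha>\<^sup>2"
  shows "\<bar>\<delta>1 + \<delta>2 * \<alpha> + \<delta>3 * \<alpha>\<^sup>2\<bar> * (norm (of_real \<delta>1 + of_real \<delta>2 * \<beta> + of_real \<delta>3 * \<beta>\<^sup>2))\<^sup>2 < 1"
    (is "\<bar>?d\<bar> * (norm ?e)\<^sup>2 < 1")
proof -
  have a1: "1 \<le> \<alpha>\<^sup>2" "\<alpha> \<le> \<alpha>\<^sup>2"
    using alpha_gt_1 by (simp_all add: one_le_power self_le_power less_imp_le)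
  have N1: "N > 1" using N a1 by linarith
  have "\<bar>?d\<bar> \<le> \<bar>\<delta>1\<bar> * 1 + \<bar>\<delta>2\<bar> * \<alpha> + \<bar>\<delta>3\<bar> * \<alpha>\<^sup>2"
    using abs_triangle_ineq[of "\<delta>1 + \<delta>2 * \<alpha>" "\<delta>3 * \<alpha>\<^sup>2"] abs_triangle_ineq[of \<delta>1 "\<delta>2 * \<alpha>"] alpha_gt_1
    by (simp add: abs_mult)
  also have "\<dots> \<le> 1 / N * \<alpha>\<^sup>2 + 1 / N * \<alpha>\<^sup>2 + 1 / N * \<alpha>\<^sup>2"
    using \<delta> a1 alpha_gt_1 N1 by (intro add_mono mult_mono) auto
  finally have 1: "\<bar>?d\<bar> \<le> 3 * \<alpha>\<^sup>2 / N" by simp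
  have nb: "norm \<beta> \<le> 1" "(norm \<beta>)\<^sup>2 \<le> 1" using norm_beta_lt_1 by (auto intro: power_le_one)
  have "norm ?e \<le> \<bar>\<delta>1\<bar> * 1 + \<bar>\<delta>2\<bar> * norm \<beta> + \<bar>\<delta>3\<bar> * (norm \<beta>)\<^sup>2"
    by (intro order_trans[OF norm_triangle_ineq] add_mono) (simp_all add: norm_mult norm_power)
  also have "\<dots> \<le> 1 / N * 1 + 1 / N * 1 + 1 / N * 1"
    using \<delta> nb N1 by (intro add_mono mult_mono) auto
  finally have "norm ?e \<le> 3 / N" by simp
  then have "(norm ?e)\<^sup>2 \<le> (3 / N)\<^sup>2"
    by (intro power_mono) auto
  with 1 have "\<bar>?d\<bar> * (norm ?e)\<^sup>2
      \<le> 3 * \<alpha>\<^sup>2 / N * (3 / N)\<^sup>2"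
    using N1 by (intro mult_mono) auto
  also have "\<dots> = 27 * \<alpha>\<^sup>2 / N * (1 / N)\<^sup>2" by (simp add: power2_eq_square)
  also have "\<dots> \<le> 27 * \<alpha>\<^sup>2 / N * 1" using N1 by (intro mult_left_mono power_le_one) auto
  also have "\<dots> < 1" using N N1 by simp
  finally show ?thesis .
qed

text \<open>Approximate the three coordinates of the quotient of \<open>v\<close> by
  \<open>p\<close> simultaneously by fractions with common denominator \<open>q\<close>, at most
  \<open>N ^ 3\<close> by Dirichlet. Then \<open>q v - p y\<close> lies in \<open>J\<close> and has
  smaller norm than \<open>p\<close>, so it is zero. The factorial is a multiple of every such
  \<open>q\<close> and does not depend on \<open>J\<close> or \<open>u\<close>.\<close>

lemma minimal_norm_divides_multiple:
  assumes N: "real N > 27 * \<alpha>\<^sup>2" and J: "J \<in> nonzero_ideals \<alpha>"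
    and p: "ipoly p \<alpha> \<in> J" "ipoly p \<alpha> \<noteq> 0"
      "\<And>q. ipoly q \<alpha> \<in> J \<Longrightarrow> ipoly q \<alpha> \<noteq> 0 \<Longrightarrow> \<bar>norm_elt p\<bar> \<le> \<bar>norm_elt q\<bar>"
    and u: "u \<in> J"
  shows "\<exists>y\<in>Zset \<alpha>. of_int (fact (N ^ 3)) * u = ipoly p \<alpha> * y"
proof -
  obtain v where v: "u = ipoly v \<alpha>" using nonzero_idealsD(1)[OF J u] unfolding Zset_def by blast
  have pb: "ipoly p \<beta> \<noteq> 0" using p(2) ipoly_eq_0_iff by blast
  obtain c :: "3 \<Rightarrow> real" where c: "ipoly v \<alpha> / ipoly p \<alpha> = (\<Sum>i\<in>UNIV. c i * power_a $ i)"
      "ipoly v \<beta> / ipoly p \<beta> = (\<Sum>i\<in>UNIV. of_real (c i) * power_b $ i)"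
    by (rule real_coordinates[OF independent_power])
  have "0 \<le> 27 * \<alpha>\<^sup>2" by simp
  then have "real N > 0" using N by linarith
  then have "N > 0" by simp
  define th :: "nat \<Rightarrow> real" where "th i = (if i = 0 then c 1 else if i = 1 then c 2 else c 3)" for i
  obtain q and k :: "nat \<Rightarrow> int" where q: "0 < q" "q \<le> int (N ^ 3)"
    and k: "\<And>i. i < 3 \<Longrightarrow> \<bar>of_int q * th i - of_int (k i)\<bar> < 1 / N"
    using Dirichlet_approx_simult[OF \<open>N > 0\<close>, of 3 th] by blast
  define y where "y = [:k 0, k 1, k 2:]"
  define \<delta>1 \<delta>2 \<delta>3 where "\<delta>1 = of_int q * c 1 - of_int (k 0)" and "\<delta>2 = of_int q * c 2 - of_int (k 1)"
    and "\<delta>3 = of_int q * c 3 - of_int (k 2)"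
  have \<delta>: "\<bar>\<delta>1\<bar> < 1 / N" "\<bar>\<delta>2\<bar> < 1 / N" "\<bar>\<delta>3\<bar> < 1 / N"
    using k[of 0] k[of 1] k[of 2] by (simp_all add: \<delta>1_def \<delta>2_def \<delta>3_def th_def)
  define e where "e = smult q v - p * y"
  have va: "ipoly v \<alpha> = ipoly p \<alpha> * (c 1 + c 2 * \<alpha> + c 3 * \<alpha>\<^sup>2)"
    using c(1) p(2) by (simp add: sum_3 field_simps)
  have vb: "ipoly v \<beta> = ipoly p \<beta> * (of_real (c 1) + of_real (c 2) * \<beta> + of_real (c 3) * \<beta>\<^sup>2)"
    using c(2) pb by (simp add: sum_3 field_simps)
  let ?d = "\<delta>1 + \<delta>2 * \<alpha> + \<delta>3 * \<alpha>\<^sup>2" and ?e = "of_real \<delta>1 + of_real \<delta>2 * \<beta> + of_real \<delta>3 * \<beta>\<^sup>2"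
  have ea: "ipoly e \<alpha> = ipoly p \<alpha> * ?d"
    unfolding e_def ipoly_diff ipoly_smult ipoly_mult va
    by (simp add: y_def \<delta>1_def \<delta>2_def \<delta>3_def ipoly_pCons algebra_simps power2_eq_square)
  have eb: "ipoly e \<beta> = ipoly p \<beta> * ?e"
    unfolding e_def ipoly_diff ipoly_smult ipoly_mult vb
    by (simp add: y_def \<delta>1_def \<delta>2_def \<delta>3_def ipoly_pCons algebra_simps power2_eq_square)
  have "\<bar>norm_elt e\<bar> = \<bar>norm_elt p\<bar> * (\<bar>?d\<bar> *
      (norm ?e)\<^sup>2)"
    unfolding norm_elt_def ea eb by (simp add: abs_mult norm_mult power_mult_distrib)
  also have "\<dots> < \<bar>norm_elt p\<bar> * 1"
    using p(2) norm_elt_eq_0_iff[of p] by (intro mult_strict_left_mono approx_bounds[OF \<delta> N]) simp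
  finally have less: "\<bar>norm_elt e\<bar> < \<bar>norm_elt p\<bar>" by simp
  have "of_int q * ipoly v \<alpha> - ipoly y \<alpha> * ipoly p \<alpha> \<in> J"
    using nonzero_idealsD(5)[OF J nonzero_idealsD(4)[OF J u] nonzero_idealsD(3)[OF J p(1) ZsetI]]
    by (simp add: v)
  then have "ipoly e \<alpha> \<in> J" by (simp add: e_def ipoly_diff ipoly_smult ipoly_mult mult.commute)
  then have "ipoly e \<alpha> = 0" using p(3)[of e] less by fastforce
  then have eq: "of_int q * u = ipoly p \<alpha> * ipoly y \<alpha>" by (simp add: e_def v ipoly_diff ipoly_smult ipoly_mult)
  have "nat q \<le> N ^ 3" using q(2) by (simp only: nat_le_iff)
  then have "nat q dvd fact (N ^ 3)" using q(1) by (intro dvd_fact) auto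
  then have "int (nat q) dvd int (fact (N ^ 3))" by (simp only: int_dvd_int_iff)
  then have "q dvd fact (N ^ 3)" using q by simp
  then obtain t where t: "fact (N ^ 3) = q * t" by blast
  have "of_int (fact (N ^ 3)) * u = of_int t * (of_int q * u)" unfolding t by simp
  also have "\<dots> = ipoly p \<alpha> * (of_int t * ipoly y \<alpha>)" unfolding eq by (simp add: mult_ac)
  finally show ?thesis using Zset_mult[OF Zset_of_int ZsetI] by blast
qed

text \<open>Scaling \<open>J\<close> by \<open>M / ipoly p \<alpha>\<close>, with \<open>p\<close>
  of minimal norm, keeps it inside the order and sends that minimal element to
  \<open>M\<close>.\<close>

lemma ideal_class_bounded_representatives:
  obtains M :: int where "M > 0"
    "\<And>J. J \<in> nonzero_ideals \<alpha> \<Longrightarrow> \<exists>J'. of_int M \<in> J' \<and> (J, J') \<in> ideal_equiv \<alpha>"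
proof -
  obtain N :: nat where N: "real N > 27 * \<alpha>\<^sup>2" using reals_Archimedean2 by blast
  define M :: int where "M = fact (N ^ 3)"
  show ?thesis
  proof (rule that)
    show "M > 0" by (simp add: M_def)
    fix J assume J: "J \<in> nonzero_ideals \<alpha>"
    obtain p where p: "ipoly p \<alpha> \<in> J" "ipoly p \<alpha> \<noteq> 0"
      "\<And>q. ipoly q \<alpha> \<in> J \<Longrightarrow> ipoly q \<alpha> \<noteq> 0 \<Longrightarrow> \<bar>norm_elt p\<bar> \<le> \<bar>norm_elt q\<bar>"
      using obtain_minimal_norm[OF J] by blast
    define \<mu> where "\<mu> = of_int M / ipoly p \<alpha>"
    have \<mu>: "\<mu> \<noteq> 0" using p(2) by (simp add: \<mu>_def M_def)
    have "\<mu> * u \<in> Zset \<alpha>" if u: "u \<in> J" for u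
    proof -
      obtain y where "y \<in> Zset \<alpha>" "of_int M * u = ipoly p \<alpha> * y"
        using minimal_norm_divides_multiple[OF N J p u] unfolding M_def by blast
      then show ?thesis using p(2) by (simp add: \<mu>_def)
    qed
    moreover have "\<exists>x\<in>J. x \<noteq> 0" using J unfolding nonzero_ideals_iff by blast
    moreover have "\<mu> * x + \<mu> * y \<in> (*) \<mu> ` J" if "x \<in> J" "y \<in> J" for x y
      using nonzero_idealsD(2)[OF J that] by (metis distrib_left imageI)
    moreover have "r * (\<mu> * x) \<in> (*) \<mu> ` J" if "x \<in> J" "r \<in> Zset \<alpha>" for x r
      using nonzero_idealsD(3)[OF J that] by (metis mult.left_commute imageI)
    ultimately have "(*) \<mu> ` J \<in> nonzero_ideals \<alpha>"
      using \<mu> unfolding nonzero_ideals_iff by auto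
    moreover have "of_int M \<in> (*) \<mu> ` J"
      using p by (intro rev_image_eqI[OF p(1)]) (simp add: \<mu>_def)
    ultimately show "\<exists>J'. of_int M \<in> J' \<and> (J, J') \<in> ideal_equiv \<alpha>"
      using J \<mu> unfolding ideal_equiv_iff by blast
  qed
qed

text \<open>Such an ideal contains \<open>M\<close> times the order, so it is determined by which
  coefficient residues modulo \<open>M\<close> occur in it, a subset of a finite box.\<close>

lemma finite_ideals_containing:
  assumes M: "M > 0"
  shows "finite {J \<in> nonzero_ideals \<alpha>. of_int M \<in> J}" (is "finite ?S")
proof -
  define T where "T J = {(x, y, z). (x, y, z) \<in> {0..<M} \<times> {0..<M} \<times> {0..<M} \<and> ipoly [:x, y, z:] \<alpha> \<in> J}" for J
  have mem: "ipoly [:x, y, z:] \<alpha> \<in> J \<longleftrightarrow> (x mod M, y mod M, z mod M) \<in> T J"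
    if J: "J \<in> nonzero_ideals \<alpha>" "of_int M \<in> J" for J x y z
  proof -
    define w where "w = ipoly [:x div M, y div M, z div M:] \<alpha> * of_int M"
    have w: "w \<in> J" unfolding w_def by (rule nonzero_idealsD(3)[OF J ZsetI])
    have "[:x, y, z:] = [:x mod M, y mod M, z mod M:] + smult M [:x div M, y div M, z div M:]" by simp
    then have "ipoly [:x, y, z:] \<alpha> = ipoly [:x mod M, y mod M, z mod M:] \<alpha> + w"
      by (simp only: ipoly_add ipoly_smult w_def mult.commute)
    then have "ipoly [:x, y, z:] \<alpha> \<in> J \<longleftrightarrow> ipoly [:x mod M, y mod M, z mod M:] \<alpha> \<in> J"
      using nonzero_idealsD(2,5)[OF J(1) _ w] by (metis add_diff_cancel_right')
    then show ?thesis using M by (simp add: T_def)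
  qed
  have "inj_on T ?S"
  proof (rule inj_onI)
    have *: "u \<in> J'" if J: "J \<in> nonzero_ideals \<alpha>" "of_int M \<in> J" and J': "J' \<in> nonzero_ideals \<alpha>" "of_int M \<in> J'"
      and T: "T J = T J'" and u: "u \<in> J" for J J' u
    proof -
      obtain p where "u = ipoly p \<alpha>" using nonzero_idealsD(1)[OF J(1) u] unfolding Zset_def by blast
      then obtain x y z :: int where "u = of_int x + of_int y * \<alpha> + of_int z * \<alpha>\<^sup>2" using ipoly_reduce by blast
      then have "u = ipoly [:x, y, z:] \<alpha>" by (simp add: ipoly_pCons algebra_simps power2_eq_square)
      then show ?thesis using mem[OF J] mem[OF J'] T u by simp
    qed
    fix J J' assume "J \<in> ?S" "J' \<in> ?S" "T J = T J'"
    then show "J = J'" using *[of J J'] *[of J' J] by auto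
  qed
  moreover have "T ` ?S \<subseteq> Pow ({0..<M} \<times> {0..<M} \<times> {0..<M})"
    unfolding T_def by blast
  then have "finite (T ` ?S)"
    by (rule finite_subset) simp
  ultimately show ?thesis by (metis finite_imageD)
qed

lemma finite_ideal_classes: "finite (nonzero_ideals \<alpha> // ideal_equiv \<alpha>)"
proof -
  obtain M :: int where M: "M > 0"
    "\<And>J. J \<in> nonzero_ideals \<alpha> \<Longrightarrow> \<exists>J'. of_int M \<in> J' \<and> (J, J') \<in> ideal_equiv \<alpha>"
    using ideal_class_bounded_representatives by blast
  have "nonzero_ideals \<alpha> // ideal_equiv \<alpha> \<subseteq> (\<lambda>J. ideal_equiv \<alpha> `` {J}) ` {J \<in> nonzero_ideals \<alpha>. of_int M \<in> J}"
  proof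
    fix c assume "c \<in> nonzero_ideals \<alpha> // ideal_equiv \<alpha>"
    then obtain J where J: "J \<in> nonzero_ideals \<alpha>" "c = ideal_equiv \<alpha> `` {J}" by (rule quotientE)
    obtain J' where J': "of_int M \<in> J'" "(J, J') \<in> ideal_equiv \<alpha>" using M(2)[OF J(1)] by blast
    have "c = ideal_equiv \<alpha> `` {J'}" unfolding J(2) by (rule equiv_class_eq[OF equiv_ideal_equiv J'(2)])
    moreover have "J' \<in> nonzero_ideals \<alpha>" using J'(2) unfolding ideal_equiv_iff by blast
    ultimately show "c \<in> (\<lambda>J. ideal_equiv \<alpha> `` {J}) ` {J \<in> nonzero_ideals \<alpha>. of_int M \<in> J}" using J' by blast
  qed
  then show ?thesis by (rule finite_subset) (intro finite_imageI finite_ideals_containing M)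
qed

end

section \<open>Counting the surfaces\<close>

context inoue_lattice
begin

lemma act_compose_eq:
  "compose inoue_domain (act n r s) (act m r' s') =
     act (n + m) (\<alpha> powi n * r' + r) (\<beta> powi n * s' + s)"
proof (rule extensionalityI[where A = inoue_domain])
  fix x assume "x \<in> inoue_domain"
  then obtain w z where x: "x = (w, z)" "Im w > 0" by (cases x) (simp add: inoue_domain_iff)
  then show "compose inoue_domain (act n r s) (act m r' s') x =
      act (n + m) (\<alpha> powi n * r' + r) (\<beta> powi n * s' + s) x"
    using act_compose[OF x(2)] by (simp add: compose_def inoue_domain_iff del: inoue_act_apply)
qed (simp_all add: inoue_act_def)

lemma act_zero_eq: "act 0 0 0 = \<one>\<^bsub>BijGroup inoue_domain\<^esub>"
  by (auto simp: inoue_act_def BijGroup_def restrict_def fun_eq_iff)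

lemma act_in_Bij: "act n r s \<in> carrier (BijGroup inoue_domain)"
proof -
  have dom: "act n r s x \<in> inoue_domain" if "x \<in> inoue_domain" for n r s x
    using that alpha_powi_pos[of n] by (cases x) (simp add: inoue_domain_iff)
  have "bij_betw (act n r s) inoue_domain inoue_domain"
  proof (rule bij_betwI)
    show "act n r s \<in> inoue_domain \<rightarrow> inoue_domain"
      "inv_act n r s \<in> inoue_domain \<rightarrow> inoue_domain"
      using dom by blast+
  qed (use act_inverse in \<open>auto simp: inoue_domain_iff simp del: inoue_act_apply\<close>)
  then show ?thesis by (simp add: BijGroup_def Bij_def inoue_act_def)
qed

lemma act_mult:
  "act n r s \<otimes>\<^bsub>BijGroup inoue_domain\<^esub> act m r' s' =
     act (n + m) (\<alpha> powi n * r' + r) (\<beta> powi n * s' + s)"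
  using act_in_Bij[of n r s] act_in_Bij[of m r' s'] by (simp add: BijGroup_def act_compose_eq)

lemma act_inv:
  "inv\<^bsub>BijGroup inoue_domain\<^esub> (act n r s) =
     inv_act n r s"
proof (rule group.inv_equality[OF group_BijGroup _ act_in_Bij act_in_Bij])
  show "inv_act n r s \<otimes>\<^bsub>BijGroup inoue_domain\<^esub>
      act n r s = \<one>\<^bsub>BijGroup inoue_domain\<^esub>"
    unfolding act_mult act_zero_eq[symmetric] by simp
qed

lemma subgroup_inoue_maps: "subgroup (inoue_maps \<alpha> \<beta> L) (BijGroup inoue_domain)"
proof
  show "inoue_maps \<alpha> \<beta> L \<subseteq> carrier (BijGroup inoue_domain)"
    using act_in_Bij by (auto elim!: inoue_mapsE)
  show "\<one>\<^bsub>BijGroup inoue_domain\<^esub> \<in> inoue_maps \<alpha> \<beta> L"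
    unfolding act_zero_eq[symmetric] by (rule inoue_mapsI[OF zero_mem])
next
  fix f g assume "f \<in> inoue_maps \<alpha> \<beta> L" "g \<in> inoue_maps \<alpha> \<beta> L"
  then obtain n r s m r' s' where fg: "(r, s) \<in> L" "f = act n r s"
      "(r', s') \<in> L" "g = act m r' s'"
    by (elim inoue_mapsE)
  show "f \<otimes>\<^bsub>BijGroup inoue_domain\<^esub> g \<in> inoue_maps \<alpha> \<beta> L"
    unfolding fg act_mult by (intro inoue_mapsI add_mem powi_mem fg)
next
  fix f assume "f \<in> inoue_maps \<alpha> \<beta> L"
  then obtain n r s where f: "(r, s) \<in> L" "f = act n r s" by (elim inoue_mapsE)
  show "inv\<^bsub>BijGroup inoue_domain\<^esub> f \<in> inoue_maps \<alpha> \<beta> L"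
    unfolding f act_inv by (intro inoue_mapsI minus_mem powi_mem f)
qed

text \<open>The normal forms are closed under the group operations, which gives one inclusion. For
  the other, \<open>act n r s\<close> is a power of the homothety followed by a translation, and the
  translations available are the integer combinations of the generating ones.\<close>

lemma carrier_inoue_group:
  assumes L: "L = lattice_of a b"
  shows "carrier (inoue_group \<beta> a b) = inoue_maps \<alpha> \<beta> L"
proof -
  define gens where "gens = insert (inoue_homothety \<beta>) (range (inoue_translation a b))"
  define H where "H = generate (BijGroup inoue_domain) gens"
  have hom: "inoue_homothety \<beta> = act 1 0 0"
    by (simp add: inoue_homothety_def inoue_act_def norm_beta)
  have trans: "inoue_translation a b i = act 0 (a $ i) (b $ i)" for i
    by (simp add: inoue_translation_def inoue_act_def)
  have basis: "(a $ i, b $ i) \<in> L" for i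
    using lattice_ofI[of "\<lambda>j. if j = i then 1 else 0" a b] by (simp add: L if_distrib if_distribR sum.delta cong: if_cong)
  have gens: "gens \<subseteq> inoue_maps \<alpha> \<beta> L"
    unfolding gens_def hom trans using inoue_mapsI[OF zero_mem] inoue_mapsI[OF basis] by auto
  have "gens \<subseteq> carrier (BijGroup inoue_domain)" unfolding gens_def hom trans using act_in_Bij by blast
  then have sub: "subgroup H (BijGroup inoue_domain)"
    unfolding H_def by (rule group.generate_is_subgroup[OF group_BijGroup])
  have 1: "H \<subseteq> inoue_maps \<alpha> \<beta> L"
    unfolding H_def by (rule group.generate_subgroup_incl[OF group_BijGroup gens subgroup_inoue_maps])
  have t_zero: "act 0 0 0 \<in> H" unfolding act_zero_eq by (rule subgroup.one_closed[OF sub])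
  have t_add: "act 0 (r + r') (s + s') \<in> H"
    if "act 0 r s \<in> H" "act 0 r' s' \<in> H" for r s r' s'
    using subgroup.m_closed[OF sub that] by (simp add: act_mult add.commute)
  have t_minus: "act 0 (- r) (- s) \<in> H" if "act 0 r s \<in> H" for r s
    using subgroup.m_inv_closed[OF sub that] by (simp add: act_inv)
  have t_int: "act 0 (of_int k * r) (of_int k * s) \<in> H" if "act 0 r s \<in> H" for k r s
    by (rule int_multiple_closed[of "\<lambda>r s. act 0 r s \<in> H", OF t_zero t_add t_minus that])
  have t_basis: "act 0 (a $ i) (b $ i) \<in> H" for i
    unfolding H_def by (rule generate.incl) (simp add: gens_def flip: trans)
  have t: "act 0 r s \<in> H" if rs: "(r, s) \<in> L" for r s
  proof -
    obtain n where n: "r = int_comb n a" "s = int_comb n b"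
      using rs unfolding L by (rule lattice_ofE)
    show ?thesis unfolding n sum_3 by (intro t_add t_int t_basis)
  qed
  have h1: "act 1 0 0 \<in> H"
    unfolding H_def by (rule generate.incl) (simp add: gens_def hom)
  have h_nat: "act (int k) 0 0 \<in> H" for k
  proof (induction k)
    case (Suc k)
    show ?case using subgroup.m_closed[OF sub h1 Suc.IH] by (simp add: act_mult)
  qed (use t_zero in simp)
  have h: "act k 0 0 \<in> H" for k
  proof (cases "k \<ge> 0")
    case True
    then show ?thesis using h_nat[of "nat k"] by simp
  next
    case False
    then show ?thesis using subgroup.m_inv_closed[OF sub h_nat[of "nat (- k)"]] by (simp add: act_inv)
  qed
  have "inoue_maps \<alpha> \<beta> L \<subseteq> H"
  proof
    fix f assume "f \<in> inoue_maps \<alpha> \<beta> L"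
    then obtain n r s where f: "(r, s) \<in> L" "f = act n r s" by (elim inoue_mapsE)
    show "f \<in> H" using subgroup.m_closed[OF sub t[OF f(1)] h[of n]] by (simp add: act_mult f(2))
  qed
  with 1 have "H = inoue_maps \<alpha> \<beta> L" by blast
  then show ?thesis by (simp add: inoue_group_def H_def gens_def)
qed

end

section \<open>Characteristic polynomial and integrality of the matrix \<open>M\<close>\<close>

lemma inoue_diag_nth: "inoue_diag \<beta> $ i $ j = (if i = j then
    (if i = 1 then of_real (1 / (norm \<beta>)\<^sup>2) else if i = 2 then \<beta> else cnj \<beta>) else 0)"
  using exhaust_3[of i] by (auto simp: inoue_diag_def vector_3)

lemma poly_charpoly_3:
  fixes A :: "complex^3^3"
  shows "poly (charpoly A) x = det (mat x - A)"
  by (simp add: charpoly_def det_3 mat_def algebra_simps)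

text \<open>Conjugation by \<open>Q\<close> preserves the determinant of \<open>mat x - A\<close>.
  No cubic is fixed here, because the formula is used to show that \<open>\<beta>\<close> is a root
  of \<open>P\<close> in the first place.\<close>

lemma poly_charpoly_inoue_M:
  assumes ind: "independent_conj a b"
  shows "poly (charpoly (inoue_M \<beta> a b)) x = (x - of_real (1 / (norm \<beta>)\<^sup>2)) * (x - \<beta>) * (x - cnj \<beta>)"
proof -
  let ?Q = "inoue_Q a b" and ?R = "matrix_inv (inoue_Q a b)"
  note inv = inoue_Q_invertible[OF ind]
  have ldiff: "A ** (B - C) = A ** B - A ** C" and rdiff: "(B - C) ** A = B ** A - C ** A" for A B C :: "complex^3^3"
    by (simp_all add: vec_eq_iff matrix_matrix_mult_def sum_subtractf right_diff_distrib left_diff_distrib)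
  have scalar: "?Q ** mat x = mat x ** ?Q"
    by (simp add: vec_eq_iff matrix_matrix_mult_def mat_def if_distrib sum.delta if_distribR mult.commute cong: if_cong)
  have "?Q ** (mat x - inoue_diag \<beta>) ** ?R = mat x ** (?Q ** ?R) - ?Q ** inoue_diag \<beta> ** ?R"
    unfolding ldiff rdiff scalar by (simp add: matrix_mul_assoc)
  also have "\<dots> = mat x - inoue_M \<beta> a b" by (simp add: inv inoue_M_def)
  finally have "poly (charpoly (inoue_M \<beta> a b)) x = det (?Q ** (mat x - inoue_diag \<beta>) ** ?R)"
    by (simp add: poly_charpoly_3)
  also have "\<dots> = det (mat x - inoue_diag \<beta>) * det (?Q ** ?R)" by (simp add: det_mul)
  also have "\<dots> = det (mat x - inoue_diag \<beta>)" unfolding inv by simp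
  also have "\<dots> = (x - of_real (1 / (norm \<beta>)\<^sup>2)) * (x - \<beta>) * (x - cnj \<beta>)"
    by (simp add: det_3 mat_def inoue_diag_nth)
  finally show ?thesis .
qed

context cubic_roots
begin

text \<open>Read \<open>M Q = Q diag\<close> column by column: the first two columns are the
  relations for \<open>a\<close> and \<open>b\<close>, and the third is the conjugate of the second.
  Invertibility of \<open>Q\<close> recovers \<open>M\<close> from them.\<close>

lemma compatible_iff:
  "compatible \<beta> a b \<longleftrightarrow> independent_conj a b \<and>
     (\<exists>m. (\<forall>i. \<alpha> * a $ i = int_comb (m i) a) \<and>
          (\<forall>i. \<beta> * b $ i = int_comb (m i) b))"
proof (intro iffI conjI)
  assume c: "compatible \<beta> a b"
  then show ind: "independent_conj a b" by (simp add: compatible_def independent_conj_def)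
  have "\<forall>i j. \<exists>k :: int. inoue_M \<beta> a b $ i $ j = of_int k"
    using c unfolding compatible_def by (meson Ints_cases)
  then obtain m :: "3 \<Rightarrow> 3 \<Rightarrow> int" where m: "\<And>i j. inoue_M \<beta> a b $ i $ j = of_int (m i j)" by metis
  have eq: "inoue_M \<beta> a b ** inoue_Q a b = inoue_Q a b ** inoue_diag \<beta>"
    unfolding inoue_M_def by (simp add: matrix_mul_assoc[symmetric] inoue_Q_invertible[OF ind])
  have M: "(\<Sum>j\<in>UNIV. of_int (m i j) * inoue_Q a b $ j $ k) = (\<Sum>j\<in>UNIV. inoue_Q a b $ i $ j * inoue_diag \<beta> $ j $ k)" for i k
    using arg_cong[OF eq, of "\<lambda>M. M $ i $ k"] by (simp add: matrix_matrix_mult_def m)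
  have "of_real (\<alpha> * a $ i) = (of_real (int_comb (m i) a) :: complex)" for i
    using M[of i 1] by (simp add: inoue_diag_nth sum_3 norm_beta mult.commute)
  then have "\<alpha> * a $ i = int_comb (m i) a" for i by (simp only: of_real_eq_iff)
  moreover have "\<beta> * b $ i = int_comb (m i) b" for i
    using M[of i 2] by (simp add: inoue_diag_nth sum_3 mult.commute)
  ultimately show "\<exists>m. (\<forall>i. \<alpha> * a $ i = int_comb (m i) a) \<and>
      (\<forall>i. \<beta> * b $ i = int_comb (m i) b)" by blast
next
  assume "independent_conj a b \<and> (\<exists>m. (\<forall>i. \<alpha> * a $ i = int_comb (m i) a) \<and>
          (\<forall>i. \<beta> * b $ i = int_comb (m i) b))"
  then obtain m where ind: "independent_conj a b"
    and ma: "\<And>i. \<alpha> * a $ i = int_comb (m i) a"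
    and mb: "\<And>i. \<beta> * b $ i = int_comb (m i) b" by blast
  define M :: "complex^3^3" where "M = (\<chi> i j. of_int (m i j))"
  have ma': "of_real \<alpha> * of_real (a $ i) = (\<Sum>j\<in>UNIV. of_int (m i j) * of_real (a $ j) :: complex)" for i
    using arg_cong[OF ma[of i], of "of_real :: real \<Rightarrow> complex"] by simp
  have mb': "cnj \<beta> * cnj (b $ i) = (\<Sum>j\<in>UNIV. of_int (m i j) * cnj (b $ j))" for i
    using arg_cong[OF mb[of i], of cnj] by (simp add: cnj_sum)
  have "M ** inoue_Q a b = inoue_Q a b ** inoue_diag \<beta>"
    unfolding vec_eq_iff forall_3 using ma'[unfolded sum_3] mb[unfolded sum_3] mb'[unfolded sum_3]
    by (simp add: matrix_matrix_mult_def sum_3 M_def inoue_diag_nth norm_beta mult.commute)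
  then have "inoue_M \<beta> a b = M ** (inoue_Q a b ** matrix_inv (inoue_Q a b))"
    unfolding inoue_M_def by (simp add: matrix_mul_assoc)
  then have "inoue_M \<beta> a b = M" by (simp add: inoue_Q_invertible[OF ind])
  then show "compatible \<beta> a b" using ind by (simp add: compatible_def independent_conj_def M_def)
qed

lemma root_iff: "poly (map_poly of_int (inoue_cubic \<theta>1 \<theta>2)) x = 0 \<longleftrightarrow> x \<in> {of_real \<alpha>, \<beta>, cnj \<beta>}" for x :: complex
  unfolding poly_inoue_cubic cubic_factor by auto

lemma admissible_beta: "admissible \<beta>"
proof -
  have "{x. poly (map_poly of_int (inoue_cubic \<theta>1 \<theta>2)) x = 0} = {of_real (1 / (norm \<beta>)\<^sup>2), \<beta>, cnj \<beta>}"
    unfolding root_iff norm_beta by auto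
  then show ?thesis unfolding admissible_def using beta_nonreal norm_beta_lt_1 by blast
qed

lemma charpoly_inoue_M:
  assumes "compatible \<beta> a b"
  shows "charpoly (inoue_M \<beta> a b) = map_poly of_int (inoue_cubic \<theta>1 \<theta>2)"
proof -
  have ind: "independent_conj a b" using assms compatible_iff by blast
  have "poly (charpoly (inoue_M \<beta> a b)) = poly (map_poly of_int (inoue_cubic \<theta>1 \<theta>2))"
    unfolding poly_charpoly_inoue_M[OF ind] poly_inoue_cubic fun_eq_iff cubic_factor norm_beta by simp
  then show ?thesis by (simp only: poly_eq_poly_eq_iff)
qed

section \<open>Compatible pairs and the ideals they represent\<close>

lemma compatible_inoue_lattice:
  assumes "compatible \<beta> a b"
  shows "inoue_lattice \<theta>1 \<theta>2 \<alpha> \<beta> (lattice_of a b)"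
  using assms inoue_lattice_of unfolding compatible_iff by blast

text \<open>The match is only up to a nonzero factor in each coordinate, so a pair representing one
  ideal represents its whole class.\<close>

definition represents :: "real^3 \<Rightarrow> complex^3 \<Rightarrow> real set \<Rightarrow> bool" where
  "represents a b J \<longleftrightarrow> compatible \<beta> a b \<and> J \<in> nonzero_ideals \<alpha> \<and>
     (\<exists>c c'. c \<noteq> 0 \<and> c' \<noteq> 0 \<and> (\<forall>r s. (r, s) \<in> lattice_of a b \<longleftrightarrow> (c * r, c' * s) \<in> conj_lattice J))"

text \<open>An equality of polynomial values at \<open>\<alpha>\<close> transfers to
  \<open>\<beta>\<close>. Scaling the ideal by a quotient thus scales the complex coordinates by the
  conjugate quotient.\<close>

lemma conj_lattice_scale:
  assumes XY: "ipoly Y \<alpha> \<noteq> 0" and eq: "(*) (ipoly X \<alpha>) ` I = (*) (ipoly Y \<alpha>) ` J"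
    and J: "J \<in> nonzero_ideals \<alpha>" and rs: "(r, s) \<in> conj_lattice I"
  shows "(ipoly X \<alpha> / ipoly Y \<alpha> * r, ipoly X \<beta> / ipoly Y \<beta> * s) \<in> conj_lattice J"
proof -
  obtain p where p: "r = ipoly p \<alpha>" "s = ipoly p \<beta>" "ipoly p \<alpha> \<in> I" using rs unfolding conj_lattice_def by blast
  then obtain t where t: "t \<in> J" "ipoly X \<alpha> * ipoly p \<alpha> = ipoly Y \<alpha> * t" using eq by blast
  obtain q where q: "t = ipoly q \<alpha>" using nonzero_idealsD(1)[OF J t(1)] unfolding Zset_def by blast
  have "ipoly (X * p) \<alpha> = ipoly (Y * q) \<alpha>" using t(2) q by (simp add: ipoly_mult)
  then have "ipoly (X * p) \<beta> = ipoly (Y * q) \<beta>" using ipoly_eq_iff by blast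
  then have b: "ipoly X \<beta> * s = ipoly Y \<beta> * ipoly q \<beta>" by (simp add: ipoly_mult p)
  have "ipoly Y \<beta> \<noteq> 0" using XY ipoly_eq_0_iff by blast
  then have "ipoly X \<beta> / ipoly Y \<beta> * s = ipoly q \<beta>" using b by simp
  moreover have "ipoly X \<alpha> / ipoly Y \<alpha> * r = ipoly q \<alpha>" using t(2) XY by (simp add: p q)
  ultimately show ?thesis using t(1) q unfolding conj_lattice_def by blast
qed

lemma ideal_equiv_conj_lattice:
  assumes "(I, J) \<in> ideal_equiv \<alpha>"
  obtains c c' where "c \<noteq> 0" "c' \<noteq> 0" "\<And>r s. (r, s) \<in> conj_lattice I \<longleftrightarrow> (c * r, c' * s) \<in> conj_lattice J"
proof -
  obtain x y where IJ: "I \<in> nonzero_ideals \<alpha>" "J \<in> nonzero_ideals \<alpha>" "x \<in> Zset \<alpha>" "y \<in> Zset \<alpha>"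
    and xy: "x \<noteq> 0" "y \<noteq> 0" "(*) x ` I = (*) y ` J"
    using assms unfolding ideal_equiv_def Z_adjoin_simps by auto
  obtain X Y where XY: "x = ipoly X \<alpha>" "y = ipoly Y \<alpha>" using IJ unfolding Zset_def by blast
  have nz: "ipoly X \<alpha> \<noteq> 0" "ipoly Y \<alpha> \<noteq> 0" "ipoly X \<beta> \<noteq> 0" "ipoly Y \<beta> \<noteq> 0"
    using xy ipoly_eq_0_iff unfolding XY by blast+
  show ?thesis
  proof (rule that)
    show "ipoly X \<alpha> / ipoly Y \<alpha> \<noteq> 0" "ipoly X \<beta> / ipoly Y \<beta> \<noteq> 0" using nz by simp_all
    show "(r, s) \<in> conj_lattice I \<longleftrightarrow> (ipoly X \<alpha> / ipoly Y \<alpha> * r, ipoly X \<beta> / ipoly Y \<beta> * s) \<in> conj_lattice J" for r s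
      using conj_lattice_scale[OF nz(2) xy(3)[unfolded XY] IJ(2), of r s]
        conj_lattice_scale[OF nz(1) xy(3)[unfolded XY, symmetric] IJ(1),
          of "ipoly X \<alpha> / ipoly Y \<alpha> * r" "ipoly X \<beta> / ipoly Y \<beta> * s"] nz
      by auto
  qed
qed

lemma compatible_represents:
  assumes "compatible \<beta> a b"
  shows "\<exists>J\<in>nonzero_ideals \<alpha>. represents a b J"
proof -
  obtain m where m: "independent_conj a b" "\<And>i. \<alpha> * a $ i = int_comb (m i) a"
    "\<And>i. \<beta> * b $ i = int_comb (m i) b" using assms unfolding compatible_iff by blast
  obtain J c c' where "J \<in> nonzero_ideals \<alpha>" "c \<noteq> 0" "c' \<noteq> 0"
    "\<And>r s. (r, s) \<in> lattice_of a b \<longleftrightarrow> (c * r, c' * s) \<in> conj_lattice J"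
    by (rule lattice_of_normal_form[OF m]) blast
  then show ?thesis using assms unfolding represents_def by blast
qed

text \<open>A basis is available for an ideal containing a positive integer, so it is taken from an
  equivalent ideal containing \<open>M\<close>, and the equivalence carries the representation back
  to \<open>J\<close>.\<close>

lemma ideal_represented:
  assumes J: "J \<in> nonzero_ideals \<alpha>"
  shows "\<exists>a b. represents a b J"
proof -
  obtain M :: int where M: "M > 0"
    "\<And>J. J \<in> nonzero_ideals \<alpha> \<Longrightarrow> \<exists>J'. of_int M \<in> J' \<and> (J, J') \<in> ideal_equiv \<alpha>"
    using ideal_class_bounded_representatives by blast
  obtain J' where J': "of_int M \<in> J'" "(J, J') \<in> ideal_equiv \<alpha>" using M(2)[OF J] by blast
  have nz: "J' \<in> nonzero_ideals \<alpha>" using J'(2) unfolding ideal_equiv_iff by blast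
  obtain a b m where ab: "independent_conj a b" "\<And>i. \<alpha> * a $ i = int_comb (m i) a"
    "\<And>i. \<beta> * b $ i = int_comb (m i) b" "lattice_of a b = conj_lattice J'"
    by (rule ideal_basis[OF nz J'(1) M(1)]) blast
  have "(J', J) \<in> ideal_equiv \<alpha>" using equiv_ideal_equiv J'(2) by (metis equivE symD)
  then obtain c c' where "c \<noteq> 0" "c' \<noteq> 0" "\<And>r s. (r, s) \<in> conj_lattice J' \<longleftrightarrow> (c * r, c' * s) \<in> conj_lattice J"
    by (rule ideal_equiv_conj_lattice) blast
  moreover have "compatible \<beta> a b" unfolding compatible_iff using ab by blast
  ultimately show ?thesis unfolding represents_def ab(4)[symmetric] using J by blast
qed

lemma represents_fst:
  assumes "J \<in> nonzero_ideals \<alpha>" "c \<noteq> 0" "c' \<noteq> 0" "\<And>r s. (r, s) \<in> L \<longleftrightarrow> (c * r, c' * s) \<in> conj_lattice J"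
  shows "(*) c ` fst ` L = J"
proof (intro equalityI subsetI)
  fix x assume "x \<in> (*) c ` fst ` L"
  then obtain r s where "(r, s) \<in> L" "x = c * r" by force
  then show "x \<in> J" using assms(4)[of r s] unfolding conj_lattice_def by auto
next
  fix x assume x: "x \<in> J"
  then obtain p where p: "x = ipoly p \<alpha>" using nonzero_idealsD(1)[OF assms(1)] unfolding Zset_def by blast
  have "(c * (x / c), c' * (ipoly p \<beta> / c')) \<in> conj_lattice J"
    using x p assms(2,3) unfolding conj_lattice_def by auto
  then have "(x / c, ipoly p \<beta> / c') \<in> L" using assms(4) by blast
  then have "x / c \<in> fst ` L" by force
  then show "x \<in> (*) c ` fst ` L" by (intro image_eqI[of x "(*) c" "x / c"]) (use assms(2) in simp_all)
qed

lemma ideal_equiv_imp_biholomorphic: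
  assumes r: "represents a b J" and r': "represents a' b' J'" and JJ': "(J, J') \<in> ideal_equiv \<alpha>"
  shows "biholomorphic (inoue_surface \<beta> a b) (inoue_surface \<beta> a' b')"
proof -
  obtain c1 c1' where c1: "c1 \<noteq> 0" "c1' \<noteq> 0" "\<And>r s. (r, s) \<in> lattice_of a b \<longleftrightarrow> (c1 * r, c1' * s) \<in> conj_lattice J"
    and comp: "compatible \<beta> a b"
    using r unfolding represents_def by blast
  obtain c2 c2' where c2: "c2 \<noteq> 0" "c2' \<noteq> 0" "\<And>r s. (r, s) \<in> lattice_of a' b' \<longleftrightarrow> (c2 * r, c2' * s) \<in> conj_lattice J'"
    and comp': "compatible \<beta> a' b'"
    using r' unfolding represents_def by blast
  obtain d d' where d: "d \<noteq> 0" "d' \<noteq> 0" "\<And>r s. (r, s) \<in> conj_lattice J \<longleftrightarrow> (d * r, d' * s) \<in> conj_lattice J'"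
    using ideal_equiv_conj_lattice[OF JJ'] by blast
  interpret X: inoue_lattice \<theta>1 \<theta>2 \<alpha> \<beta> "lattice_of a b" by (rule compatible_inoue_lattice[OF comp])
  interpret Y: inoue_lattice \<theta>1 \<theta>2 \<alpha> \<beta> "lattice_of a' b'" by (rule compatible_inoue_lattice[OF comp'])
  have "(r, s) \<in> lattice_of a b \<longleftrightarrow> ((d * c1 / c2) * r, (d' * c1' / c2') * s) \<in> lattice_of a' b'" for r s
    unfolding c1(3) d(3) c2(3) using c2(1,2) by (simp add: mult.assoc)
  then show ?thesis
    unfolding inoue_surface_def
    using c1 c2 d
    by (intro X.scaled_lattices_biholomorphic[OF Y.inoue_lattice_axioms X.carrier_inoue_group[OF refl]
          Y.carrier_inoue_group[OF refl], of "d * c1 / c2" "d' * c1' / c2'"]) auto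
qed

end

text \<open>Stated outside the locale because two roots occur. The factor \<open>c2 * A / c1\<close>
  leads from \<open>J\<close> back to the first projected lattice, across to the second, and on to
  \<open>J'\<close>.\<close>

lemma biholomorphic_imp_ideal_equiv:
  assumes X: "cubic_roots \<theta>1 \<theta>2 \<alpha> \<beta>" and X': "cubic_roots \<theta>1 \<theta>2 \<alpha> \<beta>'"
    and r: "cubic_roots.represents \<alpha> \<beta> a b J" and r': "cubic_roots.represents \<alpha> \<beta>' a' b' J'"
    and bihol: "biholomorphic (inoue_surface \<beta> a b) (inoue_surface \<beta>' a' b')"
  shows "\<beta> = \<beta>' \<and> (J, J') \<in> ideal_equiv \<alpha>"
proof -
  interpret X: cubic_roots \<theta>1 \<theta>2 \<alpha> \<beta> by (rule X)
  interpret Y: cubic_roots \<theta>1 \<theta>2 \<alpha> \<beta>' by (rule X')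
  obtain c1 c1' where c1: "c1 \<noteq> 0" "c1' \<noteq> 0" "\<And>r s. (r, s) \<in> lattice_of a b \<longleftrightarrow> (c1 * r, c1' * s) \<in> X.conj_lattice J"
    and comp: "compatible \<beta> a b" and J: "J \<in> nonzero_ideals \<alpha>"
    using r unfolding X.represents_def by blast
  obtain c2 c2' where c2: "c2 \<noteq> 0" "c2' \<noteq> 0" "\<And>r s. (r, s) \<in> lattice_of a' b' \<longleftrightarrow> (c2 * r, c2' * s) \<in> Y.conj_lattice J'"
    and comp': "compatible \<beta>' a' b'" and J': "J' \<in> nonzero_ideals \<alpha>"
    using r' unfolding Y.represents_def by blast
  interpret XL: inoue_lattice \<theta>1 \<theta>2 \<alpha> \<beta> "lattice_of a b" by (rule X.compatible_inoue_lattice[OF comp])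
  interpret YL: inoue_lattice \<theta>1 \<theta>2 \<alpha> \<beta>' "lattice_of a' b'" by (rule Y.compatible_inoue_lattice[OF comp'])
  interpret inoue_lattice_pair \<theta>1 \<theta>2 \<alpha> \<beta> \<beta>' "lattice_of a b" "lattice_of a' b'" ..
  note scal = biholomorphic_imp_scaling[OF XL.carrier_inoue_group[OF refl] YL.carrier_inoue_group[OF refl]
      bihol[unfolded inoue_surface_def]]
  obtain A where A: "A \<noteq> 0" "(*) A ` fst ` lattice_of a b = fst ` lattice_of a' b'" using scal(2) by blast
  have "(*) (c2 * A / c1) ` J = (*) (c2 * A / c1) ` (*) c1 ` fst ` lattice_of a b"
    using X.represents_fst[OF J c1] by simp
  also have "\<dots> = (*) c2 ` (*) A ` fst ` lattice_of a b" using c1(1) by (simp add: image_image mult.assoc)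
  also have "\<dots> = J'" unfolding A(2) by (rule Y.represents_fst[OF J' c2])
  finally have "(J, J') \<in> ideal_equiv \<alpha>"
    unfolding ideal_equiv_iff using J J' A(1) c1(1) c2(1) by (intro conjI exI[of _ "c2 * A / c1"]) auto
  then show ?thesis using scal(1) by blast
qed

text \<open>Vieta's relations by divided differences: subtract the root equations in pairs and
  divide by the differences of the roots, which are distinct because \<open>\<beta>\<close> is not
  real.\<close>

lemma nonreal_root_cubic_roots:
  assumes \<alpha>: "poly (map_poly of_int (inoue_cubic \<theta>1 \<theta>2)) \<alpha> = 0" "\<alpha> > 1"
    and \<beta>: "poly (map_poly of_int (inoue_cubic \<theta>1 \<theta>2)) \<beta> = 0" "\<beta> \<notin> \<real>"
  shows "cubic_roots \<theta>1 \<theta>2 \<alpha> \<beta>"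
proof -
  define A B C s t where "A = (of_real \<alpha> :: complex)" and "B = \<beta>" and "C = cnj \<beta>"
    and "s = (of_int \<theta>2 :: complex)" and "t = (of_int \<theta>1 :: complex)"
  have "\<alpha> ^ 3 - of_int \<theta>2 * \<alpha>\<^sup>2 + of_int \<theta>1 * \<alpha> - 1 = 0" using \<alpha>(1) unfolding poly_inoue_cubic .
  from arg_cong[OF this, of "of_real :: real \<Rightarrow> complex"]
  have eA: "A ^ 3 - s * A\<^sup>2 + t * A - 1 = 0" by (simp add: A_def s_def t_def)
  have eB: "B ^ 3 - s * B\<^sup>2 + t * B - 1 = 0" using \<beta>(1) unfolding poly_inoue_cubic by (simp add: B_def s_def t_def)
  have eC: "C ^ 3 - s * C\<^sup>2 + t * C - 1 = 0"
    using arg_cong[OF eB, of cnj] by (simp add: B_def C_def s_def t_def)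
  have AB: "A \<noteq> B" using \<beta>(2) by (auto simp: A_def B_def)
  have BC: "B \<noteq> C" using \<beta>(2) by (metis B_def C_def Reals_cnj_iff)
  have AC: "A \<noteq> C" using AB by (metis A_def B_def C_def complex_cnj_cnj complex_cnj_complex_of_real)
  have "(A - B) * (A\<^sup>2 + A * B + B\<^sup>2 - s * (A + B) + t) = (A ^ 3 - s * A\<^sup>2 + t * A - 1) - (B ^ 3 - s * B\<^sup>2 + t * B - 1)"
    by (simp add: algebra_simps power2_eq_square power3_eq_cube)
  then have 1: "A\<^sup>2 + A * B + B\<^sup>2 - s * (A + B) + t = 0" using AB unfolding eA eB by simp
  have "(A - C) * (A\<^sup>2 + A * C + C\<^sup>2 - s * (A + C) + t) = (A ^ 3 - s * A\<^sup>2 + t * A - 1) - (C ^ 3 - s * C\<^sup>2 + t * C - 1)"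
    by (simp add: algebra_simps power2_eq_square power3_eq_cube)
  then have 2: "A\<^sup>2 + A * C + C\<^sup>2 - s * (A + C) + t = 0" using AC unfolding eA eC by simp
  have "(B - C) * (A + B + C - s) = (A\<^sup>2 + A * B + B\<^sup>2 - s * (A + B) + t) - (A\<^sup>2 + A * C + C\<^sup>2 - s * (A + C) + t)"
    by (simp add: algebra_simps power2_eq_square)
  then have v1: "s = A + B + C" using BC unfolding 1 2 by simp
  have v2: "t = A * (B + C) + B * C" using 1 unfolding v1 by (simp add: algebra_simps power2_eq_square)
  have v3: "A * (B * C) = 1" using eA unfolding v1 v2 by (simp add: algebra_simps power2_eq_square power3_eq_cube)
  show ?thesis
    by unfold_locales (use \<alpha> \<beta> v1 v2 v3 in \<open>simp_all add: A_def B_def C_def s_def t_def\<close>)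
qed

text \<open>A surface may have many representing ideals and an ideal many surfaces, so
  \<open>rep\<close> is a relation, and \<open>rel\<close> says that it becomes one-to-one on
  classes. That \<open>R\<close> behaves like an equivalence on \<open>S\<close> is inherited from
  \<open>e\<close> through \<open>rel\<close>.\<close>

lemma card_quotient_correspondence:
  assumes e: "equiv I e" and fin: "finite B" "finite (I // e)"
    and RS: "R \<subseteq> S \<times> S"
    and total: "\<And>x. x \<in> S \<Longrightarrow> \<exists>\<beta>\<in>B. \<exists>y\<in>I. rep x \<beta> y"
    and onto: "\<And>\<beta> y. \<beta> \<in> B \<Longrightarrow> y \<in> I \<Longrightarrow> \<exists>x\<in>S. rep x \<beta> y"
    and rel: "\<And>x x' \<beta> \<beta>' y y'. x \<in> S \<Longrightarrow> x' \<in> S \<Longrightarrow> \<beta> \<in> B \<Longrightarrow> \<beta>' \<in> B \<Longrightarrow> y \<in> I \<Longrightarrow> y' \<in> I \<Longrightarrow>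
      rep x \<beta> y \<Longrightarrow> rep x' \<beta>' y' \<Longrightarrow> (x, x') \<in> R \<longleftrightarrow> \<beta> = \<beta>' \<and> (y, y') \<in> e"
  shows "finite (S // R) \<and> card (S // R) = card B * card (I // e)"
proof -
  define f where "f = (\<lambda>(\<beta>, C). {x \<in> S. \<exists>y\<in>C. y \<in> I \<and> rep x \<beta> y})"
  have eI: "y' \<in> I" if "(y, y') \<in> e" for y y' using that e equiv_class_eq_iff by metis
  have key: "f (\<beta>, e `` {y}) = R `` {x}" if "\<beta> \<in> B" "y \<in> I" "x \<in> S" "rep x \<beta> y" for \<beta> y x
  proof (intro equalityI subsetI)
    fix x' assume "x' \<in> f (\<beta>, e `` {y})"
    then obtain y' where "x' \<in> S" "(y, y') \<in> e" "y' \<in> I" "rep x' \<beta> y'" by (auto simp: f_def)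
    then show "x' \<in> R `` {x}" using rel[of x x' \<beta> \<beta> y y'] that by auto
  next
    fix x' assume x': "x' \<in> R `` {x}"
    then have "x' \<in> S" using RS by blast
    then obtain \<beta>' y' where y': "\<beta>' \<in> B" "y' \<in> I" "rep x' \<beta>' y'" using total by blast
    then have "\<beta> = \<beta>'" "(y, y') \<in> e" using rel[of x x' \<beta> \<beta>' y y'] that x' \<open>x' \<in> S\<close> by auto
    then show "x' \<in> f (\<beta>, e `` {y})" using y' \<open>x' \<in> S\<close> by (auto simp: f_def)
  qed
  have "bij_betw f (B \<times> (I // e)) (S // R)"
  proof (rule bij_betwI')
    fix p p' assume p: "p \<in> B \<times> (I // e)" and p': "p' \<in> B \<times> (I // e)"
    obtain \<beta> y where y: "p = (\<beta>, e `` {y})" "\<beta> \<in> B" "y \<in> I" using p by (auto elim!: quotientE)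
    obtain \<beta>' y' where y': "p' = (\<beta>', e `` {y'})" "\<beta>' \<in> B" "y' \<in> I" using p' by (auto elim!: quotientE)
    show "(f p = f p') = (p = p')"
    proof
      assume eq: "f p = f p'"
      obtain x where x: "x \<in> S" "rep x \<beta> y" using onto y by blast
      have "(y, y) \<in> e" using e y(3) by (metis equivE refl_onD)
      then have "x \<in> f p" using x y by (auto simp: f_def)
      then have "x \<in> f p'" using eq by simp
      then obtain y'' where y'': "(y', y'') \<in> e" "y'' \<in> I" "rep x \<beta>' y''" using y'(1) by (auto simp: f_def)
      \<comment> \<open>The same \<open>x\<close> is represented by \<open>y\<close> and by
        \<open>y''\<close>. Applying \<open>rel\<close> to \<open>x\<close> twice gives first
        reflexivity and then equality of the two labels.\<close>
      have "(x, x) \<in> R" using rel[OF x(1) x(1) y(2) y(2) y(3) y(3) x(2) x(2)] \<open>(y, y) \<in> e\<close> by blast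
      then have "\<beta> = \<beta>'" "(y, y'') \<in> e"
        using rel[OF x(1) x(1) y(2) y'(2) y(3) y''(2) x(2) y''(3)] by blast+
      then show "p = p'" using y y' equiv_class_eq[OF e y''(1)] equiv_class_eq[OF e] by metis
    qed simp
  next
    fix p assume p: "p \<in> B \<times> (I // e)"
    obtain \<beta> y where y: "p = (\<beta>, e `` {y})" "\<beta> \<in> B" "y \<in> I" using p by (auto elim!: quotientE)
    obtain x where x: "x \<in> S" "rep x \<beta> y" using onto y by blast
    show "f p \<in> S // R" unfolding y(1) key[OF y(2,3) x] by (rule quotientI[OF x(1)])
  next
    fix Q assume "Q \<in> S // R"
    then obtain x where x: "x \<in> S" "Q = R `` {x}" by (rule quotientE)
    obtain \<beta> y where y: "\<beta> \<in> B" "y \<in> I" "rep x \<beta> y" using total[OF x(1)] by blast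
    show "\<exists>p\<in>B \<times> (I // e). Q = f p"
      using key[OF y(1,2) x(1) y(3)] x(2) y quotientI[of y I e] by (intro bexI[of _ "(\<beta>, e `` {y})"]) auto
  qed
  then show ?thesis
    using fin by (metis bij_betw_finite bij_betw_same_card card_cartesian_product finite_cartesian_product)
qed

theorem theorem4p10:
  fixes \<theta>1 \<theta>2 :: int and P :: "int poly" and \<alpha> :: real
  assumes "P = inoue_cubic \<theta>1 \<theta>2"
    and "poly (map_poly of_int P) \<alpha> = 0" and "\<alpha> > 1"
    and "card {x :: complex. poly (map_poly of_int P) x = 0 \<and> x \<notin> \<real>} = 2"
  shows "finite (inoue_classes P) \<and> card (inoue_classes P) = 2 * ideal_class_number \<alpha>"
proof -
  define B where "B = {x :: complex. poly (map_poly of_int P) x = 0 \<and> x \<notin> \<real>}"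
  define rep where "rep X \<beta> J \<longleftrightarrow> (\<exists>a b. X = inoue_surface \<beta> a b \<and> cubic_roots.represents \<alpha> \<beta> a b J)" for X \<beta> J
  have roots: "cubic_roots \<theta>1 \<theta>2 \<alpha> \<beta>" if "\<beta> \<in> B" for \<beta>
    using that assms by (intro nonreal_root_cubic_roots) (auto simp: B_def)
  have finB: "finite B" using assms(4) unfolding B_def[symmetric] by (intro card_ge_0_finite) simp
  \<comment> \<open>The class number does not mention \<open>\<beta>\<close>, but its finiteness is
    proved inside \<open>cubic_roots\<close>, which one nonreal root opens.\<close>
  then obtain \<beta>0 where "\<beta>0 \<in> B" using assms(4) unfolding B_def[symmetric] by fastforce
  \<comment> \<open>As an eigenvalue of \<open>M\<close>, \<open>\<beta>\<close> is a root of
    \<open>P\<close>, hence one of the two elements of \<open>B\<close>; this set supplies the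
    factor 2.\<close>
  have data: "\<beta> \<in> B" if ab: "admissible \<beta>" "compatible \<beta> a b" "charpoly (inoue_M \<beta> a b) = map_poly of_int P" for \<beta> a b
  proof -
    have "independent_conj a b" using ab(2) by (simp add: compatible_def independent_conj_def)
    then have "poly (map_poly of_int P) \<beta> = 0"
      using poly_charpoly_inoue_M[of a b \<beta> \<beta>] by (simp add: ab(3))
    then show ?thesis using ab(1) by (simp add: B_def admissible_def)
  qed
  have "finite (inoue_surfaces P // {(X, Y) \<in> inoue_surfaces P \<times> inoue_surfaces P. biholomorphic X Y}) \<and>
    card (inoue_surfaces P // {(X, Y) \<in> inoue_surfaces P \<times> inoue_surfaces P. biholomorphic X Y}) =
      card B * card (nonzero_ideals \<alpha> // ideal_equiv \<alpha>)"
  proof (rule card_quotient_correspondence[where rep = rep, OF equiv_ideal_equiv finB])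
    show "finite (nonzero_ideals \<alpha> // ideal_equiv \<alpha>)"
      by (rule cubic_roots.finite_ideal_classes[OF roots[OF \<open>\<beta>0 \<in> B\<close>]])
  next
    fix X assume "X \<in> inoue_surfaces P"
    then obtain \<beta> a b where ab: "X = inoue_surface \<beta> a b" "admissible \<beta>" "compatible \<beta> a b"
        "charpoly (inoue_M \<beta> a b) = map_poly of_int P"
      unfolding inoue_surfaces_def by blast
    have "\<beta> \<in> B" by (rule data[OF ab(2-4)])
    then show "\<exists>\<beta>\<in>B. \<exists>J\<in>nonzero_ideals \<alpha>. rep X \<beta> J"
      using cubic_roots.compatible_represents[OF roots ab(3)] ab(1) unfolding rep_def by blast
  next
    fix \<beta> J assume \<beta>: "\<beta> \<in> B" and J: "J \<in> nonzero_ideals \<alpha>"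
    interpret cubic_roots \<theta>1 \<theta>2 \<alpha> \<beta> by (rule roots[OF \<beta>])
    obtain a b where ab: "represents a b J" using ideal_represented[OF J] by blast
    then have "compatible \<beta> a b" unfolding represents_def by blast
    then have "inoue_surface \<beta> a b \<in> inoue_surfaces P"
      unfolding inoue_surfaces_def using admissible_beta charpoly_inoue_M assms(1) by blast
    then show "\<exists>X\<in>inoue_surfaces P. rep X \<beta> J" using ab unfolding rep_def by blast
  next
    fix X X' \<beta> \<beta>' J J'
    assume X: "X \<in> inoue_surfaces P" "X' \<in> inoue_surfaces P" and \<beta>: "\<beta> \<in> B" "\<beta>' \<in> B"
      and rep: "rep X \<beta> J" "rep X' \<beta>' J'"
    obtain a b a' b' where ab: "X = inoue_surface \<beta> a b" "cubic_roots.represents \<alpha> \<beta> a b J"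
        "X' = inoue_surface \<beta>' a' b'" "cubic_roots.represents \<alpha> \<beta>' a' b' J'"
      using rep unfolding rep_def by blast
    have "biholomorphic X X' \<longleftrightarrow> \<beta> = \<beta>' \<and> (J, J') \<in> ideal_equiv \<alpha>"
      using biholomorphic_imp_ideal_equiv[OF roots[OF \<beta>(1)] roots[OF \<beta>(2)] ab(2,4)]
        cubic_roots.ideal_equiv_imp_biholomorphic[OF roots[OF \<beta>(1)] ab(2), of a' b' J'] ab by blast
    then show "(X, X') \<in> {(X, Y) \<in> inoue_surfaces P \<times> inoue_surfaces P. biholomorphic X Y} \<longleftrightarrow>
        \<beta> = \<beta>' \<and> (J, J') \<in> ideal_equiv \<alpha>" using X by simp
  qed auto
  then show ?thesis
    using assms(4) unfolding inoue_classes_def ideal_class_number_def B_def by simp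
qed

end
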